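(* There exists a constant $0<L<\infty$ such that $$\lim_{t\to\infty}t^{-2\pi}\log\mathbb{P}\{-\beta_1\ge\log t\}=-L,$$ where $\beta_1$ is the renormalized self-intersection local time at time $1$ of planar Brownian motion started at $0$.
   Context: $X_t$ is a planar standard Brownian motion started at $0$. Let $\varphi$ be a smooth nonnegative Schwartz function on $\mathbb{R}^2$ with $\int\varphi=1$, $\varphi_\varepsilon(x)=\varepsilon^{-2}\varphi(x/\varepsilon)$, and $$\beta_t=\lim_{\varepsilon\to0}\Big[\int_0^t\int_0^s\varphi_\varepsilon(X_s-X_u)\,du\,ds-\mathbb{E}\int_0^t\int_0^s\varphi_\varepsilon(X_s-X_u)\,du\,ds\Big]$$ (the limit exists a.s.). *)

theory Defs
  imports "HOL-Probability.Probability"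
begin

definition partial2 :: "2 \<Rightarrow> (real^2 \<Rightarrow> real) \<Rightarrow> real^2 \<Rightarrow> real" where
  "partial2 i f x = (THE D. ((\<lambda>h. f (x + h *\<^sub>R axis i 1)) has_real_derivative D) (at 0))"

fun iter_pd :: "2 list \<Rightarrow> (real^2 \<Rightarrow> real) \<Rightarrow> real^2 \<Rightarrow> real" where
  "iter_pd [] f = f"
| "iter_pd (i # ds) f = partial2 i (iter_pd ds f)"

definition smooth2 :: "(real^2 \<Rightarrow> real) \<Rightarrow> bool" where
  "smooth2 f \<longleftrightarrow> (\<forall>ds. continuous_on UNIV (iter_pd ds f) \<and>
     (\<forall>i x. ((\<lambda>h. iter_pd ds f (x + h *\<^sub>R axis i 1)) has_real_derivative iter_pd (i # ds) f x) (at 0)))"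

definition schwartz2 :: "(real^2 \<Rightarrow> real) \<Rightarrow> bool" where
  "schwartz2 f \<longleftrightarrow> smooth2 f \<and> (\<forall>ds (k::nat). \<exists>C. \<forall>x. norm x ^ k * \<bar>iter_pd ds f x\<bar> \<le> C)"

definition gauss2 :: "real \<Rightarrow> real^2 \<Rightarrow> real" where
  "gauss2 s x = exp (- (norm x)\<^sup>2 / (2 * s)) / (2 * pi * s)"

definition planar_BM :: "'a measure \<Rightarrow> (real \<Rightarrow> 'a \<Rightarrow> real^2) \<Rightarrow> bool" where
  "planar_BM M X \<longleftrightarrow> prob_space M
     \<and> (\<forall>t. X t \<in> borel_measurable M)
     \<and> (\<forall>\<omega>\<in>space M. X 0 \<omega> = 0)
     \<and> (\<forall>\<omega>\<in>space M. continuous_on {0..} (\<lambda>t. X t \<omega>))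
     \<and> (\<forall>s t. 0 \<le> s \<and> s < t \<longrightarrow>
           distributed M lborel (\<lambda>\<omega>. X t \<omega> - X s \<omega>) (\<lambda>x. ennreal (gauss2 (t - s) x)))
     \<and> (\<forall>(n::nat) (tt::nat \<Rightarrow> real). 0 \<le> tt 0 \<and> (\<forall>i<n. tt i \<le> tt (Suc i)) \<longrightarrow>
           prob_space.indep_vars M (\<lambda>_. borel) (\<lambda>i \<omega>. X (tt (Suc i)) \<omega> - X (tt i) \<omega>) {..<n})"

definition moll :: "(real^2 \<Rightarrow> real) \<Rightarrow> real \<Rightarrow> real^2 \<Rightarrow> real" where
  "moll \<phi> \<epsilon> x = \<phi> ((1 / \<epsilon>) *\<^sub>R x) / \<epsilon>\<^sup>2"

definition SI_approx :: "(real^2 \<Rightarrow> real) \<Rightarrow> (real \<Rightarrow> 'a \<Rightarrow> real^2) \<Rightarrow> real \<Rightarrow> real \<Rightarrow> 'a \<Rightarrow> real" where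
  "SI_approx \<phi> X t \<epsilon> \<omega> =
     (LBINT s:{0..t}. (LBINT u:{0..s}. moll \<phi> \<epsilon> (X s \<omega> - X u \<omega>)))"

end

(*
  Self-intersections inside [0, s] and inside [s, 1] contribute two independent scaled copies of the
  functional, and the mutual intersections of the two pieces are nonnegative with expectation at most
  H(s) / (2 pi), H(s) = - s ln s - (1 - s) ln (1 - s).  Hence a(l) = ln E exp(- l beta) makes
  a(l) - l ln l / (2 pi) subadditive, and Fekete's lemma gives a(l) = l ln l / (2 pi) + kappa l + o(l).
  So the moments of Y = exp(- 2 pi beta) satisfy ln E Y^t = t ln t + kappa' t + o(t), and a Tauberian argument
  turns this into ln P(Y >= x) ~ - L x with L = exp(- 1 - kappa').
  That kappa is finite needs two bounds.  From above: the mutual intersection of the two halves has bounded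
  second moment, and dyadic halving with Hoelder's inequality gives E exp(- l beta) <= exp(K l^2).
  From below: under a drift of size sqrt l the expected self-intersection drops by about ln l / (2 pi),
  at the cost l in relative entropy.  All estimates hold for the mollified functionals, uniformly in the
  mollification.
*)
theory Submission
  imports Defs "HOL-Real_Asymp.Real_Asymp"
begin

section \<open>Subadditivity and exponential Tauberian theorem\<close>

text \<open>The mollified functional has a mean that diverges like a multiple of ln (1 /
  \<epsilon>), so nothing can be split before centring. At a fixed mollification, however, cutting
  the path is an exact identity: planar scaling turns a piece of length s into s times the
  functional at mollification \<epsilon> / sqrt s, and centring each piece by its own mean removes
  the divergence. What is left is the mean of the mutual intersections; it stays bounded since the
  density of an increment over time r is at most 1 / (2 pi r), and this 1 / (2 pi) is the origin of
  the exponent 2 pi. With a = l s and b = l (1 - s), l H(s) is (a + b) ln (a + b) - a ln a - b ln b,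
  the defect that subtracting l ln l / (2 pi) cancels. Letting \<epsilon> tend to 0 needs more than
  almost sure convergence: the moment bound at 2 l makes exp (l xi) uniformly integrable. The value
  of L comes from a Legendre transform: t ln t + \<kappa>' t - t ln x is minimal at t = L x, with
  value - L x. Independence and equality in law of the pieces are proved through paths frozen on
  grids, as functions of finitely many Gaussian increments.\<close>

lemma subadditive_multiple:
  fixes g :: "real \<Rightarrow> real"
  assumes sub: "\<And>s t. s > 0 \<Longrightarrow> t > 0 \<Longrightarrow> g (s + t) \<le> g s + g t"
    and "T > 0" "r > 0"
  shows "g (real n * T + r) \<le> real n * g T + g r"
proof (induction n)
  case (Suc n)
  have "g (real (Suc n) * T + r) = g (T + (real n * T + r))"
    by (simp add: algebra_simps)
  also have "\<dots> \<le> g T + g (real n * T + r)"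
    using assms by (intro sub) (auto intro: add_nonneg_pos)
  finally show ?case
    using Suc by (simp add: algebra_simps)
qed auto

text \<open>With t = n T + r and 0 < r \<le> T, \<open>g t / t\<close> is at most
  \<open>g T / T\<close> up to an error of order 1 / t, so the limit is the infimum. The bound from
  above on (0, T] controls the remainder \<open>g r\<close>, and the linear lower bound keeps the
  infimum finite.\<close>

lemma fekete_real:
  fixes g :: "real \<Rightarrow> real"
  assumes sub: "\<And>s t. s > 0 \<Longrightarrow> t > 0 \<Longrightarrow> g (s + t) \<le> g s + g t"
    and bdd: "\<And>T. \<exists>C. \<forall>t. 0 < t \<and> t \<le> T \<longrightarrow> g t \<le> C"
    and lower: "\<And>t. t \<ge> 1 \<Longrightarrow> g t \<ge> - D * t"
  shows "\<exists>\<kappa>. ((\<lambda>t. g t / t) \<longlongrightarrow> \<kappa>) at_top"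
proof -
  define A where "A = (\<lambda>t. g t / t) ` {1..}"
  have bb: "bdd_below A"
    unfolding A_def using lower by (intro bdd_belowI2[of _ "-D"]) (auto simp: field_simps)
  have ne: "A \<noteq> {}" unfolding A_def by auto
  have "((\<lambda>t. g t / t) \<longlongrightarrow> Inf A) at_top"
  proof (rule order_tendstoI)
    fix a assume a: "a < Inf A"
    show "\<forall>\<^sub>F t in at_top. a < g t / t"
      using eventually_ge_at_top[of "1::real"]
    proof eventually_elim
      case (elim t)
      have "Inf A \<le> g t / t"
        by (rule cInf_lower[OF _ bb]) (use elim in \<open>auto simp: A_def\<close>)
      thus ?case using a by simp
    qed
  next
    fix a assume a: "Inf A < a"
    then obtain w where w: "w \<in> A" "w < a"
      using cInf_less_iff[OF ne bb] by auto
    then obtain T where T: "T \<ge> 1" "w = g T / T" by (auto simp: A_def)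
    obtain C where C: "\<And>t. 0 < t \<Longrightarrow> t \<le> T \<Longrightarrow> g t \<le> C" using bdd[of T] by auto
    have "((\<lambda>t. w + (T * \<bar>w\<bar> + C) / t) \<longlongrightarrow> w + 0) at_top"
      by (intro tendsto_intros real_tendsto_divide_at_top[OF tendsto_const] filterlim_ident)
    hence ev: "\<forall>\<^sub>F t in at_top. w + (T * \<bar>w\<bar> + C) / t < a"
      using w(2) by (auto dest: order_tendstoD)
    show "\<forall>\<^sub>F t in at_top. g t / t < a"
      using ev eventually_gt_at_top[of T]
    proof eventually_elim
      case (elim t)
      \<comment> \<open>The ceiling minus one instead of the floor keeps the remainder
        \<open>r\<close> strictly positive, also when t is a multiple of T, since subadditivity is
        assumed only for positive arguments.\<close>
      define n where "n = nat (\<lceil>t / T\<rceil> - 1)"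
      define r where "r = t - real n * T"
      have tT: "t / T > 1" using elim T by (auto simp: field_simps)
      have n: "real n = of_int \<lceil>t / T\<rceil> - 1"
        unfolding n_def using tT by (simp add: le_ceiling_iff)
      have "real n < t / T" "t / T \<le> real n + 1" unfolding n by linarith+
      hence r: "r > 0" "r \<le> T" unfolding r_def using T by (auto simp: field_simps)
      have "g t = g (real n * T + r)" unfolding r_def by simp
      also have "\<dots> \<le> real n * g T + g r"
        using T r by (intro subadditive_multiple sub) auto
      also have "\<dots> \<le> real n * T * w + C"
      proof -
        have "g T = T * w" using T by simp
        thus ?thesis using C[OF r] by (simp add: mult.assoc)
      qed
      also have "real n * T * w = t * w - r * w" unfolding r_def by (simp add: algebra_simps)
      also have "- (r * w) \<le> T * \<bar>w\<bar>"
        using r by (smt (verit, best) abs_ge_zero mult_left_mono mult_minus_right mult_right_mono)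
      hence "t * w - r * w + C \<le> t * w + (T * \<bar>w\<bar> + C)" by simp
      finally have "g t / t \<le> (t * w + (T * \<bar>w\<bar> + C)) / t"
        using elim T by (intro divide_right_mono) auto
      also have "\<dots> = w + (T * \<bar>w\<bar> + C) / t"
        using elim T by (simp add: add_divide_distrib)
      finally have "g t / t \<le> w + (T * \<bar>w\<bar> + C) / t" .
      thus ?case using elim by simp
    qed
  qed
  thus ?thesis by blast
qed

section \<open>From exponential moments to tail probabilities\<close>

context prob_space
begin

lemma exp_chernoff:
  assumes [measurable]: "\<eta> \<in> borel_measurable M"
    and int: "integrable M (\<lambda>\<omega>. exp (t * \<eta> \<omega>))" and t: "t \<ge> 0"
  shows "prob {\<omega> \<in> space M. \<eta> \<omega> \<ge> x} \<le> exp (- t * x) * expectation (\<lambda>\<omega>. exp (t * \<eta> \<omega>))"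
proof -
  have "prob {\<omega> \<in> space M. \<eta> \<omega> \<ge> x} = expectation (indicator {\<omega> \<in> space M. \<eta> \<omega> \<ge> x})"
    by simp
  also have "\<dots> \<le> expectation (\<lambda>\<omega>. exp (- t * x) * exp (t * \<eta> \<omega>))"
  proof (rule integral_mono)
    fix \<omega> assume "\<omega> \<in> space M"
    show "indicator {\<omega> \<in> space M. \<eta> \<omega> \<ge> x} \<omega> \<le> exp (- t * x) * exp (t * \<eta> \<omega>)"
      using t mult_left_mono[of x "\<eta> \<omega>" t]
      by (auto simp: indicator_def simp flip: exp_add)
  qed (use int in \<open>auto simp: less_top[symmetric]\<close>)
  finally show ?thesis using int by simp
qed

text \<open>The lower bound follows from exponential tilting: under the weight \<open>exp (n * \<eta>)\<close> the variable
  \<open>exp \<eta>\<close> concentrates near \<open>n / L\<close>.\<close>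

lemma tauberian_exponential:
  fixes \<eta> :: "'a \<Rightarrow> real"
  assumes meas[measurable]: "\<eta> \<in> borel_measurable M"
    and int: "\<And>t. t > 0 \<Longrightarrow> integrable M (\<lambda>\<omega>. exp (t * \<eta> \<omega>))"
    and lim: "((\<lambda>t. (ln (expectation (\<lambda>\<omega>. exp (t * \<eta> \<omega>))) - t * ln t) / t) \<longlongrightarrow> \<kappa>) at_top"
  shows "((\<lambda>x. ln (prob {\<omega> \<in> space M. \<eta> \<omega> \<ge> ln x}) / x) \<longlongrightarrow> - exp (- 1 - \<kappa>)) at_top"
proof -
  \<comment> \<open>Chernoff's exponent t ln t + \<kappa> t - t ln x is minimal at t = L x, where it
    equals - L x; \<open>P_upper\<close> uses this t.\<close>
  define L where "L = exp (- 1 - \<kappa>)"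
  define E where "E = (\<lambda>t. expectation (\<lambda>\<omega>. exp (t * \<eta> \<omega>)))"
  define a where "a = (\<lambda>t. ln (E t))"
  define r where "r = (\<lambda>t. (a t - t * ln t) / t - \<kappa>)"
  define P where "P = (\<lambda>x. prob {\<omega> \<in> space M. \<eta> \<omega> \<ge> ln x})"
  have Lpos: "L > 0" and lnL: "ln L = - 1 - \<kappa>" unfolding L_def by auto
  have Epos: "E t > 0" if "t > 0" for t
  proof -
    have "0 \<le> E t" unfolding E_def by (intro integral_nonneg_AE) auto
    moreover have "E t \<noteq> 0"
    proof
      assume "E t = 0"
      hence "AE \<omega> in M. exp (t * \<eta> \<omega>) = 0"
        unfolding E_def using integral_nonneg_eq_0_iff_AE[OF int[OF that]] by simp
      thus False by simp
    qed
    ultimately show ?thesis by simp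
  qed
  have Eexp: "E t = exp (a t)" if "t > 0" for t
    unfolding a_def using Epos[OF that] by simp
  have a_eq: "a t = t * ln t + \<kappa> * t + t * r t" if "t > 0" for t
    unfolding r_def using that by (simp add: field_simps)
  have r0: "(r \<longlongrightarrow> 0) at_top"
    using tendsto_diff[OF lim tendsto_const[of \<kappa>]] unfolding r_def a_def E_def by simp
  have r0': "((\<lambda>x. r (c * x)) \<longlongrightarrow> 0) at_top" if "c > 0" for c
    by (rule filterlim_compose[OF r0])
       (use that in \<open>auto intro!: filterlim_tendsto_pos_mult_at_top filterlim_ident\<close>)
  have P_upper: "P x \<le> exp (L * x * (r (L * x) - 1))" if "x > 0" for x
  proof -
    have "P x \<le> exp (- (L * x) * ln x) * E (L * x)"
      unfolding P_def E_def using that Lpos by (intro exp_chernoff int) auto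
    also have "\<dots> = exp (a (L * x) - L * x * ln x)"
      using that Lpos by (simp add: Eexp exp_diff exp_minus field_simps)
    also have "a (L * x) - L * x * ln x = L * x * (r (L * x) - 1)"
      using that Lpos by (simp add: a_eq ln_mult lnL algebra_simps)
    finally show ?thesis .
  qed
  have P_lower: "\<forall>\<^sub>F x in at_top. P x > 0 \<and>
      ln (P x) / x \<ge> ln (1/2) / x - L / (1 - \<delta>) * (1 + ln (1 + \<delta>) - r (L / (1 - \<delta>) * x))"
    if \<delta>: "0 < \<delta>" "\<delta> < 1" for \<delta>
  proof -
    \<comment> \<open>The rates below are at most \<theta> (\<theta> - ln (1 + \<delta>)) and
      \<theta> (\<theta> + ln (1 - \<delta>)). Half of ln (1 + \<delta>) makes both negative,
      because ln (1 - \<delta>) < - ln (1 + \<delta>).\<close>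
    define \<theta> where "\<theta> = ln (1 + \<delta>) / 2"
    have \<theta>0: "\<theta> > 0" unfolding \<theta>_def using \<delta> by simp
    have "ln (1 + \<delta>) \<le> \<delta>" using \<delta> by (simp add: ln_add_one_self_le_self)
    hence \<theta>1: "\<theta> < 1" unfolding \<theta>_def using \<delta> by linarith
    have "(1 - \<delta>) * (1 + \<delta>) < 1" using \<delta> by (simp add: algebra_simps)
    hence "ln ((1 - \<delta>) * (1 + \<delta>)) < 0" using \<delta> by (subst ln_less_zero_iff) auto
    hence lnsum: "ln (1 - \<delta>) + ln (1 + \<delta>) < 0" using \<delta> by (simp add: ln_mult)
    \<comment> \<open>Exponential rates in n of the tilted mass above \<open>hi\<close> and below
      \<open>lo\<close>, from comparing the weight at n with the weights at (1 + \<theta>) n and (1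
      - \<theta>) n.\<close>
    define c1 where "c1 = (1 + \<theta>) * ln (1 + \<theta>) - \<theta> - \<theta> * ln (1 + \<delta>)"
    define c2 where "c2 = (1 - \<theta>) * ln (1 - \<theta>) + \<theta> + \<theta> * ln (1 - \<delta>)"
    have "(1 + \<theta>) * ln (1 + \<theta>) \<le> (1 + \<theta>) * \<theta>"
      using \<theta>0 by (intro mult_left_mono ln_add_one_self_le_self) auto
    hence "c1 \<le> \<theta> * (\<theta> - ln (1 + \<delta>))" unfolding c1_def by (simp add: algebra_simps)
    also have "\<dots> < 0" using \<theta>0 unfolding \<theta>_def by (intro mult_pos_neg) auto
    finally have c1: "c1 < 0" .
    have "ln (1 - \<theta>) \<le> - \<theta>" using ln_le_minus_one[of "1 - \<theta>"] \<theta>1 by simp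
    hence "(1 - \<theta>) * ln (1 - \<theta>) \<le> (1 - \<theta>) * (- \<theta>)"
      using \<theta>1 by (intro mult_left_mono) auto
    hence "c2 \<le> \<theta> * (\<theta> + ln (1 - \<delta>))" unfolding c2_def by (simp add: algebra_simps)
    also have "\<dots> < 0" using \<theta>0 lnsum unfolding \<theta>_def by (intro mult_pos_neg) auto
    finally have c2: "c2 < 0" .
    have quarter: "\<forall>\<^sub>F n in at_top. exp (n * h n) \<le> 1 / 4"
      if h: "(h \<longlongrightarrow> c) at_top" and c: "c < 0" for h :: "real \<Rightarrow> real" and c
    proof -
      have "filterlim (\<lambda>n. n * h n) at_bot at_top"
        using filterlim_tendsto_neg_mult_at_bot[OF h c filterlim_ident] by (simp add: mult.commute)
      hence "((\<lambda>n. exp (n * h n)) \<longlongrightarrow> 0) at_top"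
        by (rule filterlim_compose[OF exp_at_bot])
      hence "\<forall>\<^sub>F n in at_top. exp (n * h n) < 1 / 4"
        by (rule order_tendstoD) simp
      thus ?thesis by eventually_elim simp
    qed
    have "((\<lambda>n. c1 + (1 + \<theta>) * r ((1 + \<theta>) * n) - r n) \<longlongrightarrow> c1 + (1 + \<theta>) * 0 - 0) at_top"
      using \<theta>0 by (intro tendsto_intros r0' r0) auto
    hence q1: "\<forall>\<^sub>F n in at_top. exp (n * (c1 + (1 + \<theta>) * r ((1 + \<theta>) * n) - r n)) \<le> 1 / 4"
      using c1 by (intro quarter) auto
    have "((\<lambda>n. c2 + (1 - \<theta>) * r ((1 - \<theta>) * n) - r n) \<longlongrightarrow> c2 + (1 - \<theta>) * 0 - 0) at_top"
      using \<theta>1 by (intro tendsto_intros r0' r0) auto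
    hence q2: "\<forall>\<^sub>F n in at_top. exp (n * (c2 + (1 - \<theta>) * r ((1 - \<theta>) * n) - r n)) \<le> 1 / 4"
      using c2 by (intro quarter) auto
    \<comment> \<open>Each of the two tails carries at most a quarter of \<open>E n\<close>, so half
      of it is left for the window between \<open>lo\<close> and \<open>hi\<close>, where the weight
      is at most \<open>exp (n * hi)\<close>. Dividing by that weight bounds the probability from
      below.\<close>
    have main: "\<forall>\<^sub>F n in at_top. P ((1 - \<delta>) * n / L) \<ge> 1 / 2 * exp (n * (r n - 1 - ln (1 + \<delta>)))"
      using q1 q2 eventually_gt_at_top[of 0]
    proof eventually_elim
      case (elim n)
      define hi where "hi = ln ((1 + \<delta>) * n / L)"
      define lo where "lo = ln ((1 - \<delta>) * n / L)"
      have hi: "hi = ln (1 + \<delta>) + ln n + 1 + \<kappa>" and lo: "lo = ln (1 - \<delta>) + ln n + 1 + \<kappa>"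
        unfolding hi_def lo_def using \<delta> elim Lpos by (auto simp: ln_div ln_mult lnL)
      define p where "p = exp (- \<theta> * n * hi)"
      define q where "q = exp (\<theta> * n * lo)"
      have pw: "exp (n * \<eta> \<omega>) \<le> exp (n * hi) * indicator {\<omega> \<in> space M. \<eta> \<omega> \<ge> lo} \<omega>
          + p * exp ((1 + \<theta>) * n * \<eta> \<omega>) + q * exp ((1 - \<theta>) * n * \<eta> \<omega>)"
        if "\<omega> \<in> space M" for \<omega>
      proof -
        consider "\<eta> \<omega> < lo" | "\<eta> \<omega> \<ge> hi" | "\<eta> \<omega> \<ge> lo" "\<eta> \<omega> < hi" by linarith
        thus ?thesis
        proof cases
          case 1
          have "\<theta> * n * \<eta> \<omega> \<le> \<theta> * n * lo" using 1 \<theta>0 elim by (intro mult_left_mono) auto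
          hence "exp (n * \<eta> \<omega>) \<le> q * exp ((1 - \<theta>) * n * \<eta> \<omega>)"
            unfolding q_def exp_add[symmetric] by (simp add: algebra_simps)
          thus ?thesis unfolding p_def by (smt (verit) exp_ge_zero indicator_pos_le mult_nonneg_nonneg)
        next
          case 2
          have "\<theta> * n * \<eta> \<omega> \<ge> \<theta> * n * hi" using 2 \<theta>0 elim by (intro mult_left_mono) auto
          hence "exp (n * \<eta> \<omega>) \<le> p * exp ((1 + \<theta>) * n * \<eta> \<omega>)"
            unfolding p_def exp_add[symmetric] by (simp add: algebra_simps)
          thus ?thesis unfolding q_def by (smt (verit) exp_ge_zero indicator_pos_le mult_nonneg_nonneg)
        next
          case 3
          hence "exp (n * \<eta> \<omega>) \<le> exp (n * hi)" using elim by simp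
          thus ?thesis using 3 that unfolding p_def q_def
            by (simp add: add_nonneg_nonneg add.assoc add_increasing2)
        qed
      qed
      have int1: "integrable M (\<lambda>\<omega>. exp ((1 + \<theta>) * n * \<eta> \<omega>))" "integrable M (\<lambda>\<omega>. exp ((1 - \<theta>) * n * \<eta> \<omega>))"
        using \<theta>0 \<theta>1 elim by (auto intro!: int)
      have "E n \<le> expectation (\<lambda>\<omega>. exp (n * hi) * indicator {\<omega> \<in> space M. \<eta> \<omega> \<ge> lo} \<omega>
          + p * exp ((1 + \<theta>) * n * \<eta> \<omega>) + q * exp ((1 - \<theta>) * n * \<eta> \<omega>))"
        unfolding E_def using pw int[of n] int1 elim
        by (intro integral_mono integrable_add integrable_mult_right) (auto simp: less_top[symmetric])
      also have "\<dots> = exp (n * hi) * prob {\<omega> \<in> space M. \<eta> \<omega> \<ge> lo} + p * E ((1 + \<theta>) * n) + q * E ((1 - \<theta>) * n)"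
        unfolding E_def using int1 by (subst integral_add | simp add: less_top[symmetric])+
      finally have "E n \<le> exp (n * hi) * P ((1 - \<delta>) * n / L) + p * E ((1 + \<theta>) * n) + q * E ((1 - \<theta>) * n)"
        unfolding P_def lo_def .
      moreover have "p * E ((1 + \<theta>) * n) \<le> exp (a n) / 4"
      proof -
        have "p * E ((1 + \<theta>) * n) = exp (a ((1 + \<theta>) * n) - \<theta> * n * hi)"
          using \<theta>0 elim unfolding p_def by (simp add: Eexp flip: exp_add)
        also have "a ((1 + \<theta>) * n) - \<theta> * n * hi = a n + n * (c1 + (1 + \<theta>) * r ((1 + \<theta>) * n) - r n)"
          using \<theta>0 elim a_eq[of "(1 + \<theta>) * n", OF mult_pos_pos] a_eq[of n] ln_mult[of "1 + \<theta>" n]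
          unfolding c1_def hi by (simp only: algebra_simps) (simp add: algebra_simps)
        finally show ?thesis using elim by (simp add: exp_add)
      qed
      moreover have "q * E ((1 - \<theta>) * n) \<le> exp (a n) / 4"
      proof -
        have "q * E ((1 - \<theta>) * n) = exp (a ((1 - \<theta>) * n) + \<theta> * n * lo)"
          using \<theta>1 elim unfolding q_def by (simp add: Eexp flip: exp_add)
        also have "a ((1 - \<theta>) * n) + \<theta> * n * lo = a n + n * (c2 + (1 - \<theta>) * r ((1 - \<theta>) * n) - r n)"
          using \<theta>1 elim a_eq[of "(1 - \<theta>) * n", OF mult_pos_pos] a_eq[of n] ln_mult[of "1 - \<theta>" n]
          unfolding c2_def lo by (simp only: algebra_simps) (simp add: algebra_simps)
        finally show ?thesis using elim by (simp add: exp_add)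
      qed
      ultimately have "exp (n * hi) * P ((1 - \<delta>) * n / L) \<ge> exp (a n) / 2"
        using elim by (simp add: Eexp)
      hence "P ((1 - \<delta>) * n / L) \<ge> 1 / 2 * exp (a n - n * hi)"
        by (simp add: exp_diff field_simps)
      also have "a n - n * hi = n * (r n - 1 - ln (1 + \<delta>))"
        using elim unfolding hi by (simp add: a_eq algebra_simps)
      finally show ?case by simp
    qed
    have "filterlim (\<lambda>x. L / (1 - \<delta>) * x) at_top at_top"
      by (rule filterlim_tendsto_pos_mult_at_top[OF tendsto_const _ filterlim_ident]) (use Lpos \<delta> in simp)
    from eventually_compose_filterlim[OF main this] eventually_gt_at_top[of 0]
    show ?thesis
    proof eventually_elim
      case (elim x)
      define n where "n = L / (1 - \<delta>) * x"
      have x: "(1 - \<delta>) * n / L = x" unfolding n_def using \<delta> Lpos by simp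
      have Px: "P x \<ge> 1 / 2 * exp (n * (r n - 1 - ln (1 + \<delta>)))" using elim(1) unfolding n_def[symmetric] x .
      hence pos: "P x > 0" by (smt (verit) exp_gt_zero half_gt_zero_iff mult_pos_pos)
      have "ln (P x) \<ge> ln (1 / 2 * exp (n * (r n - 1 - ln (1 + \<delta>))))"
        using Px pos by (subst ln_le_cancel_iff) auto
      also have "ln (1 / 2 * exp (n * (r n - 1 - ln (1 + \<delta>)))) = ln (1 / 2) + n * (r n - 1 - ln (1 + \<delta>))"
        by (subst ln_mult) auto
      finally have "ln (P x) / x \<ge> (ln (1 / 2) + n * (r n - 1 - ln (1 + \<delta>))) / x"
        using elim by (simp add: divide_right_mono)
      also have "(ln (1 / 2) + n * (r n - 1 - ln (1 + \<delta>))) / x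
          = ln (1/2) / x - L / (1 - \<delta>) * (1 + ln (1 + \<delta>) - r n)"
        using elim \<delta> unfolding n_def by (simp add: field_simps)
      finally show ?case using pos unfolding n_def by simp
    qed
  qed
  have "((\<lambda>x. ln (P x) / x) \<longlongrightarrow> - L) at_top"
  proof (rule order_tendstoI)
    fix b assume b: "- L < b"
    have "((\<lambda>x. L * (r (L * x) - 1)) \<longlongrightarrow> L * (0 - 1)) at_top"
      by (intro tendsto_intros r0' Lpos)
    hence "\<forall>\<^sub>F x in at_top. L * (r (L * x) - 1) < b"
      using b by (intro order_tendstoD) auto
    thus "\<forall>\<^sub>F x in at_top. ln (P x) / x < b"
      using P_lower[of "1/2", simplified] eventually_gt_at_top[of 0]
    proof eventually_elim
      case (elim x)
      hence "ln (P x) \<le> L * x * (r (L * x) - 1)"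
        using P_upper[of x] by (metis ln_exp ln_le_cancel_iff exp_gt_zero)
      hence "ln (P x) / x \<le> L * (r (L * x) - 1)" using elim by (simp add: field_simps)
      thus ?case using elim by simp
    qed
  next
    fix b assume b: "b < - L"
    \<comment> \<open>The lower bound is available for each fixed \<delta>, so \<delta> is chosen
      first, close enough to 0 that the limit in x still exceeds b.\<close>
    have "((\<lambda>\<delta>. - (L / (1 - \<delta>) * (1 + ln (1 + \<delta>)))) \<longlongrightarrow> - (L / (1 - 0) * (1 + ln (1 + 0)))) (at_right 0)"
      by (intro tendsto_intros) auto
    hence "\<forall>\<^sub>F \<delta> in at_right 0. b < - (L / (1 - \<delta>) * (1 + ln (1 + \<delta>)))"
      using b by (intro order_tendstoD) auto
    moreover have "\<forall>\<^sub>F \<delta> in at_right (0::real). \<delta> \<in> {0<..<1}"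
      by (rule eventually_at_right_real) simp
    ultimately have "\<forall>\<^sub>F \<delta> in at_right 0. b < - (L / (1 - \<delta>) * (1 + ln (1 + \<delta>))) \<and> 0 < \<delta> \<and> \<delta> < 1"
      by eventually_elim auto
    then obtain \<delta> where \<delta>: "b < - (L / (1 - \<delta>) * (1 + ln (1 + \<delta>)))" "0 < \<delta>" "\<delta> < 1"
      using eventually_happens[of _ "at_right (0::real)"] by auto
    have "((\<lambda>x. ln (1/2) / x - L / (1 - \<delta>) * (1 + ln (1 + \<delta>) - r (L / (1 - \<delta>) * x)))
        \<longlongrightarrow> 0 - L / (1 - \<delta>) * (1 + ln (1 + \<delta>) - 0)) at_top"
      using \<delta> Lpos
      by (intro tendsto_intros r0' real_tendsto_divide_at_top[OF tendsto_const] filterlim_ident) auto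
    hence "\<forall>\<^sub>F x in at_top. b < ln (1/2) / x - L / (1 - \<delta>) * (1 + ln (1 + \<delta>) - r (L / (1 - \<delta>) * x))"
      using \<delta>(1) by (intro order_tendstoD) auto
    thus "\<forall>\<^sub>F x in at_top. b < ln (P x) / x"
      using P_lower[OF \<delta>(2,3)] by eventually_elim auto
  qed
  thus ?thesis unfolding P_def L_def .
qed

end

section \<open>Gaussian densities and singular integrals\<close>

lemma gauss2_nonneg: "s > 0 \<Longrightarrow> 0 \<le> gauss2 s x"
  by (simp add: gauss2_def)

lemma gauss2_le: "s > 0 \<Longrightarrow> gauss2 s x \<le> 1 / (2 * pi * s)"
  by (auto simp: gauss2_def divide_simps)

lemma continuous_on_gauss2: "continuous_on A (gauss2 s)"
  unfolding gauss2_def by (cases "s = 0") (auto intro!: continuous_intros)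

lemma borel_measurable_gauss2 [measurable]: "gauss2 s \<in> borel_measurable borel"
  by (rule borel_measurable_continuous_onI[OF continuous_on_gauss2])

lemma gauss2_measurable_pair [measurable (raw)]:
  assumes [measurable]: "f \<in> borel_measurable N" "g \<in> borel_measurable N"
  shows "(\<lambda>x. gauss2 (f x) (g x)) \<in> borel_measurable N"
  unfolding gauss2_def by measurable

lemma gauss2_scale: "c > 0 \<Longrightarrow> gauss2 (c\<^sup>2 * s) (c *\<^sub>R x) = gauss2 s x / c\<^sup>2"
  by (simp add: gauss2_def power_mult_distrib)

text \<open>Completing the square: the exponential weight of a drift moves the mean of a Gaussian
  increment over time \<open>r\<close> to \<open>r *\<^sub>R \<mu>\<close>.\<close>

lemma gauss2_tilt:
  assumes "r > 0"
  shows "gauss2 r y * exp (\<mu> \<bullet> y - (norm \<mu>)\<^sup>2 * r / 2) = gauss2 r (y - r *\<^sub>R \<mu>)"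
proof -
  have "(norm (y - r *\<^sub>R \<mu>))\<^sup>2 = (norm y)\<^sup>2 - 2 * r * (\<mu> \<bullet> y) + r\<^sup>2 * (norm \<mu>)\<^sup>2"
    unfolding power2_norm_eq_inner
    by (simp add: inner_diff_left inner_diff_right inner_commute algebra_simps power2_eq_square)
  hence "- (norm (y - r *\<^sub>R \<mu>))\<^sup>2 / (2 * r)
      = - (norm y)\<^sup>2 / (2 * r) + (2 * r * (\<mu> \<bullet> y)) / (2 * r) - (r\<^sup>2 * (norm \<mu>)\<^sup>2) / (2 * r)"
    by (simp add: add_divide_distrib diff_divide_distrib)
  also have "\<dots> = - (norm y)\<^sup>2 / (2 * r) + (\<mu> \<bullet> y - (norm \<mu>)\<^sup>2 * r / 2)"
    using assms by (simp add: power2_eq_square)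
  finally have "- (norm y)\<^sup>2 / (2 * r) + (\<mu> \<bullet> y - (norm \<mu>)\<^sup>2 * r / 2) = - (norm (y - r *\<^sub>R \<mu>))\<^sup>2 / (2 * r)" ..
  thus ?thesis unfolding gauss2_def by (simp flip: exp_add)
qed

lemma gauss2_drift:
  assumes "r > 0"
  shows "gauss2 r (- (r *\<^sub>R \<mu>)) = exp (- (norm \<mu>)\<^sup>2 * r / 2) / (2 * pi * r)"
proof -
  have "- (norm (- (r *\<^sub>R \<mu>)))\<^sup>2 / (2 * r) = - (norm \<mu>)\<^sup>2 * r / 2"
    using assms by (simp add: power_mult_distrib power2_eq_square)
  thus ?thesis by (simp only: gauss2_def)
qed

text \<open>The derivative has absolute value z exp (- z^2 / 2) / sqrt r with z = |x| / sqrt r, and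
  z \<le> 1 + z^2 / 2 \<le> exp (z^2 / 2).\<close>

lemma exp_neg_square_lipschitz:
  fixes a b r :: real
  assumes r: "r > 0"
  shows "\<bar>exp (- a\<^sup>2 / (2 * r)) - exp (- b\<^sup>2 / (2 * r))\<bar> \<le> \<bar>a - b\<bar> / sqrt r"
proof -
  have "norm (exp (- a\<^sup>2 / (2 * r)) - exp (- b\<^sup>2 / (2 * r))) \<le> 1 / sqrt r * norm (a - b)"
  proof (rule field_differentiable_bound[where S = UNIV and f' = "\<lambda>x. - (x / r) * exp (- x\<^sup>2 / (2 * r))"])
    fix x :: real
    show "((\<lambda>x. exp (- x\<^sup>2 / (2 * r))) has_field_derivative - (x / r) * exp (- x\<^sup>2 / (2 * r))) (at x within UNIV)"
      using r by (auto intro!: derivative_eq_intros simp: field_simps)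
    define z where "z = \<bar>x\<bar> / sqrt r"
    have z2: "z\<^sup>2 = x\<^sup>2 / r" unfolding z_def using r by (simp add: power_divide)
    have "z \<le> 1 + z\<^sup>2 / 2" using zero_le_power2[of "z - 1"] by (simp add: power2_eq_square algebra_simps)
    also have "\<dots> \<le> exp (z\<^sup>2 / 2)" by (rule exp_ge_add_one_self)
    finally have "z * exp (- (z\<^sup>2 / 2)) \<le> 1" by (simp add: exp_minus field_simps)
    moreover have "norm (- (x / r) * exp (- x\<^sup>2 / (2 * r))) = z * exp (- (z\<^sup>2 / 2)) / sqrt r"
    proof -
      have "norm (- (x / r) * exp (- x\<^sup>2 / (2 * r))) = \<bar>x\<bar> / (sqrt r * sqrt r) * exp (- (x\<^sup>2 / (2 * r)))"
        using r by (simp add: abs_mult)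
      also have "\<dots> = z * exp (- (z\<^sup>2 / 2)) / sqrt r"
        unfolding z2 by (simp add: z_def mult.commute)
      finally show ?thesis .
    qed
    ultimately show "norm (- (x / r) * exp (- x\<^sup>2 / (2 * r))) \<le> 1 / sqrt r"
      using r by (simp add: divide_right_mono)
  qed auto
  thus ?thesis by simp
qed

text \<open>The shift has length proportional to r, which cancels the 1 / r of the normalisation.
  What remains, 1 / sqrt r, is integrable over the triangle and uniform in y, so it dominates the
  effect of the drift at every mollification.\<close>

lemma gauss2_shift_bound:
  assumes r: "r > 0"
  shows "\<bar>gauss2 r y - gauss2 r (y - r *\<^sub>R \<mu>)\<bar> \<le> norm \<mu> / sqrt r"
proof -
  have "\<bar>exp (- (norm y)\<^sup>2 / (2 * r)) - exp (- (norm (y - r *\<^sub>R \<mu>))\<^sup>2 / (2 * r))\<bar>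
      \<le> \<bar>norm y - norm (y - r *\<^sub>R \<mu>)\<bar> / sqrt r"
    by (rule exp_neg_square_lipschitz[OF r])
  also have "\<bar>norm y - norm (y - r *\<^sub>R \<mu>)\<bar> \<le> norm (r *\<^sub>R \<mu>)"
    using norm_triangle_ineq3[of y "y - r *\<^sub>R \<mu>"] by simp
  finally have "\<bar>exp (- (norm y)\<^sup>2 / (2 * r)) - exp (- (norm (y - r *\<^sub>R \<mu>))\<^sup>2 / (2 * r))\<bar>
      \<le> r * norm \<mu> / sqrt r" using r by (simp add: divide_right_mono)
  hence "\<bar>exp (- (norm y)\<^sup>2 / (2 * r)) - exp (- (norm (y - r *\<^sub>R \<mu>))\<^sup>2 / (2 * r))\<bar> / (2 * pi * r)
      \<le> (r * norm \<mu> / sqrt r) / (2 * pi * r)" using r by (intro divide_right_mono) auto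
  moreover have "\<bar>gauss2 r y - gauss2 r (y - r *\<^sub>R \<mu>)\<bar> =
      \<bar>exp (- (norm y)\<^sup>2 / (2 * r)) - exp (- (norm (y - r *\<^sub>R \<mu>))\<^sup>2 / (2 * r))\<bar> / (2 * pi * r)"
    unfolding gauss2_def diff_divide_distrib[symmetric] abs_divide using r by simp
  ultimately have "\<bar>gauss2 r y - gauss2 r (y - r *\<^sub>R \<mu>)\<bar> \<le> (r * norm \<mu> / sqrt r) / (2 * pi * r)"
    by simp
  also have "\<dots> = (norm \<mu> / sqrt r) / (2 * pi)" using r by (simp add: field_simps)
  also have "\<dots> \<le> norm \<mu> / sqrt r"
  proof -
    have "norm \<mu> / sqrt r * 1 \<le> norm \<mu> / sqrt r * (2 * pi)"
      using r pi_ge_two by (intro mult_left_mono) auto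
    thus ?thesis by (subst pos_divide_le_eq) auto
  qed
  finally show ?thesis .
qed

lemma nn_integral_scale:
  fixes h :: "real^2 \<Rightarrow> ennreal"
  assumes [measurable]: "h \<in> borel_measurable borel" and e: "\<epsilon> > 0"
  shows "(\<integral>\<^sup>+x. h x \<partial>lborel) = (\<integral>\<^sup>+z. ennreal (\<epsilon>\<^sup>2) * h (\<epsilon> *\<^sub>R z) \<partial>lborel)"
proof -
  have "(\<integral>\<^sup>+z. h z \<partial>lborel) = (\<integral>\<^sup>+z. h z \<partial>density (distr lborel borel (\<lambda>x. 0 + \<epsilon> *\<^sub>R x)) (\<lambda>_. \<bar>\<epsilon>\<bar> ^ DIM(real^2)))"
    using e by (subst lborel_affine[of \<epsilon> 0]) auto
  also have "\<dots> = (\<integral>\<^sup>+z. ennreal (\<epsilon>\<^sup>2) * h (\<epsilon> *\<^sub>R z) \<partial>lborel)"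
    using e by (subst nn_integral_density, simp, simp, subst nn_integral_distr) (auto simp: power2_eq_square)
  finally show ?thesis .
qed

lemma nn_integral_translate:
  fixes h :: "real^2 \<Rightarrow> ennreal"
  assumes [measurable]: "h \<in> borel_measurable borel"
  shows "(\<integral>\<^sup>+x. h (x + c) \<partial>lborel) = (\<integral>\<^sup>+x. h x \<partial>lborel)"
proof -
  have "(\<integral>\<^sup>+x. h x \<partial>lborel) = (\<integral>\<^sup>+x. h x \<partial>distr lborel borel ((+) c))"
    by (simp add: lborel_distr_plus)
  also have "\<dots> = (\<integral>\<^sup>+x. h (x + c) \<partial>lborel)"
    by (subst nn_integral_distr) (auto simp: add.commute)
  finally show ?thesis ..
qed

section \<open>Integrals that are singular on the diagonal\<close>

lemma nn_integral_inverse_sqrt: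
  fixes a b c :: real
  assumes "a \<le> c" "c \<le> b"
  shows "(\<integral>\<^sup>+x. ennreal (1 / sqrt \<bar>x - c\<bar>) * indicator {a..b} x \<partial>lborel) \<le> ennreal (4 * sqrt (b - a))"
proof -
  have 1: "((\<lambda>x. 1 / sqrt \<bar>x - c\<bar>) has_integral (2 * sqrt (b - c) - 2 * sqrt (c - c))) {c..b}"
  proof (rule fundamental_theorem_of_calculus_interior[OF assms(2), where f = "\<lambda>x. 2 * sqrt (x - c)"])
    show "continuous_on {c..b} (\<lambda>x. 2 * sqrt (x - c))"
      by (intro continuous_on_mult_left continuous_on_real_sqrt continuous_on_diff continuous_on_id continuous_on_const)
    show "((\<lambda>x. 2 * sqrt (x - c)) has_vector_derivative 1 / sqrt \<bar>x - c\<bar>) (at x)" if "x \<in> {c<..<b}" for x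
    proof -
      have "((\<lambda>x. 2 * sqrt (x - c)) has_real_derivative 2 * (1 * (inverse (sqrt (x - c)) / 2))) (at x)"
        using that by (auto intro!: derivative_eq_intros)
      moreover have "\<bar>x - c\<bar> = x - c" using that by simp
      ultimately show ?thesis unfolding has_real_derivative_iff_has_vector_derivative[symmetric]
        by (simp add: inverse_eq_divide)
    qed
  qed
  have 2: "((\<lambda>x. 1 / sqrt \<bar>x - c\<bar>) has_integral (- 2 * sqrt (c - c) - (- 2 * sqrt (c - a)))) {a..c}"
  proof (rule fundamental_theorem_of_calculus_interior[OF assms(1), where f = "\<lambda>x. - 2 * sqrt (c - x)"])
    show "continuous_on {a..c} (\<lambda>x. - 2 * sqrt (c - x))"
      by (intro continuous_on_mult_left continuous_on_real_sqrt continuous_on_diff continuous_on_id continuous_on_const)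
    show "((\<lambda>x. - 2 * sqrt (c - x)) has_vector_derivative 1 / sqrt \<bar>x - c\<bar>) (at x)" if "x \<in> {a<..<c}" for x
    proof -
      have "((\<lambda>x. - 2 * sqrt (c - x)) has_real_derivative - 2 * ((0 - 1) * (inverse (sqrt (c - x)) / 2))) (at x)"
        using that by (auto intro!: derivative_eq_intros)
      moreover have "\<bar>x - c\<bar> = c - x" using that by simp
      ultimately show ?thesis unfolding has_real_derivative_iff_has_vector_derivative[symmetric]
        by (simp add: inverse_eq_divide)
    qed
  qed
  have "((\<lambda>x. 1 / sqrt \<bar>x - c\<bar>) has_integral 2 * sqrt (c - a) + 2 * sqrt (b - c)) {a..b}"
    using has_integral_combine[OF assms 2 1] by simp
  hence "(\<integral>\<^sup>+x. ennreal (1 / sqrt \<bar>x - c\<bar>) * indicator {a..b} x \<partial>lborel) = ennreal (2 * sqrt (c - a) + 2 * sqrt (b - c))"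
    by (intro nn_integral_has_integral_lebesgue') auto
  also have "\<dots> \<le> ennreal (4 * sqrt (b - a))"
  proof (rule ennreal_leI)
    have "sqrt (c - a) \<le> sqrt (b - a)" "sqrt (b - c) \<le> sqrt (b - a)" using assms by auto
    thus "2 * sqrt (c - a) + 2 * sqrt (b - c) \<le> 4 * sqrt (b - a)" by linarith
  qed
  finally show ?thesis .
qed

text \<open>Continuity up to 0 is what the antiderivative \<open>(v - s) * ln (v - s)\<close> needs
  at its left endpoint; the value \<open>0 * ln 0\<close> is 0 whatever \<open>ln 0\<close>
  is.\<close>

lemma continuous_on_xlnx: "continuous_on {0..} (\<lambda>x::real. x * ln x)"
  unfolding continuous_on_eq_continuous_within
proof
  fix x :: real assume "x \<in> {0..}"
  show "continuous (at x within {0..}) (\<lambda>x::real. x * ln x)"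
  proof (cases "x = 0")
    case True
    have "((\<lambda>x::real. x * ln x) \<longlongrightarrow> 0) (at_right 0)" by real_asymp
    thus ?thesis using True unfolding continuous_within by (simp add: at_within_Ici_at_right)
  next
    case False
    hence "isCont (\<lambda>x. x * ln x) x" by (intro isCont_mult isCont_ln continuous_ident)
    thus ?thesis by (rule continuous_at_imp_continuous_at_within)
  qed
qed

text \<open>Divided by 2 pi, the integrand is the largest value of the density of an increment over
  time v - u. The result is the entropy that enters the subadditivity.\<close>

lemma nn_integral_rectangle_inverse:
  fixes s :: real
  assumes s: "0 < s" "s < 1"
  shows "(\<integral>\<^sup>+v. (\<integral>\<^sup>+u. ennreal (1 / (v - u)) * indicator {0..s} u \<partial>lborel) * indicator {s..1} v \<partial>lborel)
      = ennreal (- (s * ln s) - (1 - s) * ln (1 - s))"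
proof -
  have inner: "(\<integral>\<^sup>+u. ennreal (1 / (v - u)) * indicator {0..s} u \<partial>lborel) = ennreal (ln v - ln (v - s))"
    if "v > s" for v
  proof -
    have "((\<lambda>u. 1 / (v - u)) has_integral (- ln (v - s) - (- ln (v - 0)))) {0..s}"
      using that s
      by (intro fundamental_theorem_of_calculus[where f = "\<lambda>u. - ln (v - u)"])
         (auto intro!: derivative_eq_intros simp: has_real_derivative_iff_has_vector_derivative[symmetric] divide_inverse)
    thus ?thesis using that s by (subst nn_integral_has_integral_lebesgue') auto
  qed
  have "(\<integral>\<^sup>+v. (\<integral>\<^sup>+u. ennreal (1 / (v - u)) * indicator {0..s} u \<partial>lborel) * indicator {s..1} v \<partial>lborel)
      = (\<integral>\<^sup>+v. ennreal (ln v - ln (v - s)) * indicator {s..1} v \<partial>lborel)"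
    using AE_lborel_singleton[of s]
  proof (intro nn_integral_cong_AE, eventually_elim)
    fix v :: real assume "v \<noteq> s"
    thus "(\<integral>\<^sup>+u. ennreal (1 / (v - u)) * indicator {0..s} u \<partial>lborel) * indicator {s..1} v
        = ennreal (ln v - ln (v - s)) * indicator {s..1} v"
      by (cases "v > s") (simp_all add: inner)
  qed
  \<comment> \<open>At v = s the integrand involves \<open>ln 0\<close> and its sign is not
    controlled; it is reset to 0 there, on a null set, so that it is nonnegative on the whole
    interval.\<close>
  also have "\<dots> = (\<integral>\<^sup>+v. ennreal (if v = s then 0 else ln v - ln (v - s)) * indicator {s..1} v \<partial>lborel)"
    using AE_lborel_singleton[of s] by (intro nn_integral_cong_AE, eventually_elim) simp
  also have "\<dots> = ennreal ((1 * ln 1 - (1 - s) * ln (1 - s)) - (s * ln s - (s - s) * ln (s - s)))"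
  proof (rule nn_integral_has_integral_lebesgue')
    have "((\<lambda>v. ln v - ln (v - s)) has_integral ((1 * ln 1 - (1 - s) * ln (1 - s)) - (s * ln s - (s - s) * ln (s - s)))) {s..1}"
    proof (rule fundamental_theorem_of_calculus_interior[where f = "\<lambda>v. v * ln v - (v - s) * ln (v - s)"])
      have 1: "continuous_on {s..1} (\<lambda>v. (v - s) * ln (v - s))"
        by (rule continuous_on_compose2[OF continuous_on_xlnx, of _ "\<lambda>v. v - s"]) (auto intro!: continuous_intros)
      show "continuous_on {s..1} (\<lambda>v. v * ln v - (v - s) * ln (v - s))"
        using s by (intro continuous_on_diff 1 continuous_intros) auto
      show "((\<lambda>v. v * ln v - (v - s) * ln (v - s)) has_vector_derivative ln x - ln (x - s)) (at x)"
        if "x \<in> {s<..<1}" for x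
      proof -
        have "x > 0" "x > s" using that s by auto
        thus ?thesis unfolding has_real_derivative_iff_has_vector_derivative[symmetric]
          by (auto intro!: derivative_eq_intros)
      qed
    qed (use s in auto)
    thus "((\<lambda>v. if v = s then 0 else ln v - ln (v - s)) has_integral
        ((1 * ln 1 - (1 - s) * ln (1 - s)) - (s * ln s - (s - s) * ln (s - s)))) {s..1}"
      by (rule has_integral_spike_finite[of "{s}", rotated 2]) auto
    show "0 \<le> (if v = s then 0 else ln v - ln (v - s))" if "v \<in> {s..1}" for v
    proof (cases "v = s")
      case False
      hence "ln (v - s) \<le> ln v" using that s by (intro ln_mono) auto
      thus ?thesis using False by simp
    qed simp
  qed
  finally show ?thesis by (simp add: algebra_simps)
qed

text \<open>The shift by \<delta> cuts off the diagonal singularity, and the double integral then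
  grows like - ln \<delta>. Taken at \<delta> = 2 / l it yields the ln l gained by the
  drift.\<close>

lemma nn_integral_triangle_shifted_inverse:
  fixes \<delta> :: real
  assumes \<delta>: "\<delta> > 0"
  shows "(\<integral>\<^sup>+v. (\<integral>\<^sup>+u. ennreal (1 / (v - u + \<delta>)) * indicator {0..v} u \<partial>lborel) * indicator {0..1} v \<partial>lborel)
      \<ge> ennreal (- ln \<delta> - 1)"
proof -
  have inner: "(\<integral>\<^sup>+u. ennreal (1 / (v - u + \<delta>)) * indicator {0..v} u \<partial>lborel) = ennreal (ln (v + \<delta>) - ln \<delta>)"
    if "v \<ge> 0" for v
  proof -
    have "((\<lambda>u. 1 / (v - u + \<delta>)) has_integral (- ln (v - v + \<delta>) - (- ln (v - 0 + \<delta>)))) {0..v}"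
      using that \<delta>
      by (intro fundamental_theorem_of_calculus[where f = "\<lambda>u. - ln (v - u + \<delta>)"])
         (auto intro!: derivative_eq_intros simp: has_real_derivative_iff_has_vector_derivative[symmetric] divide_inverse)
    thus ?thesis using that \<delta> by (subst nn_integral_has_integral_lebesgue') auto
  qed
  have "((\<lambda>v. ln (v + \<delta>) - ln \<delta>) has_integral (((1 + \<delta>) * ln (1 + \<delta>) - 1 - 1 * ln \<delta>) - ((0 + \<delta>) * ln (0 + \<delta>) - 0 - 0 * ln \<delta>))) {0..1}"
    using \<delta> by (intro fundamental_theorem_of_calculus[where f = "\<lambda>v. (v + \<delta>) * ln (v + \<delta>) - v - v * ln \<delta>"])
      (auto intro!: derivative_eq_intros simp: has_real_derivative_iff_has_vector_derivative[symmetric])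
  hence eq: "(\<integral>\<^sup>+v. ennreal (ln (v + \<delta>) - ln \<delta>) * indicator {0..1} v \<partial>lborel)
      = ennreal ((1 + \<delta>) * ln (1 + \<delta>) - 1 - ln \<delta> - \<delta> * ln \<delta>)"
    using \<delta> by (subst nn_integral_has_integral_lebesgue') auto
  have "\<delta> * ln \<delta> \<le> (1 + \<delta>) * ln (1 + \<delta>)"
  proof -
    have "\<delta> * ln \<delta> \<le> \<delta> * ln (1 + \<delta>)" using \<delta> by simp
    also have "\<dots> \<le> (1 + \<delta>) * ln (1 + \<delta>)" using \<delta> by (intro mult_right_mono) auto
    finally show ?thesis .
  qed
  hence "ennreal (- ln \<delta> - 1) \<le> (\<integral>\<^sup>+v. ennreal (ln (v + \<delta>) - ln \<delta>) * indicator {0..1} v \<partial>lborel)"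
    unfolding eq by (intro ennreal_leI) simp
  also have "\<dots> = (\<integral>\<^sup>+v. (\<integral>\<^sup>+u. ennreal (1 / (v - u + \<delta>)) * indicator {0..v} u \<partial>lborel) * indicator {0..1} v \<partial>lborel)"
  proof (intro nn_integral_cong)
    fix v :: real
    show "ennreal (ln (v + \<delta>) - ln \<delta>) * indicator {0..1} v =
      (\<integral>\<^sup>+u. ennreal (1 / (v - u + \<delta>)) * indicator {0..v} u \<partial>lborel) * indicator {0..1} v"
      by (cases "v \<ge> 0") (simp_all add: inner)
  qed
  finally show ?thesis .
qed

section \<open>Self-intersections of a path\<close>

lemma borel_measurable_fst_Pair [measurable (raw)]:
  fixes f :: "'c \<Rightarrow> 'a::second_countable_topology \<times> 'b::second_countable_topology"
  assumes "f \<in> borel_measurable M"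
  shows "(\<lambda>x. fst (f x)) \<in> borel_measurable M"
  by (rule measurable_compose[OF assms]) (intro borel_measurable_continuous_onI continuous_intros)

lemma borel_measurable_snd_Pair [measurable (raw)]:
  fixes f :: "'c \<Rightarrow> 'a::second_countable_topology \<times> 'b::second_countable_topology"
  assumes "f \<in> borel_measurable M"
  shows "(\<lambda>x. snd (f x)) \<in> borel_measurable M"
  by (rule measurable_compose[OF assms]) (intro borel_measurable_continuous_onI continuous_intros)

text \<open>Half-open in the first coordinate, which makes the decomposition in \<open>self_int_split\<close> an exact partition.\<close>

definition triangle :: "(real \<times> real) set" where
  "triangle = {p. 0 \<le> snd p \<and> snd p \<le> fst p \<and> fst p < 1}"

definition self_int :: "(real^2 \<Rightarrow> real) \<Rightarrow> (real \<Rightarrow> real^2) \<Rightarrow> real" where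
  "self_int f x = (\<integral>p. indicator triangle p * f (x (fst p) - x (snd p)) \<partial>lborel)"

definition cross_int :: "(real^2 \<Rightarrow> real) \<Rightarrow> real \<Rightarrow> (real \<Rightarrow> real^2) \<Rightarrow> real" where
  "cross_int f s x = (\<integral>p. indicator ({s..<1} \<times> {0..<s}) p * f (x (fst p) - x (snd p)) \<partial>lborel)"

text \<open>Brownian rescaling of the piece over [a, a + t] to unit time; the position at time a
  becomes the origin, so blocks depend on increments only.\<close>

definition block :: "real \<Rightarrow> real \<Rightarrow> (real \<Rightarrow> real^2) \<Rightarrow> real \<Rightarrow> real^2" where
  "block a t x r = (1 / sqrt t) *\<^sub>R (x (a + t * r) - x a)"

lemma triangle_measurable [measurable]: "triangle \<in> sets borel"
  unfolding triangle_def by measurable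

lemma emeasure_subset_unit_square:
  fixes A :: "(real \<times> real) set"
  assumes "A \<subseteq> {0..1} \<times> {0..1}"
  shows "emeasure lborel A < \<infinity>"
proof -
  have "A \<subseteq> cbox (0, 0) (1, 1)" using assms by (auto simp: cbox_Pair_eq)
  hence "bounded A" using bounded_cbox bounded_subset by blast
  thus ?thesis by (rule emeasure_bounded_finite)
qed

lemma emeasure_triangle: "emeasure lborel triangle < \<infinity>"
  by (rule emeasure_subset_unit_square) (auto simp: triangle_def)

lemma integrable_indicator_mult_bounded:
  fixes h :: "'b::euclidean_space \<Rightarrow> real"
  assumes [measurable]: "A \<in> sets borel" "h \<in> borel_measurable borel"
    and "emeasure lborel A < \<infinity>" and B: "\<And>p. \<bar>h p\<bar> \<le> B"
  shows "integrable lborel (\<lambda>p. indicator A p * h p)"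
proof (rule Bochner_Integration.integrable_bound)
  show "integrable lborel (\<lambda>p. B * indicator A p)"
    using assms by simp
  show "AE p in lborel. norm (indicator A p * h p) \<le> norm (B * indicator A p)"
    using B by (intro AE_I2) (auto simp: indicator_def abs_mult intro: order_trans[OF B])
qed simp

lemma lborel_integral_affine:
  fixes h :: "real \<times> real \<Rightarrow> real"
  assumes [measurable]: "h \<in> borel_measurable borel" and c: "c > 0"
  shows "(\<integral>p. h p \<partial>lborel) = c\<^sup>2 * (\<integral>p. h (t + c *\<^sub>R p) \<partial>lborel)"
proof -
  have "(\<integral>p. h p \<partial>lborel) = (\<integral>p. h p \<partial>density (distr lborel borel (\<lambda>x. t + c *\<^sub>R x)) (\<lambda>_. \<bar>c\<bar> ^ DIM(real \<times> real)))"
    using c by (subst lborel_affine[of c t]) auto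
  also have "\<dots> = (\<integral>p. c\<^sup>2 *\<^sub>R h p \<partial>distr lborel borel (\<lambda>x. t + c *\<^sub>R x))"
    using c by (subst integral_density) (auto simp: power2_eq_square)
  also have "\<dots> = c\<^sup>2 * (\<integral>p. h (t + c *\<^sub>R p) \<partial>lborel)"
    by (subst integral_scaleR_right, subst integral_distr) auto
  finally show ?thesis .
qed

lemma self_int_bounds:
  assumes "\<And>z. 0 \<le> f z" "\<And>z. f z \<le> B" and [measurable]: "f \<in> borel_measurable borel" "x \<in> borel_measurable borel"
  shows "0 \<le> self_int f x" "self_int f x \<le> B * measure lborel triangle"
proof -
  show "0 \<le> self_int f x"
    unfolding self_int_def using assms by (intro integral_nonneg_AE) auto
  have "self_int f x \<le> (\<integral>p. indicator triangle p * B \<partial>lborel)"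
    unfolding self_int_def using assms emeasure_triangle
    by (intro integral_mono integrable_indicator_mult_bounded[where B = B])
       (auto simp: abs_le_iff indicator_def intro: order_trans[OF _ assms(1)]
             intro!: order_trans[of 0 "f 0" B])
  thus "self_int f x \<le> B * measure lborel triangle" using emeasure_triangle by (simp add: mult.commute)
qed

lemma cross_int_nonneg: "(\<And>z. 0 \<le> f z) \<Longrightarrow> 0 \<le> cross_int f s x"
  unfolding cross_int_def by (intro integral_nonneg_AE) auto

text \<open>Substituting (a, a) + t p for p has Jacobian t^2; the spatial factor sqrt t is absorbed
  into the kernel.\<close>

lemma self_int_block:
  assumes c: "t > 0" and [measurable]: "f \<in> borel_measurable borel" "x \<in> borel_measurable borel"
  shows "t\<^sup>2 * self_int (\<lambda>z. f (sqrt t *\<^sub>R z)) (block a t x) =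
    (\<integral>p. indicator {p. a \<le> snd p \<and> snd p \<le> fst p \<and> fst p < a + t} p * f (x (fst p) - x (snd p)) \<partial>lborel)"
proof -
  have eq: "sqrt t *\<^sub>R (block a t x u - block a t x v) = x (a + t * u) - x (a + t * v)" for u v
    unfolding block_def scaleR_diff_right[symmetric] using c by simp
  have ind: "indicator triangle p = (indicator {p. a \<le> snd p \<and> snd p \<le> fst p \<and> fst p < a + t} ((a, a) + t *\<^sub>R p) :: real)" for p
    using c by (auto simp: indicator_def triangle_def zero_le_mult_iff)
  show ?thesis
    unfolding self_int_def eq ind
    by (subst (2) lborel_integral_affine[OF _ c, of _ "(a, a)"]) (use c in auto)
qed

text \<open>The triangle is the disjoint union of two smaller triangles and a rectangle, so the
  identity is exact for each single path.\<close>

lemma self_int_split: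
  assumes s: "0 < s" "s < 1" and [measurable]: "f \<in> borel_measurable borel" "x \<in> borel_measurable borel"
    and f: "\<And>z. \<bar>f z\<bar> \<le> B"
  shows "self_int f x = s\<^sup>2 * self_int (\<lambda>z. f (sqrt s *\<^sub>R z)) (block 0 s x)
    + (1 - s)\<^sup>2 * self_int (\<lambda>z. f (sqrt (1 - s) *\<^sub>R z)) (block s (1 - s) x) + cross_int f s x"
proof -
  let ?A = "{p. 0 \<le> snd p \<and> snd p \<le> fst p \<and> fst p < 0 + s} :: (real \<times> real) set"
  let ?B = "{p. s \<le> snd p \<and> snd p \<le> fst p \<and> fst p < s + (1 - s)} :: (real \<times> real) set"
  let ?C = "{s..<1} \<times> {0..<s}"
  let ?h = "\<lambda>p. f (x (fst p) - x (snd p))"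
  have [measurable]: "?A \<in> sets borel" "?B \<in> sets borel" "?C \<in> sets borel"
    by (auto intro!: borel_Times)
  have int: "integrable lborel (\<lambda>p. indicator ?A p * ?h p)" "integrable lborel (\<lambda>p. indicator ?B p * ?h p)"
    "integrable lborel (\<lambda>p. indicator ?C p * ?h p)"
    using s f by (auto intro!: integrable_indicator_mult_bounded[where B = B] emeasure_subset_unit_square)
  have "indicator triangle p = (indicator ?A p + indicator ?B p + indicator ?C p :: real)" for p :: "real \<times> real"
    using s by (cases p) (auto simp: indicator_def triangle_def)
  hence "self_int f x = (\<integral>p. indicator ?A p * ?h p + indicator ?B p * ?h p + indicator ?C p * ?h p \<partial>lborel)"
    unfolding self_int_def by (simp add: distrib_right)
  also have "\<dots> = (\<integral>p. indicator ?A p * ?h p \<partial>lborel) + (\<integral>p. indicator ?B p * ?h p \<partial>lborel) + (\<integral>p. indicator ?C p * ?h p \<partial>lborel)"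
    using int by simp
  finally show ?thesis
    unfolding cross_int_def using s by (subst (1 2) self_int_block) auto
qed

text \<open>Fubini turns the integral over the triangle into the iterated one. The path
  \<open>x\<close> may differ from X at negative times, which the iterated integral never
  visits.\<close>

lemma SI_approx_eq_self_int:
  assumes f: "continuous_on UNIV (moll \<phi> \<epsilon>)" "\<And>z. \<bar>moll \<phi> \<epsilon> z\<bar> \<le> B"
    and x: "continuous_on UNIV (\<lambda>t. x t)" "\<And>t. t \<ge> 0 \<Longrightarrow> X t \<omega> = x t"
  shows "SI_approx \<phi> X 1 \<epsilon> \<omega> = self_int (moll \<phi> \<epsilon>) x"
proof -
  let ?h = "\<lambda>p. moll \<phi> \<epsilon> (x (fst p) - x (snd p))"
  have [measurable]: "moll \<phi> \<epsilon> \<in> borel_measurable borel" "x \<in> borel_measurable borel"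
    using f x by (auto intro: borel_measurable_continuous_onI)
  have "integrable lborel (\<lambda>p. indicator triangle p * ?h p)"
    using f emeasure_triangle by (intro integrable_indicator_mult_bounded[where B = B]) auto
  hence int: "integrable (lborel \<Otimes>\<^sub>M lborel) (\<lambda>p. indicator triangle p * ?h p)"
    unfolding lborel_prod .
  have "self_int (moll \<phi> \<epsilon>) x = (\<integral>p. indicator triangle p * ?h p \<partial>(lborel \<Otimes>\<^sub>M lborel))"
    unfolding self_int_def lborel_prod ..
  also have "\<dots> = (\<integral>v. (\<integral>u. indicator triangle (v, u) * ?h (v, u) \<partial>lborel) \<partial>lborel)"
    using lborel_pair.integral_fst'[OF int] by simp
  also have "\<dots> = (\<integral>v. indicator {0..1} v * (\<integral>u. indicator {0..v} u * ?h (v, u) \<partial>lborel) \<partial>lborel)"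
  proof (rule integral_cong_AE)
    show "AE v in lborel. (\<integral>u. indicator triangle (v, u) * ?h (v, u) \<partial>lborel) =
      indicator {0..1} v * (\<integral>u. indicator {0..v} u * ?h (v, u) \<partial>lborel)"
      \<comment> \<open>\<open>triangle\<close> omits the edge where the later time is 1, whereas
        \<open>SI_approx\<close> integrates over closed intervals.\<close>
      using AE_lborel_singleton[of 1]
    proof eventually_elim
      case (elim v)
      have "indicator triangle (v, u) = (indicator {0..1} v * indicator {0..v} u :: real)" for u
        using elim by (auto simp: triangle_def indicator_def)
      thus ?case by (simp add: mult.assoc)
    qed
    have "(\<lambda>v. indicator {0..1} v * (\<integral>u. indicator {w. 0 \<le> fst w \<and> fst w \<le> snd w} (u, v) * ?h (v, u) \<partial>lborel)) \<in> borel_measurable lborel"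
      by measurable
    moreover have "indicator {w. 0 \<le> fst w \<and> fst w \<le> snd w} (u, v) = (indicator {0..v} u :: real)" for u v :: real
      by (simp add: indicator_def)
    ultimately show "(\<lambda>v. indicator {0..1} v * (\<integral>u. indicator {0..v} u * ?h (v, u) \<partial>lborel)) \<in> borel_measurable lborel"
      by simp
  qed measurable
  also have "\<dots> = (LBINT v:{0..1}. (LBINT u:{0..v}. ?h (v, u)))"
    unfolding set_lebesgue_integral_def by simp
  also have "\<dots> = SI_approx \<phi> X 1 \<epsilon> \<omega>"
    unfolding SI_approx_def set_lebesgue_integral_def
    by (intro Bochner_Integration.integral_cong refl) (auto simp: indicator_def x intro!: Bochner_Integration.integral_cong)
  finally show ?thesis ..
qed

text \<open>Freezing the path on the grid of mesh \<open>1 / n\<close> turns \<open>self_int\<close> into a function of \<open>n\<close> increments.\<close>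

definition step_walk :: "nat \<Rightarrow> (nat \<Rightarrow> real^2) \<Rightarrow> real \<Rightarrow> real^2" where
  "step_walk n \<delta> t = (\<Sum>i<n. if real (Suc i) \<le> real n * t then \<delta> i else 0)"

definition increments :: "nat \<Rightarrow> (real \<Rightarrow> real^2) \<Rightarrow> nat \<Rightarrow> real^2" where
  "increments n x i = x (real (Suc i) / real n) - x (real i / real n)"

lemma step_walk_measurable [measurable]: "step_walk n \<delta> \<in> borel_measurable borel"
  unfolding step_walk_def by measurable

text \<open>A step counts only once its whole grid interval has elapsed, so the sum telescopes to
  the last grid point not after t.\<close>

lemma step_walk_increments:
  assumes "n > 0" "0 \<le> t" "t \<le> 1"
  shows "step_walk n (increments n x) t = x (of_int \<lfloor>real n * t\<rfloor> / real n) - x 0"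
proof -
  define k where "k = nat \<lfloor>real n * t\<rfloor>"
  have k: "real k = of_int \<lfloor>real n * t\<rfloor>" unfolding k_def using assms by simp
  have "real n * t \<le> real n" using assms by (simp add: mult_left_le)
  hence "\<lfloor>real n * t\<rfloor> \<le> int n" by linarith
  hence kn: "k \<le> n" unfolding k_def by simp
  have iff: "real (Suc i) \<le> real n * t \<longleftrightarrow> i < k" for i
  proof -
    have "real (Suc i) \<le> real n * t \<longleftrightarrow> int (Suc i) \<le> \<lfloor>real n * t\<rfloor>" by (simp add: le_floor_iff)
    also have "\<dots> \<longleftrightarrow> i < k" unfolding k_def by (auto simp: nat_less_iff zless_nat_eq_int_zless)
    finally show ?thesis .
  qed
  have "step_walk n (increments n x) t = (\<Sum>i\<in>{..<n} \<inter> {i. i < k}. increments n x i)"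
    unfolding step_walk_def iff by (subst sum.inter_filter[symmetric]) (auto intro!: sum.cong)
  also have "{..<n} \<inter> {i. i < k} = {..<k}" using kn by auto
  also have "(\<Sum>i<k. increments n x i) = x (real k / real n) - x (real 0 / real n)"
    unfolding increments_def by (rule sum_lessThan_telescope)
  finally show ?thesis by (simp add: k)
qed

lemma floor_grid_limit: "(\<lambda>n. of_int \<lfloor>real (Suc n) * t\<rfloor> / real (Suc n)) \<longlonglongrightarrow> (t::real)"
proof (rule tendsto_sandwich)
  show "\<forall>\<^sub>F n in sequentially. t - 1 / real (Suc n) \<le> of_int \<lfloor>real (Suc n) * t\<rfloor> / real (Suc n)"
  proof (intro always_eventually allI)
    fix n
    have "real (Suc n) * t - 1 \<le> of_int \<lfloor>real (Suc n) * t\<rfloor>" by linarith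
    hence "(real (Suc n) * t - 1) / real (Suc n) \<le> of_int \<lfloor>real (Suc n) * t\<rfloor> / real (Suc n)"
      by (intro divide_right_mono) auto
    thus "t - 1 / real (Suc n) \<le> of_int \<lfloor>real (Suc n) * t\<rfloor> / real (Suc n)"
      by (simp add: diff_divide_distrib del: of_nat_Suc)
  qed
  show "\<forall>\<^sub>F n in sequentially. of_int \<lfloor>real (Suc n) * t\<rfloor> / real (Suc n) \<le> t"
  proof (intro always_eventually allI)
    fix n
    have "of_int \<lfloor>real (Suc n) * t\<rfloor> \<le> real (Suc n) * t" by linarith
    thus "of_int \<lfloor>real (Suc n) * t\<rfloor> / real (Suc n) \<le> t"
      by (simp add: divide_le_eq mult.commute del: of_nat_Suc)
  qed
  have "(\<lambda>n. t - 1 / real (Suc n)) \<longlonglongrightarrow> t - 0"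
    using LIMSEQ_inverse_real_of_nat by (intro tendsto_diff tendsto_const) (simp add: inverse_eq_divide)
  thus "(\<lambda>n. t - 1 / real (Suc n)) \<longlonglongrightarrow> t" by simp
qed auto

lemma step_walk_limit:
  assumes x: "continuous_on UNIV x" and t: "0 \<le> t" "t \<le> 1"
  shows "(\<lambda>n. step_walk (Suc n) (increments (Suc n) x) t) \<longlonglongrightarrow> x t - x 0"
proof -
  note floor_grid_limit[of t]
  hence "(\<lambda>n. x (of_int \<lfloor>real (Suc n) * t\<rfloor> / real (Suc n))) \<longlonglongrightarrow> x t"
    using x by (intro isCont_tendsto_compose[of t x]) (auto simp: continuous_on_eq_continuous_at)
  hence "(\<lambda>n. x (of_int \<lfloor>real (Suc n) * t\<rfloor> / real (Suc n)) - x 0) \<longlonglongrightarrow> x t - x 0"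
    by (intro tendsto_diff tendsto_const)
  thus ?thesis using t by (subst step_walk_increments) auto
qed

text \<open>Convergence at every point of the triangle follows from continuity of the path; the
  starting point of \<open>x\<close>, absent from the walk, cancels in differences. The bound on f
  and the finite area of the triangle give domination.\<close>

lemma self_int_limit:
  assumes f: "continuous_on UNIV f" "\<And>z. \<bar>f z\<bar> \<le> B" and x: "continuous_on UNIV x"
  shows "(\<lambda>n. self_int f (step_walk (Suc n) (increments (Suc n) x))) \<longlonglongrightarrow> self_int f x"
  unfolding self_int_def
proof (rule integral_dominated_convergence[where w = "\<lambda>p. B * indicator triangle p"])
  let ?W = "\<lambda>n. step_walk (Suc n) (increments (Suc n) x)"
  have [measurable]: "f \<in> borel_measurable borel" "x \<in> borel_measurable borel"
    using f x by (auto intro: borel_measurable_continuous_onI)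
  show "(\<lambda>p. indicator triangle p * f (x (fst p) - x (snd p))) \<in> borel_measurable lborel" by measurable
  show "(\<lambda>p. indicator triangle p * f (?W n (fst p) - ?W n (snd p))) \<in> borel_measurable lborel" for n by measurable
  show "integrable lborel (\<lambda>p. B * indicator triangle p)" using emeasure_triangle by simp
  show "AE p in lborel. (\<lambda>n. indicator triangle p * f (?W n (fst p) - ?W n (snd p))) \<longlonglongrightarrow> indicator triangle p * f (x (fst p) - x (snd p))"
  proof (rule AE_I2)
    fix p :: "real \<times> real"
    show "(\<lambda>n. indicator triangle p * f (?W n (fst p) - ?W n (snd p))) \<longlonglongrightarrow> indicator triangle p * f (x (fst p) - x (snd p))"
    proof (cases "p \<in> triangle")
      case True
      hence p: "0 \<le> fst p" "fst p \<le> 1" "0 \<le> snd p" "snd p \<le> 1" by (auto simp: triangle_def)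
      have "(\<lambda>n. f (?W n (fst p) - ?W n (snd p)))
         \<longlonglongrightarrow> f ((x (fst p) - x 0) - (x (snd p) - x 0))"
        using p f x by (intro isCont_tendsto_compose[of _ f] tendsto_diff step_walk_limit) (auto simp: continuous_on_eq_continuous_at)
      thus ?thesis using True by simp
    qed simp
  qed
  show "AE p in lborel. norm (indicator triangle p * f (?W n (fst p) - ?W n (snd p))) \<le> B * indicator triangle p" for n
    using f by (intro AE_I2) (auto simp: indicator_def)
qed

text \<open>With the path frozen, the functional is a measurable function of finitely many
  increments. Laws and independence can thus be handled on finite products, without a sigma-algebra
  on path space.\<close>

lemma self_int_step_walk_measurable:
  assumes [measurable]: "f \<in> borel_measurable borel" and D: "\<And>i. i < n \<Longrightarrow> (\<lambda>y. D y i) \<in> borel_measurable N"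
  shows "(\<lambda>y. self_int f (step_walk n (D y))) \<in> borel_measurable N"
proof -
  have [measurable]: "(\<lambda>z. step_walk n (D (fst z)) (g (snd z))) \<in> borel_measurable (N \<Otimes>\<^sub>M lborel)"
    if [measurable]: "g \<in> borel_measurable lborel" for g :: "real \<times> real \<Rightarrow> real"
    unfolding step_walk_def
  proof (rule borel_measurable_sum)
    fix i assume "i \<in> {..<n}"
    hence [measurable]: "(\<lambda>y. D y i) \<in> borel_measurable N" using D by simp
    show "(\<lambda>z. if real (Suc i) \<le> real n * g (snd z) then D (fst z) i else 0) \<in> borel_measurable (N \<Otimes>\<^sub>M lborel)"
      by measurable
  qed
  have "(\<lambda>z. indicator triangle (snd z) * f (step_walk n (D (fst z)) (fst (snd z)) - step_walk n (D (fst z)) (snd (snd z))))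
      \<in> borel_measurable (N \<Otimes>\<^sub>M lborel)"
    by measurable
  thus ?thesis unfolding self_int_def
    by (intro lborel.borel_measurable_lebesgue_integral) (simp add: case_prod_unfold)
qed

section \<open>Brownian motion\<close>

text \<open>Unlike in \<open>planar_BM\<close>, paths are continuous on all of \<open>\<real>\<close> and the starting point is free; the behaviour at
  negative times is irrelevant.\<close>

locale cbm = prob_space M for M :: "'a measure" +
  fixes X :: "real \<Rightarrow> 'a \<Rightarrow> real^2"
  assumes X_meas [measurable]: "\<And>t. X t \<in> borel_measurable M"
    and X_cont: "\<And>\<omega>. \<omega> \<in> space M \<Longrightarrow> continuous_on UNIV (\<lambda>t. X t \<omega>)"
    and X_dist: "\<And>s t. 0 \<le> s \<Longrightarrow> s < t \<Longrightarrow>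
      distributed M lborel (\<lambda>\<omega>. X t \<omega> - X s \<omega>) (\<lambda>x. ennreal (gauss2 (t - s) x))"
    and X_indep: "\<And>(n::nat) tt. 0 \<le> tt 0 \<Longrightarrow> (\<And>i. i < n \<Longrightarrow> tt i \<le> tt (Suc i)) \<Longrightarrow>
      indep_vars (\<lambda>_. borel) (\<lambda>i \<omega>. X (tt (Suc i)) \<omega> - X (tt i) \<omega>) {..<n}"
begin

text \<open>Paths frozen on a grid involve only countably many times and are therefore jointly
  measurable; by continuity they converge to the path.\<close>

lemma X_jointly_measurable: "(\<lambda>p. X (fst p) (snd p)) \<in> borel_measurable (borel \<Otimes>\<^sub>M M)"
proof (rule borel_measurable_LIMSEQ_metric)
  fix n :: nat
  show "(\<lambda>p :: real \<times> 'a. X (of_int \<lfloor>real (Suc n) * fst p\<rfloor> / real (Suc n)) (snd p)) \<in> borel_measurable (borel \<Otimes>\<^sub>M M)"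
    by (rule measurable_compose_countable[where f = "\<lambda>i p. X (of_int i / real (Suc n)) (snd p)"
          and g = "\<lambda>p. \<lfloor>real (Suc n) * fst p\<rfloor>"]) measurable
next
  fix p :: "real \<times> 'a" assume "p \<in> space (borel \<Otimes>\<^sub>M M)"
  hence c: "continuous_on UNIV (\<lambda>t. X t (snd p))" by (auto simp: space_pair_measure intro: X_cont)
  note floor_grid_limit[of "fst p"]
  thus "(\<lambda>n. X (of_int \<lfloor>real (Suc n) * fst p\<rfloor> / real (Suc n)) (snd p)) \<longlonglongrightarrow> X (fst p) (snd p)"
    using c by (intro isCont_tendsto_compose[of "fst p" "\<lambda>t. X t (snd p)"]) (auto simp: continuous_on_eq_continuous_at)
qed

lemma X_measurable_pair [measurable (raw)]:
  assumes [measurable]: "g \<in> borel_measurable N" "h \<in> measurable N M"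
  shows "(\<lambda>z. X (g z) (h z)) \<in> borel_measurable N"
proof -
  have "(\<lambda>z. (g z, h z)) \<in> measurable N (borel \<Otimes>\<^sub>M M)" by measurable
  from measurable_compose[OF this X_jointly_measurable] show ?thesis by simp
qed

lemma self_int_measurable [measurable]:
  assumes [measurable]: "f \<in> borel_measurable borel"
  shows "(\<lambda>\<omega>. self_int f (\<lambda>t. X t \<omega>)) \<in> borel_measurable M"
  unfolding self_int_def
  by (intro lborel.borel_measurable_lebesgue_integral) measurable

lemma cross_int_measurable [measurable]:
  assumes [measurable]: "f \<in> borel_measurable borel"
  shows "(\<lambda>\<omega>. cross_int f s (\<lambda>t. X t \<omega>)) \<in> borel_measurable M"
proof -
  have [measurable]: "{s..<1} \<times> {0..<s} \<in> sets (borel :: (real \<times> real) measure)"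
    by (intro borel_Times) auto
  show ?thesis
    unfolding cross_int_def by (intro lborel.borel_measurable_lebesgue_integral) measurable
qed

lemma path_measurable: "\<omega> \<in> space M \<Longrightarrow> (\<lambda>t. X t \<omega>) \<in> borel_measurable borel"
  by (rule borel_measurable_continuous_onI[OF X_cont])

text \<open>Increments are stationary, and the factors t in time and 1 / sqrt t in space compensate
  each other; in dimension two the Jacobian of the spatial scaling by sqrt t is t.\<close>

lemma block_cbm:
  assumes a: "a \<ge> 0" and t: "t > 0"
  shows "cbm M (\<lambda>r \<omega>. block a t (\<lambda>t. X t \<omega>) r)"
proof
  show "(\<lambda>\<omega>. block a t (\<lambda>t. X t \<omega>) r) \<in> borel_measurable M" for r
    unfolding block_def by measurable
  show "continuous_on UNIV (\<lambda>r. block a t (\<lambda>t. X t \<omega>) r)" if "\<omega> \<in> space M" for \<omega>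
    unfolding block_def by (intro continuous_intros continuous_on_compose2[OF X_cont[OF that]]) auto
  have eq: "block a t (\<lambda>t. X t \<omega>) r - block a t (\<lambda>t. X t \<omega>) s = (1 / sqrt t) *\<^sub>R (X (a + t * r) \<omega> - X (a + t * s) \<omega>)" for r s \<omega>
    unfolding block_def by (simp add: scaleR_diff_right)
  show "distributed M lborel (\<lambda>\<omega>. block a t (\<lambda>t. X t \<omega>) r - block a t (\<lambda>t. X t \<omega>) s) (\<lambda>x. ennreal (gauss2 (r - s) x))"
    if sr: "0 \<le> s" "s < r" for s r
  proof -
    define Z where "Z = (\<lambda>\<omega>. X (a + t * r) \<omega> - X (a + t * s) \<omega>)"
    have Z: "distributed M lborel Z (\<lambda>x. ennreal (gauss2 (t * (r - s)) x))"
      using X_dist[of "a + t * s" "a + t * r"] a t sr unfolding Z_def by (simp add: algebra_simps)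
    have [measurable]: "Z \<in> borel_measurable M" unfolding Z_def by measurable
    have "distr M lborel (\<lambda>\<omega>. (1 / sqrt t) *\<^sub>R Z \<omega>) = density lborel (\<lambda>x. ennreal (gauss2 (r - s) x))"
    proof (rule measure_eqI)
      fix A assume "A \<in> sets (distr M lborel (\<lambda>\<omega>. (1 / sqrt t) *\<^sub>R Z \<omega>))"
      hence [measurable]: "A \<in> sets borel" by simp
      have "emeasure (distr M lborel (\<lambda>\<omega>. (1 / sqrt t) *\<^sub>R Z \<omega>)) A = (\<integral>\<^sup>+\<omega>. indicator A ((1 / sqrt t) *\<^sub>R Z \<omega>) \<partial>M)"
        by (subst nn_integral_indicator[symmetric], simp, subst nn_integral_distr) auto
      also have "\<dots> = (\<integral>\<^sup>+x. ennreal (gauss2 (t * (r - s)) x) * indicator A ((1 / sqrt t) *\<^sub>R x) \<partial>lborel)"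
        by (subst distributed_nn_integral[OF Z]) auto
      also have "\<dots> = (\<integral>\<^sup>+x. ennreal (gauss2 (t * (r - s)) x) * indicator A ((1 / sqrt t) *\<^sub>R x)
          \<partial>density (distr lborel borel (\<lambda>x. 0 + sqrt t *\<^sub>R x)) (\<lambda>_. \<bar>sqrt t\<bar> ^ DIM(real^2)))"
        using t by (subst lborel_affine[of "sqrt t" 0]) auto
      also have "\<dots> = (\<integral>\<^sup>+x. ennreal t * (ennreal (gauss2 (t * (r - s)) (sqrt t *\<^sub>R x)) * indicator A x) \<partial>lborel)"
        using t by (subst nn_integral_density, simp, simp, subst nn_integral_distr) (auto simp: power2_eq_square[symmetric])
      also have "\<dots> = (\<integral>\<^sup>+x. ennreal (gauss2 (r - s) x) * indicator A x \<partial>lborel)"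
        using gauss2_scale[of "sqrt t" "r - s"] gauss2_nonneg[of "r - s"] t sr
        by (auto intro!: nn_integral_cong simp: indicator_def ennreal_mult[symmetric])
      finally show "emeasure (distr M lborel (\<lambda>\<omega>. (1 / sqrt t) *\<^sub>R Z \<omega>)) A = emeasure (density lborel (\<lambda>x. ennreal (gauss2 (r - s) x))) A"
        by (simp add: emeasure_density)
    qed simp
    thus ?thesis unfolding distributed_def eq Z_def by simp
  qed
  fix n :: nat and tt :: "nat \<Rightarrow> real" assume tt: "0 \<le> tt 0" "\<And>i. i < n \<Longrightarrow> tt i \<le> tt (Suc i)"
  have "indep_vars (\<lambda>_. borel) (\<lambda>i \<omega>. X (a + t * tt (Suc i)) \<omega> - X (a + t * tt i) \<omega>) {..<n}"
    using tt a t by (intro X_indep) auto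
  from indep_vars_compose2[OF this, of "\<lambda>_ z. (1 / sqrt t) *\<^sub>R z" "\<lambda>_. borel"]
  show "indep_vars (\<lambda>_. borel) (\<lambda>i \<omega>. block a t (\<lambda>t. X t \<omega>) (tt (Suc i)) - block a t (\<lambda>t. X t \<omega>) (tt i)) {..<n}"
    unfolding eq by simp
qed

lemma increments_law:
  assumes "n > 0"
  shows "distr M (PiM {..<n} (\<lambda>_. borel)) (\<lambda>\<omega>. \<lambda>i\<in>{..<n}. increments n (\<lambda>t. X t \<omega>) i)
    = PiM {..<n} (\<lambda>i. density lborel (\<lambda>x. ennreal (gauss2 (1 / real n) x)))"
proof -
  have meas: "(\<lambda>\<omega>. increments n (\<lambda>t. X t \<omega>) i) \<in> borel_measurable M" for i
    unfolding increments_def by measurable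
  have "indep_vars (\<lambda>_. borel) (\<lambda>i \<omega>. increments n (\<lambda>t. X t \<omega>) i) {..<n}"
    unfolding increments_def by (rule X_indep) (auto intro!: divide_right_mono)
  hence "distr M (PiM {..<n} (\<lambda>_. borel)) (\<lambda>\<omega>. \<lambda>i\<in>{..<n}. increments n (\<lambda>t. X t \<omega>) i)
    = PiM {..<n} (\<lambda>i. distr M borel (\<lambda>\<omega>. increments n (\<lambda>t. X t \<omega>) i))"
    using assms meas by (subst (asm) indep_vars_iff_distr_eq_PiM') auto
  also have "\<dots> = PiM {..<n} (\<lambda>i. density lborel (\<lambda>x. ennreal (gauss2 (1 / real n) x)))"
  proof (rule PiM_cong)
    fix i assume "i \<in> {..<n}"
    have "distributed M lborel (\<lambda>\<omega>. increments n (\<lambda>t. X t \<omega>) i)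
        (\<lambda>x. ennreal (gauss2 (real (Suc i) / real n - real i / real n) x))"
      unfolding increments_def using assms by (intro X_dist) (auto intro!: divide_strict_right_mono)
    hence "distr M lborel (\<lambda>\<omega>. increments n (\<lambda>t. X t \<omega>) i) = density lborel (\<lambda>x. ennreal (gauss2 (1 / real n) x))"
      unfolding distributed_def by (simp add: diff_divide_distrib[symmetric])
    thus "distr M borel (\<lambda>\<omega>. increments n (\<lambda>t. X t \<omega>) i) = density lborel (\<lambda>x. ennreal (gauss2 (1 / real n) x))"
      by (simp cong: distr_cong)
  qed simp
  finally show ?thesis .
qed

end

section \<open>Laws and independence through discretised paths\<close>

lemma continuous_bounded_on_interval:
  fixes g :: "real \<Rightarrow> real"
  assumes "continuous_on UNIV g"
  obtains C where "\<And>x. a \<le> x \<Longrightarrow> x \<le> b \<Longrightarrow> \<bar>g x\<bar> \<le> C"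
proof -
  have "bounded (g ` {a..b})"
    using assms by (intro compact_imp_bounded compact_continuous_image) (auto intro: continuous_on_subset)
  then obtain C where "\<forall>y\<in>g ` {a..b}. norm y \<le> C" by (auto simp: bounded_iff)
  thus ?thesis using that[of C] by auto
qed

context cbm
begin

text \<open>The functional takes values in one compact interval for all grids, so dominated
  convergence applies to every continuous g, however fast it grows; exponentials and the identity
  are the cases used later.\<close>

lemma self_int_step_limit:
  fixes g :: "real \<Rightarrow> real"
  assumes f: "continuous_on UNIV f" "\<And>z. 0 \<le> f z" "\<And>z. f z \<le> B" and g: "continuous_on UNIV g"
  shows "(\<lambda>n. expectation (\<lambda>\<omega>. g (self_int f (step_walk (Suc n) (increments (Suc n) (\<lambda>t. X t \<omega>))))))
      \<longlonglongrightarrow> expectation (\<lambda>\<omega>. g (self_int f (\<lambda>t. X t \<omega>)))"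
proof -
  have [measurable]: "f \<in> borel_measurable borel" "g \<in> borel_measurable borel"
    using f g by (auto intro: borel_measurable_continuous_onI)
  have [measurable]: "(\<lambda>\<omega>. self_int f (step_walk n (increments n (\<lambda>t. X t \<omega>)))) \<in> borel_measurable M" for n
    by (rule self_int_step_walk_measurable) (auto simp: increments_def)
  obtain C where C: "\<And>y. 0 \<le> y \<Longrightarrow> y \<le> B * measure lborel triangle \<Longrightarrow> \<bar>g y\<bar> \<le> C"
    using continuous_bounded_on_interval[OF g] by metis
  show ?thesis
  proof (rule integral_dominated_convergence[where w = "\<lambda>_. C"])
    show "AE \<omega> in M. (\<lambda>n. g (self_int f (step_walk (Suc n) (increments (Suc n) (\<lambda>t. X t \<omega>)))))
        \<longlonglongrightarrow> g (self_int f (\<lambda>t. X t \<omega>))"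
      using f g X_cont
      by (intro AE_I2 isCont_tendsto_compose[of _ g] self_int_limit[where B = B])
         (auto simp: continuous_on_eq_continuous_at abs_le_iff intro: order_trans[of _ 0])
    show "AE \<omega> in M. norm (g (self_int f (step_walk (Suc n) (increments (Suc n) (\<lambda>t. X t \<omega>))))) \<le> C" for n
      using f by (intro AE_I2) (auto intro!: C self_int_bounds)
  qed auto
qed

end

text \<open>For each grid both sides are the integral of the same function against the same product
  of Gaussian laws; refining the grid gives the claim.\<close>

lemma self_int_law:
  fixes g :: "real \<Rightarrow> real"
  assumes "cbm M X" "cbm M Y"
    and f: "continuous_on UNIV f" "\<And>z. 0 \<le> f z" "\<And>z. f z \<le> B" and g: "continuous_on UNIV g"
  shows "(\<integral>\<omega>. g (self_int f (\<lambda>t. X t \<omega>)) \<partial>M) = (\<integral>\<omega>. g (self_int f (\<lambda>t. Y t \<omega>)) \<partial>M)"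
proof -
  have [measurable]: "f \<in> borel_measurable borel" "g \<in> borel_measurable borel"
    using f g by (auto intro: borel_measurable_continuous_onI)
  have step: "(\<integral>\<omega>. g (self_int f (step_walk (Suc n) (increments (Suc n) (\<lambda>t. Z t \<omega>)))) \<partial>M)
      = (\<integral>\<delta>. g (self_int f (step_walk (Suc n) \<delta>)) \<partial>PiM {..<Suc n} (\<lambda>i. density lborel (\<lambda>x. ennreal (gauss2 (1 / real (Suc n)) x))))"
    if "cbm M Z" for Z n
  proof -
    interpret Z: cbm M Z by fact
    have [measurable]: "(\<lambda>\<delta>. self_int f (step_walk (Suc n) \<delta>)) \<in> borel_measurable (PiM {..<Suc n} (\<lambda>_. borel))"
      by (rule self_int_step_walk_measurable) (auto intro!: measurable_component_singleton)
    have meas: "(\<lambda>\<omega>. \<lambda>i\<in>{..<Suc n}. increments (Suc n) (\<lambda>t. Z t \<omega>) i) \<in> measurable M (PiM {..<Suc n} (\<lambda>_. borel))"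
      unfolding increments_def by (intro measurable_restrict) measurable
    have "(\<integral>\<delta>. g (self_int f (step_walk (Suc n) \<delta>)) \<partial>PiM {..<Suc n} (\<lambda>i. density lborel (\<lambda>x. ennreal (gauss2 (1 / real (Suc n)) x))))
       = (\<integral>\<omega>. g (self_int f (step_walk (Suc n) (\<lambda>i\<in>{..<Suc n}. increments (Suc n) (\<lambda>t. Z t \<omega>) i))) \<partial>M)"
      unfolding Z.increments_law[OF zero_less_Suc, symmetric]
      by (rule integral_distr[OF meas]) measurable
    moreover have "step_walk (Suc n) (\<lambda>i\<in>{..<Suc n}. increments (Suc n) x i) = step_walk (Suc n) (increments (Suc n) x)" for x
      unfolding step_walk_def by (intro ext sum.cong) auto
    ultimately show ?thesis by simp
  qed
  have "(\<lambda>n. \<integral>\<omega>. g (self_int f (step_walk (Suc n) (increments (Suc n) (\<lambda>t. X t \<omega>)))) \<partial>M) \<longlonglongrightarrow> (\<integral>\<omega>. g (self_int f (\<lambda>t. X t \<omega>)) \<partial>M)"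
    by (rule cbm.self_int_step_limit[OF assms(1) f g])
  moreover have "(\<lambda>n. \<integral>\<omega>. g (self_int f (step_walk (Suc n) (increments (Suc n) (\<lambda>t. X t \<omega>)))) \<partial>M) \<longlonglongrightarrow> (\<integral>\<omega>. g (self_int f (\<lambda>t. Y t \<omega>)) \<partial>M)"
    unfolding step[OF assms(1)] step[OF assms(2), symmetric]
    by (rule cbm.self_int_step_limit[OF assms(2) f g])
  ultimately show ?thesis by (rule LIMSEQ_unique)
qed

context cbm
begin

text \<open>On grids the two functionals use disjoint groups of independent increments, and the
  product formula survives the limit. Two kernels are allowed because the pieces are mollified at
  the different scales \<epsilon> / sqrt s and \<epsilon> / sqrt (1 - s).\<close>

lemma block_integral_product:
  fixes g1 g2 :: "real \<Rightarrow> real"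
  assumes s: "0 < s" "s < 1"
    and f1: "continuous_on UNIV f1" "\<And>z. 0 \<le> f1 z" "\<And>z. f1 z \<le> B1" and g1: "continuous_on UNIV g1"
    and f2: "continuous_on UNIV f2" "\<And>z. 0 \<le> f2 z" "\<And>z. f2 z \<le> B2" and g2: "continuous_on UNIV g2"
  shows "expectation (\<lambda>\<omega>. g1 (self_int f1 (block 0 s (\<lambda>t. X t \<omega>))) * g2 (self_int f2 (block s (1 - s) (\<lambda>t. X t \<omega>))))
    = expectation (\<lambda>\<omega>. g1 (self_int f1 (block 0 s (\<lambda>t. X t \<omega>)))) * expectation (\<lambda>\<omega>. g2 (self_int f2 (block s (1 - s) (\<lambda>t. X t \<omega>))))"
proof -
  let ?Y = "\<lambda>\<omega>. block 0 s (\<lambda>t. X t \<omega>)" and ?Z = "\<lambda>\<omega>. block s (1 - s) (\<lambda>t. X t \<omega>)"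
  interpret Y: cbm M "\<lambda>r \<omega>. ?Y \<omega> r" using s by (intro block_cbm) auto
  interpret Z: cbm M "\<lambda>r \<omega>. ?Z \<omega> r" using s by (intro block_cbm) auto
  have [measurable]: "f1 \<in> borel_measurable borel" "g1 \<in> borel_measurable borel" "f2 \<in> borel_measurable borel" "g2 \<in> borel_measurable borel"
    using f1 g1 f2 g2 by (auto intro: borel_measurable_continuous_onI)
  obtain C1 where C1: "\<And>y. 0 \<le> y \<Longrightarrow> y \<le> B1 * measure lborel triangle \<Longrightarrow> \<bar>g1 y\<bar> \<le> C1"
    using continuous_bounded_on_interval[OF g1] by metis
  obtain C2 where C2: "\<And>y. 0 \<le> y \<Longrightarrow> y \<le> B2 * measure lborel triangle \<Longrightarrow> \<bar>g2 y\<bar> \<le> C2"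
    using continuous_bounded_on_interval[OF g2] by metis
  define P where "P = (\<lambda>n \<omega>. g1 (self_int f1 (step_walk (Suc n) (increments (Suc n) (?Y \<omega>)))))"
  define Q where "Q = (\<lambda>n \<omega>. g2 (self_int f2 (step_walk (Suc n) (increments (Suc n) (?Z \<omega>)))))"
  have [measurable]: "P n \<in> borel_measurable M" for n
    unfolding P_def by (rule measurable_compose[OF self_int_step_walk_measurable]) (auto simp: increments_def)
  have [measurable]: "Q n \<in> borel_measurable M" for n
    unfolding Q_def by (rule measurable_compose[OF self_int_step_walk_measurable]) (auto simp: increments_def)
  have Pb: "\<bar>P n \<omega>\<bar> \<le> C1" for n \<omega>
    unfolding P_def using f1 by (intro C1 self_int_bounds) auto
  have Qb: "\<bar>Q n \<omega>\<bar> \<le> C2" for n \<omega>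
    unfolding Q_def using f2 by (intro C2 self_int_bounds) auto
  have int: "integrable M (P n)" "integrable M (Q n)" for n
    by (rule integrable_const_bound[where B = C1], use Pb in auto)
       (rule integrable_const_bound[where B = C2], use Qb in auto)
  have prod: "expectation (\<lambda>\<omega>. P n \<omega> * Q n \<omega>) = expectation (P n) * expectation (Q n)" for n
  proof -
    define N where "N = Suc n"
    \<comment> \<open>One increasing sequence of 2 N steps that subdivides [0, s] and then [s, 1];
      both branches give s at k = N.\<close>
    define tt where "tt = (\<lambda>k. if k \<le> N then s * (real k / real N) else s + (1 - s) * (real (k - N) / real N))"
    define D where "D = (\<lambda>i \<omega>. X (tt (Suc i)) \<omega> - X (tt i) \<omega>)"
    have mono: "tt i \<le> tt (Suc i)" for i
    proof -
      consider "Suc i \<le> N" | "i = N" | "i > N" by linarith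
      thus ?thesis
      proof cases
        case 1 thus ?thesis using s by (auto simp: tt_def intro!: mult_left_mono divide_right_mono)
      next
        case 2 thus ?thesis using s by (auto simp: tt_def N_def)
      next
        case 3 thus ?thesis using s by (auto simp: tt_def intro!: mult_left_mono divide_right_mono)
      qed
    qed
    have indep: "indep_vars (\<lambda>_. borel) D {..<2 * N}"
      unfolding D_def using mono by (intro X_indep) (auto simp: tt_def)
    have D1: "increments N (?Y \<omega>) i = (1 / sqrt s) *\<^sub>R D i \<omega>" if "i < N" for i \<omega>
      using that unfolding increments_def block_def D_def tt_def by (simp add: scaleR_diff_right)
    \<comment> \<open>For i = 0 the left end is \<open>tt N\<close>, which is computed by the first
      branch; hence the case distinction on i.\<close>
    have D2: "increments N (?Z \<omega>) i = (1 / sqrt (1 - s)) *\<^sub>R D (N + i) \<omega>" if "i < N" for i \<omega>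
      using that unfolding increments_def block_def D_def tt_def
      by (cases i) (auto simp: scaleR_diff_right N_def)
    have sw1: "step_walk N (increments N (?Y \<omega>))
        = step_walk N (\<lambda>i. (1 / sqrt s) *\<^sub>R (\<lambda>i\<in>{..<N}. D i \<omega>) i)" for \<omega>
      unfolding step_walk_def using D1 by (intro ext sum.cong) auto
    have sw2: "step_walk N (increments N (?Z \<omega>))
        = step_walk N (\<lambda>i. (1 / sqrt (1 - s)) *\<^sub>R (\<lambda>i\<in>{N..<2 * N}. D i \<omega>) (N + i))" for \<omega>
      unfolding step_walk_def using D2 by (intro ext sum.cong) auto
    have "indep_var (PiM {..<N} (\<lambda>_. borel)) (\<lambda>\<omega>. \<lambda>i\<in>{..<N}. D i \<omega>) (PiM {N..<2 * N} (\<lambda>_. borel)) (\<lambda>\<omega>. \<lambda>i\<in>{N..<2 * N}. D i \<omega>)"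
      by (rule indep_var_restrict[OF indep]) auto
    hence "indep_var borel ((\<lambda>d. g1 (self_int f1 (step_walk N (\<lambda>i. (1 / sqrt s) *\<^sub>R d i)))) \<circ> (\<lambda>\<omega>. \<lambda>i\<in>{..<N}. D i \<omega>))
       borel ((\<lambda>d. g2 (self_int f2 (step_walk N (\<lambda>i. (1 / sqrt (1 - s)) *\<^sub>R d (N + i))))) \<circ> (\<lambda>\<omega>. \<lambda>i\<in>{N..<2 * N}. D i \<omega>))"
    proof (rule indep_var_compose)
      show "(\<lambda>d. g1 (self_int f1 (step_walk N (\<lambda>i. (1 / sqrt s) *\<^sub>R d i)))) \<in> borel_measurable (PiM {..<N} (\<lambda>_. borel))"
        by (rule measurable_compose[OF self_int_step_walk_measurable])
           (auto intro!: borel_measurable_scaleR measurable_component_singleton)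
      show "(\<lambda>d. g2 (self_int f2 (step_walk N (\<lambda>i. (1 / sqrt (1 - s)) *\<^sub>R d (N + i))))) \<in> borel_measurable (PiM {N..<2 * N} (\<lambda>_. borel))"
        by (rule measurable_compose[OF self_int_step_walk_measurable])
           (auto intro!: borel_measurable_scaleR measurable_component_singleton)
    qed
    hence "indep_var borel (P n) borel (Q n)"
      unfolding P_def Q_def N_def[symmetric] sw1 sw2 by (simp add: comp_def)
    thus ?thesis using int by (rule indep_var_lebesgue_integral)
  qed
  have limP: "AE \<omega> in M. (\<lambda>n. P n \<omega>) \<longlonglongrightarrow> g1 (self_int f1 (?Y \<omega>))"
    unfolding P_def using f1 g1 Y.X_cont
    by (intro AE_I2 isCont_tendsto_compose[of _ g1] self_int_limit[where B = B1])
       (auto simp: continuous_on_eq_continuous_at abs_le_iff intro: order_trans[of _ 0])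
  have limQ: "AE \<omega> in M. (\<lambda>n. Q n \<omega>) \<longlonglongrightarrow> g2 (self_int f2 (?Z \<omega>))"
    unfolding Q_def using f2 g2 Z.X_cont
    by (intro AE_I2 isCont_tendsto_compose[of _ g2] self_int_limit[where B = B2])
       (auto simp: continuous_on_eq_continuous_at abs_le_iff intro: order_trans[of _ 0])
  have "(\<lambda>n. expectation (\<lambda>\<omega>. P n \<omega> * Q n \<omega>)) \<longlonglongrightarrow>
      expectation (\<lambda>\<omega>. g1 (self_int f1 (?Y \<omega>)) * g2 (self_int f2 (?Z \<omega>)))"
  proof (rule integral_dominated_convergence[where w = "\<lambda>_. C1 * C2"])
    show "AE \<omega> in M. (\<lambda>n. P n \<omega> * Q n \<omega>) \<longlonglongrightarrow>
        g1 (self_int f1 (?Y \<omega>)) * g2 (self_int f2 (?Z \<omega>))"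
      using limP limQ by eventually_elim (rule tendsto_mult)
    show "AE \<omega> in M. norm (P n \<omega> * Q n \<omega>) \<le> C1 * C2" for n
      unfolding real_norm_def abs_mult using Pb Qb by (intro AE_I2 mult_mono) (auto intro: order_trans[OF abs_ge_zero])
  qed auto
  moreover have "(\<lambda>n. expectation (P n) * expectation (Q n)) \<longlonglongrightarrow>
      expectation (\<lambda>\<omega>. g1 (self_int f1 (?Y \<omega>))) * expectation (\<lambda>\<omega>. g2 (self_int f2 (?Z \<omega>)))"
    using Y.self_int_step_limit[OF f1 g1] Z.self_int_step_limit[OF f2 g2]
    unfolding P_def Q_def by (intro tendsto_mult)
  ultimately show ?thesis unfolding prod by (rule LIMSEQ_unique)
qed

section \<open>Integrating out single increments\<close>

lemma nn_integral_increment: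
  assumes "0 \<le> u" "u < v" and [measurable]: "h \<in> borel_measurable borel"
  shows "(\<integral>\<^sup>+\<omega>. h (X v \<omega> - X u \<omega>) \<partial>M) = (\<integral>\<^sup>+x. ennreal (gauss2 (v - u) x) * h x \<partial>lborel)"
  using distributed_nn_integral[OF X_dist[OF assms(1,2)], of h] by simp

lemma nn_integral_gauss2:
  assumes "s > 0"
  shows "(\<integral>\<^sup>+x. ennreal (gauss2 s x) \<partial>lborel) = 1"
  using nn_integral_increment[of 0 s "\<lambda>_. 1"] assms emeasure_space_1 by simp

text \<open>Only the total mass of h enters, not its shape: this is the source of the uniformity in
  the mollification.\<close>

lemma nn_integral_increment_le:
  assumes u: "0 \<le> u" "u < v" and [measurable]: "h \<in> borel_measurable borel"
    and h: "(\<integral>\<^sup>+x. h x \<partial>lborel) \<le> 1"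
  shows "(\<integral>\<^sup>+\<omega>. h (X v \<omega> - X u \<omega>) \<partial>M) \<le> ennreal (1 / (2 * pi * (v - u)))"
proof -
  have "(\<integral>\<^sup>+\<omega>. h (X v \<omega> - X u \<omega>) \<partial>M) \<le> (\<integral>\<^sup>+x. ennreal (1 / (2 * pi * (v - u))) * h x \<partial>lborel)"
    unfolding nn_integral_increment[OF u assms(3)] using u
    by (intro nn_integral_mono mult_right_mono ennreal_leI gauss2_le) auto
  also have "\<dots> = ennreal (1 / (2 * pi * (v - u))) * (\<integral>\<^sup>+x. h x \<partial>lborel)"
    by (rule nn_integral_cmult) simp
  also have "\<dots> \<le> ennreal (1 / (2 * pi * (v - u))) * 1" using h by (rule mult_left_mono) simp
  finally show ?thesis by simp
qed

text \<open>Given V, the argument of h is \<open>A (U \<omega>)\<close> shifted by a constant. Since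
  its density is at most K and h has mass at most one, the factor that contains U integrates to at
  most K.\<close>

lemma nn_integral_pivot:
  fixes p :: "real^2 \<Rightarrow> real"
  assumes indep: "indep_var N' U N V"
    and A: "distributed M lborel (\<lambda>\<omega>. A (U \<omega>)) (\<lambda>x. ennreal (p x))" "\<And>x. p x \<le> K"
    and [measurable]: "A \<in> borel_measurable N'" "h \<in> borel_measurable borel"
      "F \<in> borel_measurable N" "H \<in> borel_measurable N"
    and h: "(\<integral>\<^sup>+x. h x \<partial>lborel) \<le> 1"
  shows "(\<integral>\<^sup>+\<omega>. h (A (U \<omega>) + F (V \<omega>)) * H (V \<omega>) \<partial>M) \<le> ennreal K * (\<integral>\<^sup>+\<omega>. H (V \<omega>) \<partial>M)"
proof -
  have [measurable]: "U \<in> measurable M N'" "V \<in> measurable M N"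
    using indep unfolding indep_var_distribution_eq by auto
  interpret U: prob_space "distr M N' U" by (rule prob_space_distr) simp
  interpret V: prob_space "distr M N V" by (rule prob_space_distr) simp
  interpret UV: pair_sigma_finite "distr M N' U" "distr M N V" ..
  have meas: "(\<lambda>z. h (A (fst z) + F (snd z)) * H (snd z)) \<in> borel_measurable (N' \<Otimes>\<^sub>M N)"
    by measurable
  have "(\<integral>\<^sup>+\<omega>. h (A (U \<omega>) + F (V \<omega>)) * H (V \<omega>) \<partial>M) =
      (\<integral>\<^sup>+z. h (A (fst z) + F (snd z)) * H (snd z) \<partial>distr M (N' \<Otimes>\<^sub>M N) (\<lambda>\<omega>. (U \<omega>, V \<omega>)))"
    using meas by (subst nn_integral_distr) simp_all
  also have "distr M (N' \<Otimes>\<^sub>M N) (\<lambda>\<omega>. (U \<omega>, V \<omega>)) = distr M N' U \<Otimes>\<^sub>M distr M N V"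
    using indep unfolding indep_var_distribution_eq by simp
  also have "(\<integral>\<^sup>+z. h (A (fst z) + F (snd z)) * H (snd z) \<partial>(distr M N' U \<Otimes>\<^sub>M distr M N V))
      = (\<integral>\<^sup>+v. (\<integral>\<^sup>+u. h (A u + F v) * H v \<partial>distr M N' U) \<partial>distr M N V)"
    by (subst UV.nn_integral_snd[symmetric]) (simp_all add: case_prod_unfold)
  also have "\<dots> \<le> (\<integral>\<^sup>+v. ennreal K * H v \<partial>distr M N V)"
  proof (rule nn_integral_mono)
    fix v assume "v \<in> space (distr M N V)"
    hence [simp]: "v \<in> space N" by simp
    have "(\<integral>\<^sup>+u. h (A u + F v) * H v \<partial>distr M N' U) = (\<integral>\<^sup>+\<omega>. h (A (U \<omega>) + F v) * H v \<partial>M)"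
      by (subst nn_integral_distr) auto
    also have "\<dots> = (\<integral>\<^sup>+a. ennreal (p a) * (h (a + F v) * H v) \<partial>lborel)"
      by (rule distributed_nn_integral[OF A(1), symmetric]) measurable
    also have "\<dots> \<le> (\<integral>\<^sup>+a. ennreal K * (h (a + F v) * H v) \<partial>lborel)"
      using A by (intro nn_integral_mono mult_right_mono ennreal_leI) auto
    also have "\<dots> = (\<integral>\<^sup>+a. (ennreal K * H v) * h (a + F v) \<partial>lborel)"
      by (simp add: mult_ac)
    also have "\<dots> = (ennreal K * H v) * (\<integral>\<^sup>+a. h (a + F v) \<partial>lborel)"
      by (rule nn_integral_cmult) simp
    also have "\<dots> \<le> (ennreal K * H v) * 1"
      unfolding nn_integral_translate[OF \<open>h \<in> borel_measurable borel\<close>] by (rule mult_left_mono[OF h]) simp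
    finally show "(\<integral>\<^sup>+u. h (A u + F v) * H v \<partial>distr M N' U) \<le> ennreal K * H v" by simp
  qed
  also have "\<dots> = ennreal K * (\<integral>\<^sup>+\<omega>. H (V \<omega>) \<partial>M)"
    by (subst nn_integral_cmult, simp, subst nn_integral_distr) auto
  finally show ?thesis .
qed

text \<open>The pivot \<open>D j\<close> occurs in the first factor only; S collects the other
  increments of that factor and T those of the second.\<close>

lemma three_increments_pivot:
  fixes j :: nat
  assumes t: "0 \<le> t (0::nat)" "\<And>i. i < 3 \<Longrightarrow> t i < t (Suc i)" and j: "j < 3"
    and D: "D = (\<lambda>i \<omega>. X (t (Suc i)) \<omega> - X (t i) \<omega>)"
    and S: "finite S" "finite T" "j \<notin> S" "j \<notin> T" "S \<subseteq> {..<3}" "T \<subseteq> {..<3}"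
    and [measurable]: "h \<in> borel_measurable borel" and h: "(\<integral>\<^sup>+x. h x \<partial>lborel) \<le> 1"
  shows "(\<integral>\<^sup>+\<omega>. h (D j \<omega> + (\<Sum>i\<in>S. D i \<omega>)) * h (\<Sum>i\<in>T. D i \<omega>) \<partial>M)
    \<le> ennreal (1 / (2 * pi * (t (Suc j) - t j))) * (\<integral>\<^sup>+\<omega>. h (\<Sum>i\<in>T. D i \<omega>) \<partial>M)"
proof -
  have t': "0 \<le> t i" if "i \<le> 3" for i
    using that
  proof (induction i)
    case (Suc i) thus ?case using t(2)[of i] by simp
  qed (use t in auto)
  have indep: "indep_vars (\<lambda>_. borel) D {..<3}"
    unfolding D using t by (intro X_indep) (auto intro: less_imp_le)
  let ?N = "PiM ({..<3} - {j}) (\<lambda>_. borel :: (real^2) measure)"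
  let ?V = "\<lambda>\<omega>. \<lambda>i\<in>{..<3} - {j}. D i \<omega>"
  let ?U = "\<lambda>\<omega>. \<lambda>i\<in>{j}. D i \<omega>"
  have iv: "indep_var (PiM {j} (\<lambda>_. borel)) ?U ?N ?V"
    using j by (intro indep_var_restrict[OF indep]) auto
  have dist: "distributed M lborel (D j) (\<lambda>x. ennreal (gauss2 (t (Suc j) - t j) x))"
    unfolding D using t t'[of j] j by (intro X_dist) auto
  have m: "(\<lambda>d. \<Sum>i\<in>U. d i) \<in> borel_measurable ?N" if "U \<subseteq> {..<3} - {j}" for U
    using that by (intro borel_measurable_sum measurable_component_singleton) auto
  have "(\<integral>\<^sup>+\<omega>. h (?U \<omega> j + (\<Sum>i\<in>S. ?V \<omega> i)) * h (\<Sum>i\<in>T. ?V \<omega> i) \<partial>M)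
    \<le> ennreal (1 / (2 * pi * (t (Suc j) - t j))) * (\<integral>\<^sup>+\<omega>. h (\<Sum>i\<in>T. ?V \<omega> i) \<partial>M)"
    using t(2)[OF j] S
    by (intro nn_integral_pivot[OF iv, where A = "\<lambda>d. d j" and p = "gauss2 (t (Suc j) - t j)" and F = "\<lambda>d. \<Sum>i\<in>S. d i" and H = "\<lambda>d. h (\<Sum>i\<in>T. d i)", OF _ gauss2_le] h
        measurable_compose[OF m] m) (auto simp: dist)
  moreover have "(\<Sum>i\<in>U. ?V \<omega> i) = (\<Sum>i\<in>U. D i \<omega>)" if "j \<notin> U" "U \<subseteq> {..<3}" for U \<omega>
    using that by (intro sum.cong) auto
  ultimately show ?thesis using S by simp
qed

end

section \<open>Moments of the mutual intersections\<close>

text \<open>Values in \<open>ennreal\<close>, so that the singularity is \<open>\<infinity>\<close> and not the junk value \<open>1 / 0 = 0\<close>.\<close>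

definition inv_sqrt :: "real \<Rightarrow> ennreal" where
  "inv_sqrt x = inverse (ennreal (sqrt \<bar>x\<bar>))"

lemma inv_sqrt_measurable [measurable]: "inv_sqrt \<in> borel_measurable borel"
  unfolding inv_sqrt_def by measurable

lemma inv_sqrt_0: "inv_sqrt 0 = \<infinity>"
  by (simp add: inv_sqrt_def)

lemma inv_sqrt_eq: "x \<noteq> 0 \<Longrightarrow> inv_sqrt x = ennreal (1 / sqrt \<bar>x\<bar>)"
  by (simp add: inv_sqrt_def inverse_ennreal inverse_eq_divide)

lemma inv_sqrt_pos: "inv_sqrt x > 0"
  by (cases "x = 0") (auto simp: inv_sqrt_0 inv_sqrt_eq)

lemma inv_sqrt_minus: "inv_sqrt (x - y) = inv_sqrt (y - x)"
  by (simp add: inv_sqrt_def abs_minus_commute)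

lemma nn_integral_inv_sqrt:
  assumes "a \<le> c" "c \<le> b"
  shows "(\<integral>\<^sup>+x. inv_sqrt (x - c) * indicator {a..b} x \<partial>lborel) \<le> ennreal (4 * sqrt (b - a))"
proof -
  have "(\<integral>\<^sup>+x. inv_sqrt (x - c) * indicator {a..b} x \<partial>lborel) = (\<integral>\<^sup>+x. ennreal (1 / sqrt \<bar>x - c\<bar>) * indicator {a..b} x \<partial>lborel)"
    using AE_lborel_singleton[of c] by (intro nn_integral_cong_AE, eventually_elim) (simp add: inv_sqrt_eq)
  thus ?thesis using nn_integral_inverse_sqrt[OF assms] by simp
qed

text \<open>Majorant for one side of the two-point function at the common endpoint e: one
  singularity for the mutual distance of the two times, one for the distance of the nearer time to
  e. The sum replaces a case distinction on which time is nearer.\<close>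

definition pair_sing :: "real \<Rightarrow> real \<Rightarrow> real \<Rightarrow> ennreal" where
  "pair_sing e u u' = inv_sqrt (u - u') * (inv_sqrt (u - e) + inv_sqrt (u' - e))"

lemma pair_sing_measurable [measurable (raw)]:
  assumes [measurable]: "f \<in> borel_measurable N" "g \<in> borel_measurable N"
  shows "(\<lambda>x. pair_sing e (f x) (g x)) \<in> borel_measurable N"
  unfolding pair_sing_def by measurable

text \<open>The variable that occurs only in \<open>inv_sqrt (u - u')\<close> is integrated first,
  then the other one: each step costs 4 sqrt (b - a), hence 16 (b - a) for one summand. The other
  summand is equal by symmetry.\<close>

lemma nn_integral_pair_sing:
  assumes e: "a \<le> e" "e \<le> b"
  shows "(\<integral>\<^sup>+u. (\<integral>\<^sup>+u'. pair_sing e u u' * indicator {a..b} u' \<partial>lborel) * indicator {a..b} u \<partial>lborel) \<le> ennreal (32 * (b - a))"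
proof -
  let ?I = "indicator {a..b} :: real \<Rightarrow> ennreal"
  define J where "J = (\<integral>\<^sup>+u. (\<integral>\<^sup>+u'. inv_sqrt (u - u') * inv_sqrt (u - e) * ?I u' * ?I u \<partial>lborel) \<partial>lborel)"
  have "J = (\<integral>\<^sup>+u. (inv_sqrt (u - e) * ?I u) * (\<integral>\<^sup>+u'. inv_sqrt (u' - u) * ?I u' \<partial>lborel) \<partial>lborel)"
    unfolding J_def by (subst nn_integral_cmult[symmetric]) (auto simp: mult_ac inv_sqrt_minus)
  also have "\<dots> \<le> (\<integral>\<^sup>+u. (inv_sqrt (u - e) * ?I u) * ennreal (4 * sqrt (b - a)) \<partial>lborel)"
  proof (rule nn_integral_mono)
    fix u
    show "(inv_sqrt (u - e) * ?I u) * (\<integral>\<^sup>+u'. inv_sqrt (u' - u) * ?I u' \<partial>lborel)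
      \<le> (inv_sqrt (u - e) * ?I u) * ennreal (4 * sqrt (b - a))"
      using nn_integral_inv_sqrt[of a u b] by (cases "u \<in> {a..b}") (auto intro!: mult_left_mono)
  qed
  also have "\<dots> = (\<integral>\<^sup>+u. inv_sqrt (u - e) * ?I u \<partial>lborel) * ennreal (4 * sqrt (b - a))"
    by (rule nn_integral_multc) measurable
  also have "\<dots> \<le> ennreal (4 * sqrt (b - a)) * ennreal (4 * sqrt (b - a))"
    by (rule mult_right_mono[OF nn_integral_inv_sqrt[OF e]]) simp
  also have "\<dots> = ennreal (16 * (b - a))"
  proof -
    have "4 * sqrt (b - a) * (4 * sqrt (b - a)) = 16 * (sqrt (b - a) * sqrt (b - a))" by simp
    also have "\<dots> = 16 * (b - a)" using e by (subst real_sqrt_mult_self) auto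
    finally show ?thesis using e by (simp add: ennreal_mult[symmetric])
  qed
  finally have J: "J \<le> ennreal (16 * (b - a))" .
  have "(\<integral>\<^sup>+u. (\<integral>\<^sup>+u'. pair_sing e u u' * ?I u' \<partial>lborel) * ?I u \<partial>lborel)
    = (\<integral>\<^sup>+u. (\<integral>\<^sup>+u'. inv_sqrt (u - u') * inv_sqrt (u - e) * ?I u' * ?I u + inv_sqrt (u - u') * inv_sqrt (u' - e) * ?I u' * ?I u \<partial>lborel) \<partial>lborel)"
    by (subst nn_integral_multc[symmetric]) (auto simp: pair_sing_def distrib_left distrib_right)
  also have "\<dots> = J + (\<integral>\<^sup>+u. (\<integral>\<^sup>+u'. inv_sqrt (u - u') * inv_sqrt (u' - e) * ?I u' * ?I u \<partial>lborel) \<partial>lborel)"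
    unfolding J_def by (subst nn_integral_add[symmetric]) (auto simp: nn_integral_add)
  also have "(\<integral>\<^sup>+u. (\<integral>\<^sup>+u'. inv_sqrt (u - u') * inv_sqrt (u' - e) * ?I u' * ?I u \<partial>lborel) \<partial>lborel) = J"
    unfolding J_def by (subst lborel_pair.Fubini') (auto simp: mult_ac inv_sqrt_minus)
  also have "J + J \<le> ennreal (16 * (b - a)) + ennreal (16 * (b - a))" using J by (intro add_mono)
  also have "\<dots> = ennreal (32 * (b - a))" using e by (simp add: ennreal_plus[symmetric] del: ennreal_plus)
  finally show ?thesis .
qed

text \<open>Separates the times before e from those after e. With p and q the distances to e of the
  nearest times, y = p + q \<ge> sqrt (p q), and the minimum is at most the geometric mean of its
  two arguments.\<close>

lemma inverse_le_pair_sing: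
  assumes u: "u < e" "u' < e" "u \<noteq> u'" and v: "e < v" "e < v'" "v \<noteq> v'"
  defines "y \<equiv> min v v' - max u u'"
  shows "ennreal (1 / (2 * pi * y) * min (1 / (2 * pi * \<bar>u - u'\<bar>)) (1 / (2 * pi * \<bar>v - v'\<bar>))) \<le> pair_sing e u u' * pair_sing e v v'"
proof -
  define p where "p = e - max u u'"
  define q where "q = min v v' - e"
  define x where "x = \<bar>u - u'\<bar>"
  define z where "z = \<bar>v - v'\<bar>"
  have pos: "p > 0" "q > 0" "x > 0" "z > 0" using u v by (auto simp: p_def q_def x_def z_def)
  have y: "y = p + q" unfolding y_def p_def q_def by simp
  have "2 * sqrt (p * q) \<le> p + q" using arith_geo_mean_sqrt[of p q] pos by simp
  hence ypq: "sqrt p * sqrt q \<le> y" unfolding y real_sqrt_mult using pos by (smt (verit) real_sqrt_gt_zero mult_pos_pos)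
  have m: "min (1 / x) (1 / z) \<le> 1 / (sqrt x * sqrt z)"
  proof (cases "x \<le> z")
    case True
    hence "sqrt x * sqrt z \<le> sqrt z * sqrt z" using pos by (intro mult_right_mono) auto
    hence "1 / z \<le> 1 / (sqrt x * sqrt z)" using pos by (intro divide_left_mono) auto
    thus ?thesis by simp
  next
    case False
    hence "sqrt x * sqrt z \<le> sqrt x * sqrt x" using pos by (intro mult_left_mono) auto
    hence "1 / x \<le> 1 / (sqrt x * sqrt z)" using pos by (intro divide_left_mono) auto
    thus ?thesis by simp
  qed
  have "1 / (2 * pi * y) * min (1 / (2 * pi * x)) (1 / (2 * pi * z)) \<le> (1 / y) * min (1 / x) (1 / z)"
  proof (rule mult_mono)
    have pi: "a \<le> 2 * pi * a" if "a > 0" for a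
      using that pi_ge_two mult_right_mono[of 1 "2 * pi" a] by simp
    show "1 / (2 * pi * y) \<le> 1 / y" using pos pi[of y] by (intro divide_left_mono) (auto simp: y)
    show "min (1 / (2 * pi * x)) (1 / (2 * pi * z)) \<le> min (1 / x) (1 / z)"
      using pos pi[of x] pi[of z] by (intro min.mono divide_left_mono) auto
  qed (use pos in \<open>auto simp: y\<close>)
  also have "\<dots> \<le> (1 / (sqrt p * sqrt q)) * (1 / (sqrt x * sqrt z))"
    using pos ypq m by (intro mult_mono divide_left_mono) (auto simp: y)
  also have "\<dots> = (1 / sqrt x * (1 / sqrt p)) * (1 / sqrt z * (1 / sqrt q))" by simp
  finally have "ennreal (1 / (2 * pi * y) * min (1 / (2 * pi * x)) (1 / (2 * pi * z)))
      \<le> ennreal ((1 / sqrt x * (1 / sqrt p)) * (1 / sqrt z * (1 / sqrt q)))" by (rule ennreal_leI)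
  also have "\<dots> = (ennreal (1 / sqrt x) * ennreal (1 / sqrt p)) * (ennreal (1 / sqrt z) * ennreal (1 / sqrt q))"
    using pos by (subst ennreal_mult, simp, simp)+ simp
  also have "\<dots> \<le> pair_sing e u u' * pair_sing e v v'"
  proof (rule mult_mono)
    have "p = \<bar>u - e\<bar> \<or> p = \<bar>u' - e\<bar>" using u by (auto simp: p_def max_def)
    thus "ennreal (1 / sqrt x) * ennreal (1 / sqrt p) \<le> pair_sing e u u'"
      unfolding pair_sing_def x_def using u by (intro mult_mono) (auto simp: inv_sqrt_eq)
    have "q = \<bar>v - e\<bar> \<or> q = \<bar>v' - e\<bar>" using v by (auto simp: q_def min_def)
    thus "ennreal (1 / sqrt z) * ennreal (1 / sqrt q) \<le> pair_sing e v v'"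
      unfolding pair_sing_def z_def using v by (intro mult_mono) (auto simp: inv_sqrt_eq)
  qed auto
  finally show ?thesis unfolding x_def z_def .
qed

context cbm
begin

text \<open>The first bound treats interlaced intervals, the second nested ones. Either outer
  increment, over [a, b] or over [c, d], occurs in a single factor and can be integrated out; the
  other factor spans at least [b, c]. Taking the better of the two choices gives the
  minimum.\<close>

lemma pair_moment_ordered:
  assumes t: "0 \<le> a" "a < b" "b < c" "c < d"
    and [measurable]: "h \<in> borel_measurable borel" and h: "(\<integral>\<^sup>+x. h x \<partial>lborel) \<le> 1"
  shows "(\<integral>\<^sup>+\<omega>. h (X c \<omega> - X a \<omega>) * h (X d \<omega> - X b \<omega>) \<partial>M)
      \<le> ennreal (1 / (2 * pi * (c - b)) * min (1 / (2 * pi * (b - a))) (1 / (2 * pi * (d - c))))" (is "?A \<le> _")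
    and "(\<integral>\<^sup>+\<omega>. h (X d \<omega> - X a \<omega>) * h (X c \<omega> - X b \<omega>) \<partial>M)
      \<le> ennreal (1 / (2 * pi * (c - b)) * min (1 / (2 * pi * (b - a))) (1 / (2 * pi * (d - c))))" (is "?B \<le> _")
proof -
  define t where "t = (\<lambda>i::nat. if i = 0 then a else if i = 1 then b else if i = 2 then c else d)"
  define D where "D = (\<lambda>i \<omega>. X (t (Suc i)) \<omega> - X (t i) \<omega>)"
  have t': "0 \<le> t 0" "\<And>i. i < 3 \<Longrightarrow> t i < t (Suc i)"
    using t by (auto simp: t_def)
  let ?\<kappa> = "\<lambda>x. ennreal (1 / (2 * pi * x))"
  have pivot: "A \<le> ?\<kappa> x * ?\<kappa> (c - b)"
    if A: "A = (\<integral>\<^sup>+\<omega>. h (D j \<omega> + (\<Sum>i\<in>S. D i \<omega>)) * h (\<Sum>i\<in>T. D i \<omega>) \<partial>M)"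
      and j: "j < 3" "x = t (Suc j) - t j" "j \<notin> S" "j \<notin> T" "S \<subseteq> {..<3}" "T \<subseteq> {..<3}"
      and T: "\<And>\<omega>. (\<Sum>i\<in>T. D i \<omega>) = X v \<omega> - X u \<omega>" "0 \<le> u" "c - b \<le> v - u" for A x j S T u v
  proof -
    have "finite S" "finite T" using j by (auto intro: finite_subset)
    hence "A \<le> ?\<kappa> x * (\<integral>\<^sup>+\<omega>. h (X v \<omega> - X u \<omega>) \<partial>M)"
      unfolding A j(2) T(1)[symmetric] using j h t' by (intro three_increments_pivot[OF _ _ _ D_def]) auto
    also have "(\<integral>\<^sup>+\<omega>. h (X v \<omega> - X u \<omega>) \<partial>M) \<le> ?\<kappa> (v - u)"
      using T t h by (intro nn_integral_increment_le) auto
    also have "?\<kappa> (v - u) \<le> ?\<kappa> (c - b)"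
      using T t by (intro ennreal_leI divide_left_mono mult_left_mono) auto
    finally show ?thesis by (simp add: mult_left_mono)
  qed
  have min: "A \<le> ennreal (1 / (2 * pi * (c - b)) * min (1 / (2 * pi * (b - a))) (1 / (2 * pi * (d - c))))"
    if "A \<le> ?\<kappa> (b - a) * ?\<kappa> (c - b)" "A \<le> ?\<kappa> (d - c) * ?\<kappa> (c - b)" for A
    using that t by (auto simp: min_def ennreal_mult[symmetric] mult.commute)
  note D_simps = D_def t_def numeral_2_eq_2
  show "?A \<le> ennreal (1 / (2 * pi * (c - b)) * min (1 / (2 * pi * (b - a))) (1 / (2 * pi * (d - c))))"
  proof (rule min)
    show "?A \<le> ?\<kappa> (b - a) * ?\<kappa> (c - b)"
      by (rule pivot[of _ 0 "{1}" "{1, 2}" _ d b]) (use t in \<open>auto simp: D_simps\<close>)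
    show "?A \<le> ?\<kappa> (d - c) * ?\<kappa> (c - b)"
      by (rule pivot[of _ 2 "{1}" "{0, 1}" _ c a])
         (use t in \<open>auto simp: D_simps mult.commute\<close>)
  qed
  show "?B \<le> ennreal (1 / (2 * pi * (c - b)) * min (1 / (2 * pi * (b - a))) (1 / (2 * pi * (d - c))))"
  proof (rule min)
    show "?B \<le> ?\<kappa> (b - a) * ?\<kappa> (c - b)"
      by (rule pivot[of _ 0 "{1, 2}" "{1}" _ c b]) (use t in \<open>auto simp: D_simps\<close>)
    show "?B \<le> ?\<kappa> (d - c) * ?\<kappa> (c - b)"
      by (rule pivot[of _ 2 "{0, 1}" "{1}" _ c b]) (use t in \<open>auto simp: D_simps\<close>)
  qed
qed

lemma pair_moment_le:
  assumes u: "0 \<le> u" "0 \<le> u'" "u < e" "u' < e" and v: "e \<le> v" "e \<le> v'"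
    and [measurable]: "h \<in> borel_measurable borel" and h: "(\<integral>\<^sup>+x. h x \<partial>lborel) \<le> 1"
  shows "(\<integral>\<^sup>+\<omega>. h (X v \<omega> - X u \<omega>) * h (X v' \<omega> - X u' \<omega>) \<partial>M) \<le> pair_sing e u u' * pair_sing e v v'"
proof (cases "u = u' \<or> v = v' \<or> v = e \<or> v' = e")
  \<comment> \<open>At coinciding times, or when v or v' hits e, the majorant is infinite, because
    \<open>inv_sqrt 0\<close> is infinite and the other factors are positive.\<close>
  case True
  have pos: "pair_sing e x y > 0" for x y
    unfolding pair_sing_def using inv_sqrt_pos by (intro ennreal_zero_less_mult_iff[THEN iffD2] conjI) (auto simp: add_pos_pos)
  have "pair_sing e u u' = \<top> \<or> pair_sing e v v' = \<top>"
    using True inv_sqrt_pos unfolding pair_sing_def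
    by (auto simp: inv_sqrt_0 ennreal_mult_eq_top_iff ennreal_top_mult ennreal_mult_top zero_less_iff_neq_zero)
  hence "pair_sing e u u' * pair_sing e v v' = \<top>"
    using pos by (auto simp: ennreal_mult_eq_top_iff zero_less_iff_neq_zero)
  thus ?thesis by simp
next
  case False
  hence v': "e < v" "e < v'" and ne: "u \<noteq> u'" "v \<noteq> v'" using v by auto
  let ?m = "ennreal (1 / (2 * pi * (min v v' - max u u')) * min (1 / (2 * pi * \<bar>u - u'\<bar>)) (1 / (2 * pi * \<bar>v - v'\<bar>)))"
  have "(\<integral>\<^sup>+\<omega>. h (X v \<omega> - X u \<omega>) * h (X v' \<omega> - X u' \<omega>) \<partial>M) \<le> ?m"
  proof -
    consider "u < u'" "v < v'" | "u < u'" "v' < v" | "u' < u" "v < v'" | "u' < u" "v' < v"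
      using ne by linarith
    thus ?thesis
    proof cases
      case 1
      thus ?thesis using pair_moment_ordered(1)[of u u' v v' h] u v' h by (simp add: abs_if)
    next
      case 2
      thus ?thesis using pair_moment_ordered(2)[of u u' v' v h] u v' h by (simp add: abs_if)
    next
      case 3
      thus ?thesis using pair_moment_ordered(2)[of u' u v v' h] u v' h by (simp add: abs_if mult.commute)
    next
      case 4
      thus ?thesis using pair_moment_ordered(1)[of u' u v' v h] u v' h by (simp add: abs_if mult.commute)
    qed
  qed
  also have "?m \<le> pair_sing e u u' * pair_sing e v v'"
    using u v' ne by (intro inverse_le_pair_sing) auto
  finally show ?thesis .
qed

end

text \<open>The class is stable under \<open>moll\<close>, which changes only the bound; the moment
  bounds for \<open>cross_int\<close> depend on the total mass and not on B.\<close>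

definition kernel :: "real \<Rightarrow> (real^2 \<Rightarrow> real) \<Rightarrow> bool" where
  "kernel B f \<longleftrightarrow> continuous_on UNIV f \<and> (\<forall>z. 0 \<le> f z \<and> f z \<le> B) \<and> (\<integral>\<^sup>+z. ennreal (f z) \<partial>lborel) = 1"

lemma kernelD:
  assumes "kernel B f"
  shows "continuous_on UNIV f" "\<And>z. 0 \<le> f z" "\<And>z. f z \<le> B" "\<And>z. \<bar>f z\<bar> \<le> B"
    "(\<integral>\<^sup>+z. ennreal (f z) \<partial>lborel) = 1" "f \<in> borel_measurable borel" "0 \<le> B"
  using assms unfolding kernel_def
  by (auto intro: borel_measurable_continuous_onI order_trans)

section \<open>Fubini for the mollified functionals\<close>

lemma ennreal_integral_indicator_bounded:
  fixes h :: "real \<times> real \<Rightarrow> real"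
  assumes [measurable]: "A \<in> sets borel" "h \<in> borel_measurable borel"
    and A: "emeasure lborel A < \<infinity>" and h: "\<And>p. 0 \<le> h p" "\<And>p. h p \<le> B"
  shows "ennreal (\<integral>p. indicator A p * h p \<partial>lborel) = (\<integral>\<^sup>+p. indicator A p * ennreal (h p) \<partial>lborel)"
proof -
  have "ennreal (\<integral>p. indicator A p * h p \<partial>lborel) = (\<integral>\<^sup>+p. ennreal (indicator A p * h p) \<partial>lborel)"
    using h A by (intro nn_integral_eq_integral[symmetric] integrable_indicator_mult_bounded[where B = B]) auto
  also have "\<dots> = (\<integral>\<^sup>+p. indicator A p * ennreal (h p) \<partial>lborel)"
    by (intro nn_integral_cong) (simp add: indicator_def)
  finally show ?thesis .
qed

lemma rectangle_sets [measurable]: "{s..<t} \<times> {a..<b} \<in> sets (borel :: (real \<times> real) measure)"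
  by (intro borel_Times) auto

lemma nn_integral_lborel_pair:
  fixes h :: "real \<times> real \<Rightarrow> ennreal"
  assumes [measurable]: "h \<in> borel_measurable borel"
  shows "(\<integral>\<^sup>+p. h p \<partial>lborel) = (\<integral>\<^sup>+v. (\<integral>\<^sup>+u. h (v, u) \<partial>lborel) \<partial>lborel)"
proof -
  have "(\<integral>\<^sup>+p. h p \<partial>lborel) = (\<integral>\<^sup>+p. h p \<partial>(lborel \<Otimes>\<^sub>M lborel))" by (simp add: lborel_prod)
  also have "\<dots> = (\<integral>\<^sup>+v. (\<integral>\<^sup>+u. h (v, u) \<partial>lborel) \<partial>lborel)"
    by (rule lborel.nn_integral_fst[symmetric]) (simp add: lborel_prod)
  finally show ?thesis .
qed

lemma AE_off_diagonal: "AE p in (lborel :: (real \<times> real) measure). fst p \<noteq> snd p"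
proof (rule AE_I')
  have diag: "{p::real \<times> real. fst p = snd p} \<in> sets borel"
    by (intro borel_closed closed_Collect_eq continuous_intros)
  have "emeasure (lborel \<Otimes>\<^sub>M lborel) {p::real \<times> real. fst p = snd p} = (\<integral>\<^sup>+v. emeasure lborel (Pair v -` {p::real \<times> real. fst p = snd p}) \<partial>lborel)"
    by (rule lborel.emeasure_pair_measure_alt) (unfold lborel_prod, use diag in simp)
  also have "(\<lambda>v. Pair v -` {p::real \<times> real. fst p = snd p}) = (\<lambda>v. {v})" by auto
  finally show "{p::real \<times> real. fst p = snd p} \<in> null_sets lborel"
    unfolding lborel_prod using diag by (auto intro!: null_setsI)
qed auto

lemma nn_integral_separated:
  fixes a b :: "real \<Rightarrow> ennreal"
  assumes [measurable]: "a \<in> borel_measurable borel" "b \<in> borel_measurable borel"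
  shows "(\<integral>\<^sup>+p. a (snd p) * b (fst p) \<partial>lborel) = (\<integral>\<^sup>+u. a u \<partial>lborel) * (\<integral>\<^sup>+v. b v \<partial>lborel)"
proof -
  have "(\<integral>\<^sup>+p. a (snd p) * b (fst p) \<partial>lborel) = (\<integral>\<^sup>+v. (\<integral>\<^sup>+u. a u * b v \<partial>lborel) \<partial>lborel)"
    by (subst nn_integral_lborel_pair) auto
  also have "\<dots> = (\<integral>\<^sup>+v. (\<integral>\<^sup>+u. a u \<partial>lborel) * b v \<partial>lborel)"
    by (intro nn_integral_cong nn_integral_multc) simp
  also have "\<dots> = (\<integral>\<^sup>+u. a u \<partial>lborel) * (\<integral>\<^sup>+v. b v \<partial>lborel)"
    by (rule nn_integral_cmult) simp
  finally show ?thesis .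
qed

lemma nn_integral_separated_pairs:
  fixes P Q :: "real \<Rightarrow> real \<Rightarrow> ennreal"
  assumes P: "(\<lambda>z. P (fst z) (snd z)) \<in> borel_measurable (borel \<Otimes>\<^sub>M borel)"
    and Q: "(\<lambda>z. Q (fst z) (snd z)) \<in> borel_measurable (borel \<Otimes>\<^sub>M borel)"
  shows "(\<integral>\<^sup>+p. (\<integral>\<^sup>+q. P (snd p) (snd q) * Q (fst p) (fst q) \<partial>lborel) \<partial>lborel)
    = (\<integral>\<^sup>+u. (\<integral>\<^sup>+u'. P u u' \<partial>lborel) \<partial>lborel) * (\<integral>\<^sup>+v. (\<integral>\<^sup>+v'. Q v v' \<partial>lborel) \<partial>lborel)"
proof -
  have 1: "R u \<in> borel_measurable borel" and 2: "(\<lambda>u. \<integral>\<^sup>+u'. R u u' \<partial>lborel) \<in> borel_measurable borel"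
    if R: "(\<lambda>z. R (fst z) (snd z)) \<in> borel_measurable (borel \<Otimes>\<^sub>M borel)" for R :: "real \<Rightarrow> real \<Rightarrow> ennreal" and u
  proof -
    show "R u \<in> borel_measurable borel" using measurable_Pair2[OF R, of u] by simp
    have "case_prod R \<in> borel_measurable (borel \<Otimes>\<^sub>M (lborel :: real measure))"
      using R by (simp add: case_prod_unfold cong: measurable_cong_sets)
    thus "(\<lambda>u. \<integral>\<^sup>+u'. R u u' \<partial>lborel) \<in> borel_measurable borel"
      by (rule lborel.borel_measurable_nn_integral)
  qed
  have "(\<integral>\<^sup>+p. (\<integral>\<^sup>+q. P (snd p) (snd q) * Q (fst p) (fst q) \<partial>lborel) \<partial>lborel)
    = (\<integral>\<^sup>+p. (\<integral>\<^sup>+u'. P (snd p) u' \<partial>lborel) * (\<integral>\<^sup>+v'. Q (fst p) v' \<partial>lborel) \<partial>lborel)"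
    by (intro nn_integral_cong nn_integral_separated 1[OF P] 1[OF Q])
  also have "\<dots> = (\<integral>\<^sup>+u. (\<integral>\<^sup>+u'. P u u' \<partial>lborel) \<partial>lborel) * (\<integral>\<^sup>+v. (\<integral>\<^sup>+v'. Q v v' \<partial>lborel) \<partial>lborel)"
    by (rule nn_integral_separated[OF 2[OF P] 2[OF Q]])
  finally show ?thesis .
qed

context cbm
begin

lemma nn_integral_swap:
  assumes [measurable]: "(\<lambda>z. h (fst z) (snd z)) \<in> borel_measurable (M \<Otimes>\<^sub>M (borel :: (real \<times> real) measure))"
  shows "(\<integral>\<^sup>+\<omega>. (\<integral>\<^sup>+p. h \<omega> p \<partial>lborel) \<partial>M) = (\<integral>\<^sup>+p. (\<integral>\<^sup>+\<omega>. h \<omega> p \<partial>M) \<partial>(lborel :: (real \<times> real) measure))"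
proof -
  interpret pair_sigma_finite M "lborel :: (real \<times> real) measure" ..
  have "case_prod h \<in> borel_measurable (M \<Otimes>\<^sub>M (lborel :: (real \<times> real) measure))"
    using assms by (simp add: case_prod_unfold cong: measurable_cong_sets)
  thus ?thesis by (rule Fubini'[symmetric])
qed

lemma ennreal_cross_int:
  assumes s: "0 < s" "s < 1" and k: "kernel B f" and \<omega>: "\<omega> \<in> space M"
  shows "ennreal (cross_int f s (\<lambda>t. X t \<omega>)) = (\<integral>\<^sup>+p. indicator ({s..<1} \<times> {0..<s}) p * ennreal (f (X (fst p) \<omega> - X (snd p) \<omega>)) \<partial>lborel)"
proof -
  note [measurable] = kernelD(6)[OF k] path_measurable[OF \<omega>]
  show ?thesis unfolding cross_int_def
    using s kernelD[OF k] by (intro ennreal_integral_indicator_bounded[where B = B] emeasure_subset_unit_square) auto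
qed

lemma ennreal_self_int:
  assumes k: "kernel B f" and \<omega>: "\<omega> \<in> space M"
  shows "ennreal (self_int f (\<lambda>t. X t \<omega>)) = (\<integral>\<^sup>+p. indicator triangle p * ennreal (f (X (fst p) \<omega> - X (snd p) \<omega>)) \<partial>lborel)"
proof -
  note [measurable] = kernelD(6)[OF k] path_measurable[OF \<omega>]
  show ?thesis unfolding self_int_def
    using kernelD[OF k] by (intro ennreal_integral_indicator_bounded[where B = B] emeasure_triangle) auto
qed

lemma nn_integral_cross_int_le:
  assumes s: "0 < s" "s < 1" and k: "kernel B f"
  shows "(\<integral>\<^sup>+\<omega>. ennreal (cross_int f s (\<lambda>t. X t \<omega>)) \<partial>M) \<le> ennreal ((- (s * ln s) - (1 - s) * ln (1 - s)) / (2 * pi))"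
proof -
  note [measurable] = kernelD(6)[OF k]
  let ?R = "{s..<1} \<times> {0..<s}"
  have "(\<integral>\<^sup>+\<omega>. ennreal (cross_int f s (\<lambda>t. X t \<omega>)) \<partial>M)
     = (\<integral>\<^sup>+\<omega>. (\<integral>\<^sup>+p. indicator ?R p * ennreal (f (X (fst p) \<omega> - X (snd p) \<omega>)) \<partial>lborel) \<partial>M)"
    using ennreal_cross_int[OF s k] by (intro nn_integral_cong) auto
  also have "\<dots> = (\<integral>\<^sup>+p. (\<integral>\<^sup>+\<omega>. indicator ?R p * ennreal (f (X (fst p) \<omega> - X (snd p) \<omega>)) \<partial>M) \<partial>lborel)"
    by (rule nn_integral_swap) measurable
  also have "\<dots> \<le> (\<integral>\<^sup>+p. ennreal (1 / (2 * pi)) * (ennreal (1 / (fst p - snd p)) * indicator {0..s} (snd p) * indicator {s..1} (fst p)) \<partial>lborel)"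
  proof (rule nn_integral_mono)
    fix p :: "real \<times> real"
    show "(\<integral>\<^sup>+\<omega>. indicator ?R p * ennreal (f (X (fst p) \<omega> - X (snd p) \<omega>)) \<partial>M)
      \<le> ennreal (1 / (2 * pi)) * (ennreal (1 / (fst p - snd p)) * indicator {0..s} (snd p) * indicator {s..1} (fst p))"
    proof (cases "p \<in> ?R")
      case True
      hence p: "0 \<le> snd p" "snd p < fst p" "snd p \<in> {0..s}" "fst p \<in> {s..1}" by auto
      have "(\<integral>\<^sup>+\<omega>. ennreal (f (X (fst p) \<omega> - X (snd p) \<omega>)) \<partial>M) \<le> ennreal (1 / (2 * pi * (fst p - snd p)))"
        using p kernelD[OF k] by (intro nn_integral_increment_le) auto
      thus ?thesis using True p by (simp add: ennreal_mult[symmetric])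
    qed simp
  qed
  also have "\<dots> = ennreal (1 / (2 * pi)) * (\<integral>\<^sup>+p. ennreal (1 / (fst p - snd p)) * indicator {0..s} (snd p) * indicator {s..1} (fst p) \<partial>lborel)"
    by (rule nn_integral_cmult) measurable
  also have "(\<integral>\<^sup>+p. ennreal (1 / (fst p - snd p)) * indicator {0..s} (snd p) * indicator {s..1} (fst p) \<partial>lborel)
      = (\<integral>\<^sup>+v. (\<integral>\<^sup>+u. ennreal (1 / (v - u)) * indicator {0..s} u \<partial>lborel) * indicator {s..1} v \<partial>lborel)"
    by (subst nn_integral_lborel_pair, measurable) (auto intro!: nn_integral_cong nn_integral_multc)
  also have "\<dots> = ennreal (- (s * ln s) - (1 - s) * ln (1 - s))"
    by (rule nn_integral_rectangle_inverse[OF s])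
  also have "ennreal (1 / (2 * pi)) * ennreal (- (s * ln s) - (1 - s) * ln (1 - s)) = ennreal ((- (s * ln s) - (1 - s) * ln (1 - s)) / (2 * pi))"
    by (subst ennreal_mult'[symmetric]) auto
  finally show ?thesis .
qed

text \<open>The square is a double integral over two pairs of times; \<open>pair_moment_le\<close>
  bounds its mean by a function of the earlier times multiplied by one of the later times. Each half
  of the time interval contributes 32 * 1/2 = 16, and 256 = 16 * 16.\<close>

lemma nn_integral_cross_int_square_le:
  assumes k: "kernel B f"
  shows "(\<integral>\<^sup>+\<omega>. ennreal ((cross_int f (1/2) (\<lambda>t. X t \<omega>))\<^sup>2) \<partial>M) \<le> ennreal 256"
proof -
  note [measurable] = kernelD(6)[OF k]
  let ?R = "{1/2..<1} \<times> {0..<1/2} :: (real \<times> real) set"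
  let ?I = "indicator {0..1/2} :: real \<Rightarrow> ennreal" and ?J = "indicator {1/2..1} :: real \<Rightarrow> ennreal"
  define G where "G = (\<lambda>\<omega> p. indicator ?R p * ennreal (f (X (fst p) \<omega> - X (snd p) \<omega>)))"
  have [measurable]: "(\<lambda>z. G (g1 z) (g2 z)) \<in> borel_measurable N"
    if [measurable]: "g1 \<in> measurable N M" "g2 \<in> borel_measurable N" for g1 g2 and N :: "'z measure"
    unfolding G_def by measurable
  have "(\<integral>\<^sup>+\<omega>. ennreal ((cross_int f (1/2) (\<lambda>t. X t \<omega>))\<^sup>2) \<partial>M)
     = (\<integral>\<^sup>+\<omega>. (\<integral>\<^sup>+p. (\<integral>\<^sup>+q. G \<omega> p * G \<omega> q \<partial>lborel) \<partial>lborel) \<partial>M)"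
  proof (rule nn_integral_cong)
    fix \<omega> assume \<omega>: "\<omega> \<in> space M"
    note [measurable] = path_measurable[OF \<omega>]
    have [measurable]: "G \<omega> \<in> borel_measurable borel" unfolding G_def by measurable
    have "ennreal ((cross_int f (1/2) (\<lambda>t. X t \<omega>))\<^sup>2) = ennreal (cross_int f (1/2) (\<lambda>t. X t \<omega>)) * ennreal (cross_int f (1/2) (\<lambda>t. X t \<omega>))"
      using kernelD[OF k] by (simp add: power2_eq_square ennreal_mult cross_int_nonneg)
    also have "\<dots> = (\<integral>\<^sup>+p. G \<omega> p \<partial>lborel) * (\<integral>\<^sup>+q. G \<omega> q \<partial>lborel)"
      using ennreal_cross_int[OF _ _ k \<omega>, of "1/2"] unfolding G_def by simp
    also have "\<dots> = (\<integral>\<^sup>+p. (\<integral>\<^sup>+q. G \<omega> p * G \<omega> q \<partial>lborel) \<partial>lborel)"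
      by (simp add: nn_integral_cmult nn_integral_multc)
    finally show "ennreal ((cross_int f (1/2) (\<lambda>t. X t \<omega>))\<^sup>2) = (\<integral>\<^sup>+p. (\<integral>\<^sup>+q. G \<omega> p * G \<omega> q \<partial>lborel) \<partial>lborel)" .
  qed
  also have "\<dots> = (\<integral>\<^sup>+p. (\<integral>\<^sup>+\<omega>. (\<integral>\<^sup>+q. G \<omega> p * G \<omega> q \<partial>lborel) \<partial>M) \<partial>lborel)"
    by (rule nn_integral_swap) measurable
  also have "\<dots> = (\<integral>\<^sup>+p. (\<integral>\<^sup>+q. (\<integral>\<^sup>+\<omega>. G \<omega> p * G \<omega> q \<partial>M) \<partial>lborel) \<partial>lborel)"
    by (intro nn_integral_cong nn_integral_swap) measurable
  also have "\<dots> \<le> (\<integral>\<^sup>+p. (\<integral>\<^sup>+q. (pair_sing (1/2) (snd p) (snd q) * ?I (snd q) * ?I (snd p)) *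
      (pair_sing (1/2) (fst p) (fst q) * ?J (fst q) * ?J (fst p)) \<partial>lborel) \<partial>lborel)"
  proof (intro nn_integral_mono)
    fix p q :: "real \<times> real"
    show "(\<integral>\<^sup>+\<omega>. G \<omega> p * G \<omega> q \<partial>M) \<le> (pair_sing (1/2) (snd p) (snd q) * ?I (snd q) * ?I (snd p)) *
      (pair_sing (1/2) (fst p) (fst q) * ?J (fst q) * ?J (fst p))"
    proof (cases "p \<in> ?R \<and> q \<in> ?R")
      case True
      hence "(\<integral>\<^sup>+\<omega>. ennreal (f (X (fst p) \<omega> - X (snd p) \<omega>)) * ennreal (f (X (fst q) \<omega> - X (snd q) \<omega>)) \<partial>M)
         \<le> pair_sing (1/2) (snd p) (snd q) * pair_sing (1/2) (fst p) (fst q)"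
        using kernelD[OF k] by (intro pair_moment_le) auto
      moreover have "snd p \<in> {0..1/2}" "snd q \<in> {0..1/2}" "fst p \<in> {1/2..1}" "fst q \<in> {1/2..1}" using True by auto
      ultimately show ?thesis using True by (simp add: G_def)
    next
      case False
      hence "(\<lambda>\<omega>. G \<omega> p * G \<omega> q) = (\<lambda>_. 0)" by (auto simp: G_def)
      thus ?thesis by (simp only: nn_integral_const) simp
    qed
  qed
  also have "\<dots> = (\<integral>\<^sup>+u. (\<integral>\<^sup>+u'. pair_sing (1/2) u u' * ?I u' * ?I u \<partial>lborel) \<partial>lborel) *
      (\<integral>\<^sup>+v. (\<integral>\<^sup>+v'. pair_sing (1/2) v v' * ?J v' * ?J v \<partial>lborel) \<partial>lborel)"
    by (rule nn_integral_separated_pairs) measurable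
  also have "\<dots> = (\<integral>\<^sup>+u. (\<integral>\<^sup>+u'. pair_sing (1/2) u u' * ?I u' \<partial>lborel) * ?I u \<partial>lborel) *
      (\<integral>\<^sup>+v. (\<integral>\<^sup>+v'. pair_sing (1/2) v v' * ?J v' \<partial>lborel) * ?J v \<partial>lborel)"
    by (intro arg_cong2[where f = times] nn_integral_cong nn_integral_multc) measurable
  also have "\<dots> \<le> ennreal (32 * (1/2 - 0)) * ennreal (32 * (1 - 1/2))"
    by (intro mult_mono nn_integral_pair_sing) auto
  also have "\<dots> = ennreal 256" by (simp add: ennreal_mult[symmetric])
  finally show ?thesis .
qed

section \<open>Change of measure by a drift\<close>

lemma nn_integral_exp_increment:
  assumes "0 \<le> s" "s \<le> t"
  shows "(\<integral>\<^sup>+\<omega>. ennreal (exp (\<mu> \<bullet> (X t \<omega> - X s \<omega>) - (norm \<mu>)\<^sup>2 * (t - s) / 2)) \<partial>M) = 1"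
proof (cases "s = t")
  case True
  thus ?thesis by (simp add: emeasure_space_1)
next
  case False
  hence st: "s < t" using assms by simp
  have "(\<integral>\<^sup>+\<omega>. ennreal (exp (\<mu> \<bullet> (X t \<omega> - X s \<omega>) - (norm \<mu>)\<^sup>2 * (t - s) / 2)) \<partial>M)
    = (\<integral>\<^sup>+x. ennreal (gauss2 (t - s) x) * ennreal (exp (\<mu> \<bullet> x - (norm \<mu>)\<^sup>2 * (t - s) / 2)) \<partial>lborel)"
    using assms st by (intro nn_integral_increment) measurable
  also have "\<dots> = (\<integral>\<^sup>+x. ennreal (gauss2 (t - s) (x + (- (t - s) *\<^sub>R \<mu>))) \<partial>lborel)"
  proof (intro nn_integral_cong)
    fix x
    have "gauss2 (t - s) x * exp (\<mu> \<bullet> x - (norm \<mu>)\<^sup>2 * (t - s) / 2) = gauss2 (t - s) (x + (- (t - s) *\<^sub>R \<mu>))"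
      using gauss2_tilt[of "t - s" x \<mu>] st by (simp only: diff_gt_0_iff_gt scaleR_minus_left add_uminus_conv_diff)
    thus "ennreal (gauss2 (t - s) x) * ennreal (exp (\<mu> \<bullet> x - (norm \<mu>)\<^sup>2 * (t - s) / 2)) = ennreal (gauss2 (t - s) (x + (- (t - s) *\<^sub>R \<mu>)))"
      using st gauss2_nonneg[of "t - s" x] by (simp only: ennreal_mult[symmetric] exp_ge_zero diff_gt_0_iff_gt)
  qed
  also have "\<dots> = 1"
    using st by (subst nn_integral_translate) (auto simp: nn_integral_gauss2)
  finally show ?thesis .
qed

text \<open>Girsanov's theorem for one increment: the density factors over [0, u], [u, v] and
  [v, 1]. The outer factors have mean one, and the middle one moves the Gaussian by (v - u)
  \<mu>.\<close>

lemma nn_integral_tilted_increment: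
  assumes u: "0 \<le> u" "u < v" "v \<le> 1" and [measurable]: "f \<in> borel_measurable borel" and f: "\<And>z. 0 \<le> f z"
  shows "(\<integral>\<^sup>+\<omega>. ennreal (f (X v \<omega> - X u \<omega>) * exp (\<mu> \<bullet> (X 1 \<omega> - X 0 \<omega>) - (norm \<mu>)\<^sup>2 / 2)) \<partial>M)
    = (\<integral>\<^sup>+x. ennreal (f x * gauss2 (v - u) (x - (v - u) *\<^sub>R \<mu>)) \<partial>lborel)"
proof -
  define t where "t = (\<lambda>i::nat. if i = 0 then 0 else if i = 1 then u else if i = 2 then v else 1)"
  define E where "E = (\<lambda>i (z :: real^2). exp (\<mu> \<bullet> z - (norm \<mu>)\<^sup>2 * (t (Suc i) - t i) / 2))"
  define Y where "Y = (\<lambda>i::nat. \<lambda>z. (if i = 1 then f z else 1) * E i z)"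
  have "indep_vars (\<lambda>_. borel) (\<lambda>i \<omega>. X (t (Suc i)) \<omega> - X (t i) \<omega>) {..<3}"
    using u by (intro X_indep) (auto simp: t_def)
  from indep_vars_compose2[OF this, of "\<lambda>i z. ennreal (Y i z)" "\<lambda>_. borel"]
  have indep: "indep_vars (\<lambda>_. borel) (\<lambda>i \<omega>. ennreal (Y i (X (t (Suc i)) \<omega> - X (t i) \<omega>))) {..<3}"
    unfolding Y_def E_def by measurable
  have "f (X v \<omega> - X u \<omega>) * exp (\<mu> \<bullet> (X 1 \<omega> - X 0 \<omega>) - (norm \<mu>)\<^sup>2 / 2) = (\<Prod>i<3. Y i (X (t (Suc i)) \<omega> - X (t i) \<omega>))" for \<omega>
  proof -
    have "(\<Prod>i<3. Y i (X (t (Suc i)) \<omega> - X (t i) \<omega>)) = f (X v \<omega> - X u \<omega>) *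
       (exp (\<mu> \<bullet> (X u \<omega> - X 0 \<omega>) - (norm \<mu>)\<^sup>2 * (u - 0) / 2) * exp (\<mu> \<bullet> (X v \<omega> - X u \<omega>) - (norm \<mu>)\<^sup>2 * (v - u) / 2) *
        exp (\<mu> \<bullet> (X 1 \<omega> - X v \<omega>) - (norm \<mu>)\<^sup>2 * (1 - v) / 2))"
      by (simp add: Y_def E_def t_def eval_nat_numeral lessThan_Suc)
    also have "\<dots> = f (X v \<omega> - X u \<omega>) * exp (\<mu> \<bullet> (X 1 \<omega> - X 0 \<omega>) - (norm \<mu>)\<^sup>2 / 2)"
      by (simp add: exp_add[symmetric] inner_diff_right) (simp add: field_simps)
    finally show ?thesis ..
  qed
  hence "(\<integral>\<^sup>+\<omega>. ennreal (f (X v \<omega> - X u \<omega>) * exp (\<mu> \<bullet> (X 1 \<omega> - X 0 \<omega>) - (norm \<mu>)\<^sup>2 / 2)) \<partial>M)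
      = (\<Prod>i<3. \<integral>\<^sup>+\<omega>. ennreal (Y i (X (t (Suc i)) \<omega> - X (t i) \<omega>)) \<partial>M)"
    using indep_vars_nn_integral[OF _ indep] f by (simp add: prod_ennreal Y_def E_def)
  also have "\<dots> = (\<integral>\<^sup>+\<omega>. ennreal (Y 1 (X v \<omega> - X u \<omega>)) \<partial>M)"
    using nn_integral_exp_increment[of 0 u \<mu>] nn_integral_exp_increment[of v 1 \<mu>] u
    by (simp add: Y_def E_def t_def eval_nat_numeral lessThan_Suc)
  also have "\<dots> = (\<integral>\<^sup>+x. ennreal (gauss2 (v - u) x) * ennreal (Y 1 x) \<partial>lborel)"
    unfolding Y_def E_def using u by (intro nn_integral_increment) measurable
  also have "\<dots> = (\<integral>\<^sup>+x. ennreal (f x * gauss2 (v - u) (x - (v - u) *\<^sub>R \<mu>)) \<partial>lborel)"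
  proof (intro nn_integral_cong)
    fix x
    have "ennreal (gauss2 (v - u) x) * ennreal (Y 1 x) = ennreal (f x * (gauss2 (v - u) x * exp (\<mu> \<bullet> x - (norm \<mu>)\<^sup>2 * (v - u) / 2)))"
      using u f gauss2_nonneg by (simp add: Y_def E_def t_def ennreal_mult[symmetric] mult_ac eval_nat_numeral)
    thus "ennreal (gauss2 (v - u) x) * ennreal (Y 1 x) = ennreal (f x * gauss2 (v - u) (x - (v - u) *\<^sub>R \<mu>))"
      using u by (simp add: gauss2_tilt)
  qed
  finally show ?thesis .
qed

lemma nn_integral_tilted_self_int:
  assumes k: "kernel B f"
  shows "(\<integral>\<^sup>+\<omega>. ennreal (self_int f (\<lambda>t. X t \<omega>) * exp (\<mu> \<bullet> (X 1 \<omega> - X 0 \<omega>) - (norm \<mu>)\<^sup>2 / 2)) \<partial>M)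
    = (\<integral>\<^sup>+p. indicator triangle p * (\<integral>\<^sup>+x. ennreal (f x * gauss2 (fst p - snd p) (x - (fst p - snd p) *\<^sub>R \<mu>)) \<partial>lborel) \<partial>lborel)"
proof -
  note [measurable] = kernelD(6)[OF k]
  define D where "D = (\<lambda>\<omega>. exp (\<mu> \<bullet> (X 1 \<omega> - X 0 \<omega>) - (norm \<mu>)\<^sup>2 / 2))"
  have [measurable]: "D \<in> borel_measurable M" unfolding D_def by measurable
  have "(\<integral>\<^sup>+\<omega>. ennreal (self_int f (\<lambda>t. X t \<omega>) * D \<omega>) \<partial>M)
     = (\<integral>\<^sup>+\<omega>. (\<integral>\<^sup>+p. indicator triangle p * ennreal (f (X (fst p) \<omega> - X (snd p) \<omega>) * D \<omega>) \<partial>lborel) \<partial>M)"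
  proof (rule nn_integral_cong)
    fix \<omega> assume \<omega>: "\<omega> \<in> space M"
    note [measurable] = path_measurable[OF \<omega>]
    have "ennreal (self_int f (\<lambda>t. X t \<omega>) * D \<omega>) = (\<integral>\<^sup>+p. indicator triangle p * ennreal (f (X (fst p) \<omega> - X (snd p) \<omega>)) \<partial>lborel) * ennreal (D \<omega>)"
      unfolding ennreal_self_int[OF k \<omega>, symmetric] by (simp add: ennreal_mult'' D_def)
    also have "\<dots> = (\<integral>\<^sup>+p. indicator triangle p * ennreal (f (X (fst p) \<omega> - X (snd p) \<omega>)) * ennreal (D \<omega>) \<partial>lborel)"
      by (rule nn_integral_multc[symmetric]) measurable
    finally show "ennreal (self_int f (\<lambda>t. X t \<omega>) * D \<omega>) = (\<integral>\<^sup>+p. indicator triangle p * ennreal (f (X (fst p) \<omega> - X (snd p) \<omega>) * D \<omega>) \<partial>lborel)"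
      by (simp add: ennreal_mult'' D_def mult.assoc)
  qed
  also have "\<dots> = (\<integral>\<^sup>+p. (\<integral>\<^sup>+\<omega>. indicator triangle p * ennreal (f (X (fst p) \<omega> - X (snd p) \<omega>) * D \<omega>) \<partial>M) \<partial>lborel)"
    by (rule nn_integral_swap) measurable
  also have "\<dots> = (\<integral>\<^sup>+p. indicator triangle p * (\<integral>\<^sup>+x. ennreal (f x * gauss2 (fst p - snd p) (x - (fst p - snd p) *\<^sub>R \<mu>)) \<partial>lborel) \<partial>lborel)"
  proof (rule nn_integral_cong_AE)
    note AE_off_diagonal
    thus "AE p in lborel. (\<integral>\<^sup>+\<omega>. indicator triangle p * ennreal (f (X (fst p) \<omega> - X (snd p) \<omega>) * D \<omega>) \<partial>M)
       = indicator triangle p * (\<integral>\<^sup>+x. ennreal (f x * gauss2 (fst p - snd p) (x - (fst p - snd p) *\<^sub>R \<mu>)) \<partial>lborel)"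
    proof eventually_elim
      case (elim p)
      show ?case
      proof (cases "p \<in> triangle")
        case True
        thus ?thesis using elim nn_integral_tilted_increment[of "snd p" "fst p" f \<mu>] kernelD[OF k]
          by (simp add: triangle_def D_def)
      qed simp
    qed
  qed
  finally show ?thesis unfolding D_def .
qed

end

section \<open>Uniform exponential bounds\<close>

lemma moll_scale:
  assumes "t > 0"
  shows "moll \<phi> \<epsilon> (sqrt t *\<^sub>R z) = moll \<phi> (\<epsilon> / sqrt t) z / t"
  using assms by (simp add: moll_def power_divide)

lemma kernel_moll:
  assumes k: "kernel B \<phi>" and e: "\<epsilon> > 0"
  shows "kernel (B / \<epsilon>\<^sup>2) (moll \<phi> \<epsilon>)"
proof -
  note [measurable] = kernelD(6)[OF k]
  have [measurable]: "moll \<phi> \<epsilon> \<in> borel_measurable borel" unfolding moll_def by measurable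
  have "(\<integral>\<^sup>+z. ennreal (moll \<phi> \<epsilon> z) \<partial>lborel)
      = (\<integral>\<^sup>+z. ennreal (\<epsilon>\<^sup>2) * ennreal (moll \<phi> \<epsilon> (\<epsilon> *\<^sub>R z)) \<partial>lborel)"
    by (rule nn_integral_scale[OF _ e]) simp
  also have "\<dots> = (\<integral>\<^sup>+z. ennreal (\<phi> z) \<partial>lborel)"
    using e kernelD(2)[OF k] by (intro nn_integral_cong) (simp add: moll_def ennreal_mult[symmetric])
  finally have "(\<integral>\<^sup>+z. ennreal (moll \<phi> \<epsilon> z) \<partial>lborel) = 1" using kernelD(5)[OF k] by simp
  moreover have "continuous_on UNIV (moll \<phi> \<epsilon>)"
    unfolding moll_def using e
    by (intro continuous_intros continuous_on_compose2[OF kernelD(1)[OF k]]) auto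
  moreover have "0 \<le> moll \<phi> \<epsilon> z \<and> moll \<phi> \<epsilon> z \<le> B / \<epsilon>\<^sup>2" for z
    using kernelD(2,3)[OF k] by (auto simp: moll_def intro!: divide_right_mono)
  ultimately show ?thesis unfolding kernel_def by blast
qed

lemma self_int_divide: "self_int (\<lambda>z. f z / c) x = self_int f x / c"
  unfolding self_int_def by simp

text \<open>(1 - x + x^2 / 2) (1 + x + x^2 / 2) = 1 + x^4 / 4, and the second factor is at most exp
  x.\<close>

lemma exp_minus_le_quadratic:
  fixes x :: real
  assumes "x \<ge> 0"
  shows "exp (- x) \<le> 1 - x + x\<^sup>2 / 2"
proof -
  have "1 \<le> (1 - x + x\<^sup>2 / 2) * (1 + x + x\<^sup>2 / 2)"
    using assms by (simp add: algebra_simps power2_eq_square)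
  also have "\<dots> \<le> (1 - x + x\<^sup>2 / 2) * exp x"
  proof (rule mult_left_mono[OF exp_lower_Taylor_quadratic[OF assms]])
    show "0 \<le> 1 - x + x\<^sup>2 / 2" using zero_le_power2[of "x - 1"] by (simp add: power2_eq_square algebra_simps)
  qed
  finally show ?thesis by (simp add: exp_minus field_simps)
qed

text \<open>As Z is nonnegative, exp (- \<theta> Z) is bounded by its quadratic Taylor polynomial,
  so a second moment alone gives a Gaussian bound for every \<theta> \<ge> 0. The bound b serves
  integrability; the estimate sees only C.\<close>

lemma (in prob_space) exp_lower_deviation:
  fixes Z :: "'a \<Rightarrow> real"
  assumes [measurable]: "Z \<in> borel_measurable M" and Z: "\<And>\<omega>. \<omega> \<in> space M \<Longrightarrow> 0 \<le> Z \<omega> \<and> Z \<omega> \<le> b"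
    and C: "expectation (\<lambda>\<omega>. (Z \<omega>)\<^sup>2) \<le> C" and \<theta>: "\<theta> \<ge> 0"
  shows "expectation (\<lambda>\<omega>. exp (- \<theta> * (Z \<omega> - expectation Z))) \<le> exp (\<theta>\<^sup>2 * C / 2)"
proof -
  define c where "c = expectation Z"
  have int1: "integrable M Z" by (rule integrable_const_bound[where B = b]) (use Z in auto)
  have int2: "integrable M (\<lambda>\<omega>. (Z \<omega>)\<^sup>2)"
    by (rule integrable_const_bound[where B = "b\<^sup>2"]) (use Z in \<open>auto intro!: AE_I2 power_mono\<close>)
  have int3: "integrable M (\<lambda>\<omega>. exp (- \<theta> * Z \<omega>))"
    by (rule integrable_const_bound[where B = 1]) (use Z \<theta> in \<open>auto intro!: AE_I2\<close>)
  have "expectation (\<lambda>\<omega>. exp (- \<theta> * Z \<omega>)) \<le> expectation (\<lambda>\<omega>. 1 - \<theta> * Z \<omega> + \<theta>\<^sup>2 / 2 * (Z \<omega>)\<^sup>2)"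
  proof (rule integral_mono[OF int3])
    show "integrable M (\<lambda>\<omega>. 1 - \<theta> * Z \<omega> + \<theta>\<^sup>2 / 2 * (Z \<omega>)\<^sup>2)"
      by (intro Bochner_Integration.integrable_add Bochner_Integration.integrable_diff integrable_mult_right int1 int2) simp
    fix \<omega> assume "\<omega> \<in> space M"
    thus "exp (- \<theta> * Z \<omega>) \<le> 1 - \<theta> * Z \<omega> + \<theta>\<^sup>2 / 2 * (Z \<omega>)\<^sup>2"
      using exp_minus_le_quadratic[of "\<theta> * Z \<omega>"] Z \<theta> by (simp add: power_mult_distrib)
  qed
  also have "\<dots> = 1 - \<theta> * c + \<theta>\<^sup>2 / 2 * expectation (\<lambda>\<omega>. (Z \<omega>)\<^sup>2)"
    unfolding c_def using int1 int2 by (simp add: prob_space)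
  also have "\<dots> \<le> 1 + (\<theta>\<^sup>2 * C / 2 - \<theta> * c)"
    using mult_left_mono[OF C, of "\<theta>\<^sup>2 / 2"] by simp
  also have "\<dots> \<le> exp (\<theta>\<^sup>2 * C / 2 - \<theta> * c)" by (rule exp_ge_add_one_self)
  finally have "exp (\<theta> * c) * expectation (\<lambda>\<omega>. exp (- \<theta> * Z \<omega>))
      \<le> exp (\<theta> * c) * exp (\<theta>\<^sup>2 * C / 2 - \<theta> * c)"
    by (rule mult_left_mono) simp
  also have "\<dots> = exp (\<theta>\<^sup>2 * C / 2)" unfolding exp_add[symmetric] by simp
  also have "exp (\<theta> * c) * expectation (\<lambda>\<omega>. exp (- \<theta> * Z \<omega>)) = expectation (\<lambda>\<omega>. exp (\<theta> * c) * exp (- \<theta> * Z \<omega>))"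
    by (rule Bochner_Integration.integral_mult_right[symmetric]) (use int3 in simp)
  also have "(\<lambda>\<omega>. exp (\<theta> * c) * exp (- \<theta> * Z \<omega>)) = (\<lambda>\<omega>. exp (- \<theta> * (Z \<omega> - c)))"
    unfolding exp_add[symmetric] by (simp add: right_diff_distrib)
  finally show ?thesis unfolding c_def .
qed

text \<open>Pointwise form of Hoelder's inequality with exponents 3/2 and 3, from the tangent of exp
  at the weighted mean.\<close>

lemma exp_convex_thirds:
  fixes x y :: real
  shows "exp (2 / 3 * x + 1 / 3 * y) \<le> 2 / 3 * exp x + 1 / 3 * exp y"
proof -
  define c where "c = 2 / 3 * x + 1 / 3 * y"
  have "exp c * (1 + (x - c)) \<le> exp c * exp (x - c)" "exp c * (1 + (y - c)) \<le> exp c * exp (y - c)"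
    by (intro mult_left_mono exp_ge_add_one_self; simp)+
  hence x: "exp c * (1 + (x - c)) \<le> exp x" and y: "exp c * (1 + (y - c)) \<le> exp y"
    by (simp_all add: exp_add[symmetric])
  have "exp c = 2 / 3 * (exp c * (1 + (x - c))) + 1 / 3 * (exp c * (1 + (y - c)))"
    unfolding c_def by (simp add: field_simps)
  also have "\<dots> \<le> 2 / 3 * exp x + 1 / 3 * exp y" using x y by simp
  finally show ?thesis unfolding c_def .
qed

section \<open>The mollified functional and its exponential moments\<close>

locale cbm_kernel = cbm M X for M :: "'a measure" and X :: "real \<Rightarrow> 'a \<Rightarrow> real^2" +
  fixes \<phi> :: "real^2 \<Rightarrow> real" and B :: real
  assumes phi: "kernel B \<phi>"
begin

definition SI :: "real \<Rightarrow> 'a \<Rightarrow> real" where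
  "SI \<epsilon> \<omega> = self_int (moll \<phi> \<epsilon>) (\<lambda>t. X t \<omega>)"

definition SI_block :: "real \<Rightarrow> real \<Rightarrow> real \<Rightarrow> 'a \<Rightarrow> real" where
  "SI_block a t \<epsilon> \<omega> = self_int (moll \<phi> \<epsilon>) (block a t (\<lambda>t. X t \<omega>))"

definition cross :: "real \<Rightarrow> real \<Rightarrow> 'a \<Rightarrow> real" where
  "cross s \<epsilon> \<omega> = cross_int (moll \<phi> \<epsilon>) s (\<lambda>t. X t \<omega>)"

text \<open>Approximation of - \<beta>: with this sign the lower tail of \<beta> becomes an upper
  tail, governed by positive exponential moments.\<close>

definition xi :: "real \<Rightarrow> 'a \<Rightarrow> real" where
  "xi \<epsilon> \<omega> = expectation (SI \<epsilon>) - SI \<epsilon> \<omega>"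

definition mgf :: "real \<Rightarrow> real \<Rightarrow> real" where
  "mgf \<epsilon> l = expectation (\<lambda>\<omega>. exp (l * xi \<epsilon> \<omega>))"

text \<open>Crude bound at \<epsilon> = 1. At general \<epsilon> it becomes SI_bound / \<epsilon>^2,
  which blows up; it secures integrability and the case \<epsilon> \<ge> 1.\<close>

definition SI_bound :: real where "SI_bound = B * measure lborel triangle"

lemma SI_bound_nonneg: "0 \<le> SI_bound"
  unfolding SI_bound_def using kernelD(7)[OF phi] by simp

lemma SI_measurable [measurable]: "\<epsilon> > 0 \<Longrightarrow> SI \<epsilon> \<in> borel_measurable M"
  unfolding SI_def using kernelD(6)[OF kernel_moll[OF phi]] by (intro self_int_measurable) auto

lemma cross_measurable [measurable]: "\<epsilon> > 0 \<Longrightarrow> cross s \<epsilon> \<in> borel_measurable M"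
  unfolding cross_def using kernelD(6)[OF kernel_moll[OF phi]] by (intro cross_int_measurable) auto

lemma SI_bounds:
  assumes "\<epsilon> > 0" "\<omega> \<in> space M"
  shows "0 \<le> SI \<epsilon> \<omega>" "SI \<epsilon> \<omega> \<le> SI_bound / \<epsilon>\<^sup>2"
  using self_int_bounds[OF kernelD(2,3,6)[OF kernel_moll[OF phi assms(1)]] path_measurable[OF assms(2)]]
  unfolding SI_def SI_bound_def by auto

lemma SI_integrable: "\<epsilon> > 0 \<Longrightarrow> integrable M (SI \<epsilon>)"
  using SI_bounds by (intro integrable_const_bound[where B = "SI_bound / \<epsilon>\<^sup>2"]) auto

lemma xi_measurable [measurable]: "\<epsilon> > 0 \<Longrightarrow> xi \<epsilon> \<in> borel_measurable M"
  unfolding xi_def by measurable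

lemma xi_bound:
  assumes "\<epsilon> > 0" "\<omega> \<in> space M"
  shows "\<bar>xi \<epsilon> \<omega>\<bar> \<le> 2 * (SI_bound / \<epsilon>\<^sup>2)"
proof -
  have "\<bar>expectation (SI \<epsilon>)\<bar> \<le> SI_bound / \<epsilon>\<^sup>2"
    using SI_bounds[OF assms(1)] SI_integrable[OF assms(1)]
    by (auto simp: abs_le_iff intro!: integral_le_const order_trans[OF _ integral_ge_const[of _ 0]]
      divide_nonneg_nonneg SI_bound_nonneg)
  thus ?thesis unfolding xi_def using SI_bounds[OF assms] by linarith
qed

lemma exp_xi_integrable:
  assumes "\<epsilon> > 0"
  shows "integrable M (\<lambda>\<omega>. exp (l * xi \<epsilon> \<omega>))"
proof (rule integrable_const_bound)
  show "AE \<omega> in M. norm (exp (l * xi \<epsilon> \<omega>)) \<le> exp (\<bar>l\<bar> * (2 * (SI_bound / \<epsilon>\<^sup>2)))"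
  proof (rule AE_I2)
    fix \<omega> assume "\<omega> \<in> space M"
    hence "\<bar>l * xi \<epsilon> \<omega>\<bar> \<le> \<bar>l\<bar> * (2 * (SI_bound / \<epsilon>\<^sup>2))"
      unfolding abs_mult using assms by (intro mult_left_mono xi_bound) auto
    thus "norm (exp (l * xi \<epsilon> \<omega>)) \<le> exp (\<bar>l\<bar> * (2 * (SI_bound / \<epsilon>\<^sup>2)))" by simp
  qed
qed (use assms in measurable)

lemma SI_block_law:
  fixes g :: "real \<Rightarrow> real"
  assumes a: "a \<ge> 0" "t > 0" and e: "\<epsilon> > 0" and g: "continuous_on UNIV g"
  shows "expectation (\<lambda>\<omega>. g (SI_block a t \<epsilon> \<omega>)) = expectation (\<lambda>\<omega>. g (SI \<epsilon> \<omega>))"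
  unfolding SI_block_def SI_def
  by (rule self_int_law[OF block_cbm[OF a] cbm_axioms kernelD(1,2,3)[OF kernel_moll[OF phi e]] g])

lemma SI_block_bounds:
  assumes "a \<ge> 0" "t > 0" "\<epsilon> > 0" "\<omega> \<in> space M"
  shows "0 \<le> SI_block a t \<epsilon> \<omega>" "SI_block a t \<epsilon> \<omega> \<le> SI_bound / \<epsilon>\<^sup>2"
  using self_int_bounds[OF kernelD(2,3,6)[OF kernel_moll[OF phi assms(3)]] cbm.path_measurable[OF block_cbm[OF assms(1,2)] assms(4)]]
  unfolding SI_block_def SI_bound_def by auto

lemma SI_block_measurable:
  assumes "a \<ge> 0" "t > 0" "\<epsilon> > 0"
  shows "SI_block a t \<epsilon> \<in> borel_measurable M"
  unfolding SI_block_def using kernelD(6)[OF kernel_moll[OF phi assms(3)]]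
  by (rule cbm.self_int_measurable[OF block_cbm[OF assms(1,2)]])

lemma SI_block_integrable:
  assumes "a \<ge> 0" "t > 0" "\<epsilon> > 0"
  shows "integrable M (SI_block a t \<epsilon>)"
  using SI_block_bounds[OF assms] SI_block_measurable[OF assms]
  by (intro integrable_const_bound[where B = "SI_bound / \<epsilon>\<^sup>2"]) auto

text \<open>Planar scaling: the area factor s^2 meets the factor 1 / s by which \<open>moll\<close>
  changes under sqrt s, and leaves the weight s at mollification \<epsilon> / sqrt s.\<close>

lemma SI_split:
  assumes s: "0 < s" "s < 1" and e: "\<epsilon> > 0" and \<omega>: "\<omega> \<in> space M"
  shows "SI \<epsilon> \<omega> = s * SI_block 0 s (\<epsilon> / sqrt s) \<omega> + (1 - s) * SI_block s (1 - s) (\<epsilon> / sqrt (1 - s)) \<omega> + cross s \<epsilon> \<omega>"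
  using self_int_split[OF s kernelD(6)[OF kernel_moll[OF phi e]] path_measurable[OF \<omega>] kernelD(4)[OF kernel_moll[OF phi e]]] s
  unfolding SI_def SI_block_def cross_def
  by (simp add: moll_scale self_int_divide power2_eq_square)

lemma cross_bounds:
  assumes s: "0 < s" "s < 1" and e: "\<epsilon> > 0" and \<omega>: "\<omega> \<in> space M"
  shows "0 \<le> cross s \<epsilon> \<omega>" "cross s \<epsilon> \<omega> \<le> SI_bound / \<epsilon>\<^sup>2"
proof -
  show 0: "0 \<le> cross s \<epsilon> \<omega>"
    unfolding cross_def using kernelD(2)[OF kernel_moll[OF phi e]] by (rule cross_int_nonneg)
  have "0 \<le> s * SI_block 0 s (\<epsilon> / sqrt s) \<omega>" "0 \<le> (1 - s) * SI_block s (1 - s) (\<epsilon> / sqrt (1 - s)) \<omega>"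
    using s e \<omega> by (auto intro!: mult_nonneg_nonneg SI_block_bounds)
  thus "cross s \<epsilon> \<omega> \<le> SI_bound / \<epsilon>\<^sup>2" using SI_split[OF assms] SI_bounds[OF e \<omega>] by linarith
qed

lemma cross_integrable:
  assumes "0 < s" "s < 1" "\<epsilon> > 0"
  shows "integrable M (cross s \<epsilon>)"
  using cross_bounds[OF assms] assms by (intro integrable_const_bound[where B = "SI_bound / \<epsilon>\<^sup>2"]) auto

text \<open>Subtract \<open>SI_split\<close> from its mean: each block has the law of
  \<open>SI\<close> at its own mollification and is centred by that mean, so no logarithmic
  correction appears.\<close>

lemma xi_split:
  assumes s: "0 < s" "s < 1" and e: "\<epsilon> > 0" and \<omega>: "\<omega> \<in> space M"
  shows "xi \<epsilon> \<omega> = s * (expectation (SI (\<epsilon> / sqrt s)) - SI_block 0 s (\<epsilon> / sqrt s) \<omega>)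
    + (1 - s) * (expectation (SI (\<epsilon> / sqrt (1 - s))) - SI_block s (1 - s) (\<epsilon> / sqrt (1 - s)) \<omega>)
    - (cross s \<epsilon> \<omega> - expectation (cross s \<epsilon>))"
proof -
  let ?e1 = "\<epsilon> / sqrt s" and ?e2 = "\<epsilon> / sqrt (1 - s)"
  have e': "?e1 > 0" "?e2 > 0" using s e by auto
  have "expectation (SI \<epsilon>) = expectation (\<lambda>\<omega>. s * SI_block 0 s ?e1 \<omega> + (1 - s) * SI_block s (1 - s) ?e2 \<omega> + cross s \<epsilon> \<omega>)"
    using SI_split[OF s e] by (intro Bochner_Integration.integral_cong) auto
  also have "\<dots> = s * expectation (SI_block 0 s ?e1) + (1 - s) * expectation (SI_block s (1 - s) ?e2) + expectation (cross s \<epsilon>)"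
    using SI_block_integrable[of 0 s ?e1] SI_block_integrable[of s "1 - s" ?e2] cross_integrable[OF s e] s e' by simp
  also have "expectation (SI_block 0 s ?e1) = expectation (SI ?e1)"
    using SI_block_law[of 0 s ?e1 "\<lambda>x. x"] s e' by simp
  also have "expectation (SI_block s (1 - s) ?e2) = expectation (SI ?e2)"
    using SI_block_law[of s "1 - s" ?e2 "\<lambda>x. x"] s e' by simp
  finally show ?thesis unfolding xi_def SI_split[OF assms] by (simp add: algebra_simps)
qed

lemma mgf_blocks:
  assumes s: "0 < s" "s < 1" and e: "\<epsilon>1 > 0" "\<epsilon>2 > 0"
  shows "expectation (\<lambda>\<omega>. exp (a * (expectation (SI \<epsilon>1) - SI_block 0 s \<epsilon>1 \<omega>) + b * (expectation (SI \<epsilon>2) - SI_block s (1 - s) \<epsilon>2 \<omega>)))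
    = mgf \<epsilon>1 a * mgf \<epsilon>2 b"
proof -
  define g1 where "g1 = (\<lambda>y. exp (a * (expectation (SI \<epsilon>1) - y)))"
  define g2 where "g2 = (\<lambda>y. exp (b * (expectation (SI \<epsilon>2) - y)))"
  have c: "continuous_on UNIV g1" "continuous_on UNIV g2" unfolding g1_def g2_def by (intro continuous_intros)+
  note k = kernelD(1,2,3)[OF kernel_moll[OF phi e(1)]] kernelD(1,2,3)[OF kernel_moll[OF phi e(2)]]
  have "expectation (\<lambda>\<omega>. g1 (SI_block 0 s \<epsilon>1 \<omega>) * g2 (SI_block s (1 - s) \<epsilon>2 \<omega>))
      = expectation (\<lambda>\<omega>. g1 (SI_block 0 s \<epsilon>1 \<omega>)) * expectation (\<lambda>\<omega>. g2 (SI_block s (1 - s) \<epsilon>2 \<omega>))"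
    unfolding SI_block_def by (rule block_integral_product[OF s k(1,2,3) c(1) k(4,5,6) c(2)])
  also have "expectation (\<lambda>\<omega>. g1 (SI_block 0 s \<epsilon>1 \<omega>)) = expectation (\<lambda>\<omega>. g1 (SI \<epsilon>1 \<omega>))"
    using s e c by (intro SI_block_law) auto
  also have "expectation (\<lambda>\<omega>. g2 (SI_block s (1 - s) \<epsilon>2 \<omega>)) = expectation (\<lambda>\<omega>. g2 (SI \<epsilon>2 \<omega>))"
    using s e c by (intro SI_block_law) auto
  finally show ?thesis unfolding g1_def g2_def mgf_def xi_def by (simp add: exp_add)
qed

lemma exp_blocks_integrable:
  assumes s: "0 < s" "s < 1" and e: "\<epsilon>1 > 0" "\<epsilon>2 > 0"
  shows "integrable M (\<lambda>\<omega>. exp (a * (c1 - SI_block 0 s \<epsilon>1 \<omega>) + b * (c2 - SI_block s (1 - s) \<epsilon>2 \<omega>)))"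
proof -
  let ?U = "\<lambda>\<omega>. c1 - SI_block 0 s \<epsilon>1 \<omega>" and ?V = "\<lambda>\<omega>. c2 - SI_block s (1 - s) \<epsilon>2 \<omega>"
  have [measurable]: "SI_block 0 s \<epsilon>1 \<in> borel_measurable M" "SI_block s (1 - s) \<epsilon>2 \<in> borel_measurable M"
    using s e by (auto intro!: SI_block_measurable)
  let ?C = "\<bar>a\<bar> * (\<bar>c1\<bar> + SI_bound / \<epsilon>1\<^sup>2) + \<bar>b\<bar> * (\<bar>c2\<bar> + SI_bound / \<epsilon>2\<^sup>2)"
  show ?thesis
  proof (rule integrable_const_bound)
    show "AE \<omega> in M. norm (exp (a * ?U \<omega> + b * ?V \<omega>)) \<le> exp ?C"
    proof (rule AE_I2)
      fix \<omega> assume \<omega>: "\<omega> \<in> space M"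
      have "a * ?U \<omega> \<le> \<bar>a\<bar> * \<bar>?U \<omega>\<bar>" by (simp add: abs_mult[symmetric])
      also have "\<dots> \<le> \<bar>a\<bar> * (\<bar>c1\<bar> + SI_bound / \<epsilon>1\<^sup>2)"
        using SI_block_bounds[of 0 s \<epsilon>1 \<omega>] s e \<omega> by (intro mult_left_mono) auto
      finally have 1: "a * ?U \<omega> \<le> \<bar>a\<bar> * (\<bar>c1\<bar> + SI_bound / \<epsilon>1\<^sup>2)" .
      have "b * ?V \<omega> \<le> \<bar>b\<bar> * \<bar>?V \<omega>\<bar>" by (simp add: abs_mult[symmetric])
      also have "\<dots> \<le> \<bar>b\<bar> * (\<bar>c2\<bar> + SI_bound / \<epsilon>2\<^sup>2)"
        using SI_block_bounds[of s "1 - s" \<epsilon>2 \<omega>] s e \<omega> by (intro mult_left_mono) auto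
      finally show "norm (exp (a * ?U \<omega> + b * ?V \<omega>)) \<le> exp ?C"
        using 1 by simp
    qed
  qed measurable
qed

lemma expectation_cross_le:
  assumes s: "0 < s" "s < 1" and e: "\<epsilon> > 0"
  shows "expectation (cross s \<epsilon>) \<le> (- (s * ln s) - (1 - s) * ln (1 - s)) / (2 * pi)"
proof -
  have "ennreal (expectation (cross s \<epsilon>)) = (\<integral>\<^sup>+\<omega>. ennreal (cross s \<epsilon> \<omega>) \<partial>M)"
    using cross_bounds[OF s e] by (intro nn_integral_eq_integral[symmetric] cross_integrable s e) auto
  also have "\<dots> \<le> ennreal ((- (s * ln s) - (1 - s) * ln (1 - s)) / (2 * pi))"
    unfolding cross_def by (rule nn_integral_cross_int_le[OF s kernel_moll[OF phi e]])
  finally show ?thesis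
  proof (subst (asm) ennreal_le_iff)
    have "s * ln s \<le> 0" "(1 - s) * ln (1 - s) \<le> 0" using s by (auto intro!: mult_nonneg_nonpos)
    thus "0 \<le> (- (s * ln s) - (1 - s) * ln (1 - s)) / (2 * pi)" by auto
  qed
qed

text \<open>The mutual intersections are nonnegative and are dropped; their mean is kept and costs
  the entropy factor. The blocks are independent, which gives the product.\<close>

lemma mgf_submultiplicative:
  assumes s: "0 < s" "s < 1" and e: "\<epsilon> > 0" and l: "l \<ge> 0"
  shows "mgf \<epsilon> l \<le> mgf (\<epsilon> / sqrt s) (l * s) * mgf (\<epsilon> / sqrt (1 - s)) (l * (1 - s))
    * exp (l * ((- (s * ln s) - (1 - s) * ln (1 - s)) / (2 * pi)))"
proof -
  let ?e1 = "\<epsilon> / sqrt s" and ?e2 = "\<epsilon> / sqrt (1 - s)"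
  let ?A = "\<lambda>\<omega>. expectation (SI ?e1) - SI_block 0 s ?e1 \<omega>"
  let ?B = "\<lambda>\<omega>. expectation (SI ?e2) - SI_block s (1 - s) ?e2 \<omega>"
  let ?H = "(- (s * ln s) - (1 - s) * ln (1 - s)) / (2 * pi)"
  let ?E = "\<lambda>\<omega>. exp (l * s * ?A \<omega> + l * (1 - s) * ?B \<omega>)"
  have e': "?e1 > 0" "?e2 > 0" using s e by auto
  have "mgf \<epsilon> l \<le> expectation (\<lambda>\<omega>. ?E \<omega> * exp (l * ?H))"
    unfolding mgf_def
  proof (rule integral_mono)
    fix \<omega> assume \<omega>: "\<omega> \<in> space M"
    have "l * xi \<epsilon> \<omega> = (l * s * ?A \<omega> + l * (1 - s) * ?B \<omega>)
        + l * (expectation (cross s \<epsilon>) - cross s \<epsilon> \<omega>)"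
      unfolding xi_split[OF s e \<omega>] by (simp add: algebra_simps)
    moreover have "l * (expectation (cross s \<epsilon>) - cross s \<epsilon> \<omega>) \<le> l * ?H"
      using expectation_cross_le[OF s e] cross_bounds(1)[OF s e \<omega>] l by (intro mult_left_mono) auto
    ultimately show "exp (l * xi \<epsilon> \<omega>) \<le> ?E \<omega> * exp (l * ?H)"
      unfolding exp_add[symmetric] by simp
  qed (use s e e' in \<open>auto intro!: exp_xi_integrable exp_blocks_integrable\<close>)
  also have "\<dots> = expectation ?E * exp (l * ?H)" by simp
  also have "expectation ?E = mgf ?e1 (l * s) * mgf ?e2 (l * (1 - s))"
    by (rule mgf_blocks[OF s e'])
  finally show ?thesis .
qed

text \<open>Write K for this constant. The second entry starts the recursion at \<epsilon> \<ge> 1.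
  The first closes it: one halving yields 3/4 K + 9 * 256 / 6 in place of K, and 9 * 256 / 6 = 384
  \<le> K / 4 for K \<ge> 1536.\<close>

definition mgf_rate :: real where "mgf_rate = max 1536 (SI_bound\<^sup>2 / 2)"

lemma mgf_le_base:
  assumes e: "\<epsilon> \<ge> 1" and l: "l \<ge> 0"
  shows "mgf \<epsilon> l \<le> exp (mgf_rate * l\<^sup>2)"
proof -
  have e0: "\<epsilon> > 0" using e by simp
  have b: "0 \<le> SI \<epsilon> \<omega> \<and> SI \<epsilon> \<omega> \<le> SI_bound" if "\<omega> \<in> space M" for \<omega>
  proof -
    have "SI_bound / \<epsilon>\<^sup>2 \<le> SI_bound" using SI_bound_nonneg e by (simp add: divide_le_eq mult_le_cancel_left1)
    thus ?thesis using SI_bounds[OF e0 that] by simp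
  qed
  have "expectation (\<lambda>\<omega>. (SI \<epsilon> \<omega>)\<^sup>2) \<le> SI_bound\<^sup>2"
    using b e0 by (intro integral_le_const integrable_const_bound[where B = "SI_bound\<^sup>2"] AE_I2) (auto intro: power_mono)
  from exp_lower_deviation[OF SI_measurable[OF e0] b this l]
  have "mgf \<epsilon> l \<le> exp (l\<^sup>2 * SI_bound\<^sup>2 / 2)"
    unfolding mgf_def xi_def by (simp add: algebra_simps)
  also have "\<dots> \<le> exp (mgf_rate * l\<^sup>2)"
    using mult_right_mono[of "SI_bound\<^sup>2 / 2" mgf_rate "l\<^sup>2"] unfolding mgf_rate_def by (simp add: mult.commute)
  finally show ?thesis .
qed

text \<open>Hoelder's inequality with exponents \<open>3/2\<close> and \<open>3\<close>: each half of the time interval carries the parameter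
  \<open>3/2 * 1/2 * l\<close>, and \<open>2 * 2/3 * (3/4)\<^sup>2 = 3/4 < 1\<close> leaves room for the cross term.\<close>

lemma mgf_le_step:
  assumes e: "\<epsilon> > 0" and l: "l \<ge> 0"
    and IH: "mgf (\<epsilon> / sqrt (1/2)) (3 / 4 * l) \<le> exp (mgf_rate * (3 / 4 * l)\<^sup>2)"
  shows "mgf \<epsilon> l \<le> exp (mgf_rate * l\<^sup>2)"
proof -
  let ?e = "\<epsilon> / sqrt (1/2)"
  have e': "?e > 0" using e by simp
  have half: "1 - 1 / 2 = (1 / 2 :: real)" and half_pos: "0 < (1 / 2 :: real)" "(1 / 2 :: real) < 1" by simp_all
  \<comment> \<open>l xi = 2/3 S + 1/3 T: the blocks are multiplied by 3/2 and the mutual part by 3,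
    to match the two Hoelder exponents.\<close>
  define S where "S = (\<lambda>\<omega>. 3 / 4 * l * (expectation (SI ?e) - SI_block 0 (1/2) ?e \<omega>)
    + 3 / 4 * l * (expectation (SI ?e) - SI_block (1/2) (1/2) ?e \<omega>))"
  define T where "T = (\<lambda>\<omega>. - (3 * l) * (cross (1/2) \<epsilon> \<omega> - expectation (cross (1/2) \<epsilon>)))"
  define p where "p = 9 / 8 * mgf_rate * l\<^sup>2"
  define q where "q = (3 * l)\<^sup>2 * 256 / 2"
  have intS: "integrable M (\<lambda>\<omega>. exp (S \<omega>))"
    unfolding S_def by (rule exp_blocks_integrable[OF half_pos e' e', unfolded half])
  have "expectation (\<lambda>\<omega>. exp (S \<omega>)) = mgf ?e (3 / 4 * l) * mgf ?e (3 / 4 * l)"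
    unfolding S_def by (rule mgf_blocks[OF half_pos e' e', unfolded half])
  also have "\<dots> \<le> exp (mgf_rate * (3 / 4 * l)\<^sup>2) * exp (mgf_rate * (3 / 4 * l)\<^sup>2)"
    using IH by (intro mult_mono) (auto simp: mgf_def intro!: integral_nonneg_AE)
  also have "\<dots> = exp p" unfolding p_def by (simp add: exp_add[symmetric] power_mult_distrib power_divide)
  finally have ES: "expectation (\<lambda>\<omega>. exp (S \<omega>)) \<le> exp p" .
  have cb: "0 \<le> cross (1/2) \<epsilon> \<omega> \<and> cross (1/2) \<epsilon> \<omega> \<le> SI_bound / \<epsilon>\<^sup>2" if "\<omega> \<in> space M" for \<omega>
    using cross_bounds[of "1/2" \<epsilon> \<omega>] e that by simp
  have cm [measurable]: "cross (1/2) \<epsilon> \<in> borel_measurable M" using e by measurable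
  have intT: "integrable M (\<lambda>\<omega>. exp (T \<omega>))"
  proof (rule integrable_const_bound)
    show "AE \<omega> in M. norm (exp (T \<omega>)) \<le> exp (3 * l * expectation (cross (1/2) \<epsilon>))"
      using cb l by (intro AE_I2) (auto simp: T_def algebra_simps)
  qed (simp add: T_def)
  have "ennreal (expectation (\<lambda>\<omega>. (cross (1/2) \<epsilon> \<omega>)\<^sup>2)) = (\<integral>\<^sup>+\<omega>. ennreal ((cross (1/2) \<epsilon> \<omega>)\<^sup>2) \<partial>M)"
    using cb by (intro nn_integral_eq_integral[symmetric] integrable_const_bound[where B = "(SI_bound / \<epsilon>\<^sup>2)\<^sup>2"] AE_I2)
      (auto simp: power_mono)
  also have "\<dots> \<le> ennreal 256"
    unfolding cross_def by (rule nn_integral_cross_int_square_le[OF kernel_moll[OF phi e]])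
  finally have c2: "expectation (\<lambda>\<omega>. (cross (1/2) \<epsilon> \<omega>)\<^sup>2) \<le> 256" by (subst (asm) ennreal_le_iff) auto
  have ET: "expectation (\<lambda>\<omega>. exp (T \<omega>)) \<le> exp q"
    unfolding T_def q_def by (rule exp_lower_deviation[OF cm cb c2]) (use l in auto)
  \<comment> \<open>Subtracting the logarithmic bounds p and q first gives both exponentials mean at
    most one, so that the pointwise convexity inequality loses nothing against Hoelder's
    inequality.\<close>
  have "mgf \<epsilon> l \<le> expectation (\<lambda>\<omega>. exp (2 / 3 * p + 1 / 3 * q) * (2 / 3 * (exp (- p) * exp (S \<omega>)) + 1 / 3 * (exp (- q) * exp (T \<omega>))))"
    unfolding mgf_def
  proof (rule integral_mono)
    fix \<omega> assume \<omega>: "\<omega> \<in> space M"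
    have "l * xi \<epsilon> \<omega> = 2 / 3 * S \<omega> + 1 / 3 * T \<omega>"
      unfolding S_def T_def xi_split[OF half_pos e \<omega>, unfolded half] by (simp add: algebra_simps)
    also have "\<dots> = (2 / 3 * p + 1 / 3 * q) + (2 / 3 * (- p + S \<omega>) + 1 / 3 * (- q + T \<omega>))" by (simp add: field_simps)
    finally have "exp (l * xi \<epsilon> \<omega>) = exp (2 / 3 * p + 1 / 3 * q) * exp (2 / 3 * (- p + S \<omega>) + 1 / 3 * (- q + T \<omega>))"
      by (simp only: exp_add)
    also have "\<dots> \<le> exp (2 / 3 * p + 1 / 3 * q) * (2 / 3 * exp (- p + S \<omega>) + 1 / 3 * exp (- q + T \<omega>))"
      by (intro mult_left_mono exp_convex_thirds) simp
    finally show "exp (l * xi \<epsilon> \<omega>) \<le> exp (2 / 3 * p + 1 / 3 * q) * (2 / 3 * (exp (- p) * exp (S \<omega>)) + 1 / 3 * (exp (- q) * exp (T \<omega>)))"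
      by (simp only: exp_add)
  qed (use intS intT e in \<open>auto intro!: exp_xi_integrable\<close>)
  also have "\<dots> = exp (2 / 3 * p + 1 / 3 * q) * (2 / 3 * (exp (- p) * expectation (\<lambda>\<omega>. exp (S \<omega>))) + 1 / 3 * (exp (- q) * expectation (\<lambda>\<omega>. exp (T \<omega>))))"
    using intS intT by simp
  also have "\<dots> \<le> exp (2 / 3 * p + 1 / 3 * q) * (2 / 3 * (exp (- p) * exp p) + 1 / 3 * (exp (- q) * exp q))"
    by (intro mult_left_mono add_mono ES ET) auto
  also have "\<dots> = exp (2 / 3 * p + 1 / 3 * q)" by (simp add: exp_minus)
  also have "\<dots> \<le> exp (mgf_rate * l\<^sup>2)"
  proof -
    have "1536 * l\<^sup>2 \<le> mgf_rate * l\<^sup>2" unfolding mgf_rate_def by (intro mult_right_mono) auto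
    thus ?thesis unfolding p_def q_def by (simp add: power_mult_distrib)
  qed
  finally show ?thesis .
qed

text \<open>Each halving multiplies the mollification by sqrt 2 and l by 3/4; after finitely many
  steps the mollification is at least 1. The constant is the same at every step, so the bound is
  uniform in \<epsilon>.\<close>

lemma mgf_le:
  assumes e: "\<epsilon> > 0" and l: "l \<ge> 0"
  shows "mgf \<epsilon> l \<le> exp (mgf_rate * l\<^sup>2)"
proof -
  have *: "mgf \<epsilon> l \<le> exp (mgf_rate * l\<^sup>2)" if "\<epsilon> * sqrt 2 ^ n \<ge> 1" "\<epsilon> > 0" "l \<ge> 0" for n \<epsilon> l
    using that
  proof (induction n arbitrary: \<epsilon> l)
    case 0
    thus ?case by (intro mgf_le_base) auto
  next
    case (Suc n)
    have eq: "\<epsilon> / sqrt (1/2) = \<epsilon> * sqrt 2" by (simp add: real_sqrt_divide)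
    have "mgf (\<epsilon> / sqrt (1/2)) (3 / 4 * l) \<le> exp (mgf_rate * (3 / 4 * l)\<^sup>2)"
      unfolding eq
    proof (rule Suc.IH)
      show "1 \<le> \<epsilon> * sqrt 2 * sqrt 2 ^ n" using Suc.prems(1) by (simp add: mult.assoc)
      show "0 < \<epsilon> * sqrt 2" "0 \<le> 3 / 4 * l" using Suc.prems by auto
    qed
    thus ?case by (rule mgf_le_step[OF Suc.prems(2,3)])
  qed
  obtain n where "1 / \<epsilon> < sqrt 2 ^ n" using real_arch_pow[of "sqrt 2" "1 / \<epsilon>"] by auto
  hence "1 \<le> \<epsilon> * sqrt 2 ^ n" using e by (simp add: divide_less_eq mult.commute)
  thus ?thesis by (rule *[OF _ e l])
qed

end

section \<open>Lower bound by a drift\<close>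

lemma integrable_triangle_inverse_sqrt:
  "integrable lborel (\<lambda>p. indicator triangle p * (1 / sqrt (fst p - snd p)))"
proof (rule integrableI_nonneg)
  have "(\<integral>\<^sup>+p. ennreal (indicator triangle p * (1 / sqrt (fst p - snd p))) \<partial>lborel)
      \<le> (\<integral>\<^sup>+p. ennreal (1 / sqrt \<bar>snd p - fst p\<bar>) * indicator {0..1} (snd p) * indicator {0..1} (fst p) \<partial>lborel)"
    by (intro nn_integral_mono) (auto simp: indicator_def triangle_def)
  also have "\<dots> = (\<integral>\<^sup>+v. (\<integral>\<^sup>+u. ennreal (1 / sqrt \<bar>u - v\<bar>) * indicator {0..1} u * indicator {0..1} v \<partial>lborel) \<partial>lborel)"
    by (subst nn_integral_lborel_pair) auto
  also have "\<dots> \<le> (\<integral>\<^sup>+v. ennreal 4 * indicator {0..1::real} v \<partial>lborel)"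
  proof (rule nn_integral_mono)
    fix v :: real
    show "(\<integral>\<^sup>+u. ennreal (1 / sqrt \<bar>u - v\<bar>) * indicator {0..1} u * indicator {0..1} v \<partial>lborel) \<le> ennreal 4 * indicator {0..1} v"
      using nn_integral_inverse_sqrt[of 0 v 1] by (cases "v \<in> {0..1}") auto
  qed
  also have "\<dots> < \<infinity>" by (simp add: nn_integral_cmult)
  finally show "(\<integral>\<^sup>+p. ennreal (indicator triangle p * (1 / sqrt (fst p - snd p))) \<partial>lborel) < \<infinity>" .
qed (auto simp: indicator_def triangle_def)

text \<open>Exponent gained by the drift \<open>\<mu>\<close>: the limit of the decrease of the expected self-intersections,
  bounded below through \<open>1 - exp (- x) \<ge> x / (1 + x)\<close>.\<close>

lemma integral_triangle_drift_ge:
  assumes l: "l > 0"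
  shows "(ln l - ln 2 - 1) / (2 * pi) \<le>
    (\<integral>p. indicator triangle p * ((1 - exp (- l * (fst p - snd p) / 2)) / (2 * pi * (fst p - snd p))) \<partial>lborel)"
    (is "_ \<le> ?I")
proof -
  define F where "F = (\<lambda>p. indicator triangle p * ((1 - exp (- l * (fst p - snd p) / 2)) / (2 * pi * (fst p - snd p))))"
  have [measurable]: "F \<in> borel_measurable borel" unfolding F_def by measurable
  have F0: "0 \<le> F p" for p
    using l unfolding F_def by (auto simp: indicator_def triangle_def)
  \<comment> \<open>1 - exp (- x) \<le> x cancels the singularity on the diagonal.\<close>
  have Fle: "F p \<le> indicator triangle p * l" for p
  proof (cases "p \<in> triangle \<and> fst p \<noteq> snd p")
    case True
    hence r: "fst p - snd p > 0" by (auto simp: triangle_def)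
    have "1 - exp (- l * (fst p - snd p) / 2) \<le> l * (fst p - snd p) / 2"
      using exp_ge_add_one_self[of "- l * (fst p - snd p) / 2"] by simp
    also have "\<dots> \<le> l * (fst p - snd p) * (2 * pi)"
      using r l pi_ge_two by (simp add: divide_le_eq)
    finally have "(1 - exp (- l * (fst p - snd p) / 2)) / (2 * pi * (fst p - snd p)) \<le> l"
      using r by (simp add: divide_le_eq mult_ac)
    thus ?thesis using True by (simp add: F_def)
  next
    case False
    thus ?thesis using l by (auto simp: F_def)
  qed
  have intF: "integrable lborel F"
  proof (rule Bochner_Integration.integrable_bound)
    show "integrable lborel (\<lambda>p. indicator triangle p * l)" using emeasure_triangle by simp
    show "AE p in lborel. norm (F p) \<le> norm (indicator triangle p * l)"
      using F0 Fle l by (intro AE_I2) (auto simp: abs_of_nonneg)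
  qed simp
  \<comment> \<open>With x = l r / 2 the quotient x / (1 + x) / r equals 1 / (r + 2 / l).\<close>
  define \<delta> where "\<delta> = 2 / l"
  have \<delta>: "\<delta> > 0" unfolding \<delta>_def using l by simp
  have "ennreal ((ln l - ln 2 - 1) / (2 * pi)) = ennreal (1 / (2 * pi)) * ennreal (- ln \<delta> - 1)"
    unfolding \<delta>_def using l by (subst ennreal_mult'[symmetric]) (auto simp: ln_div)
  also have "\<dots> \<le> ennreal (1 / (2 * pi)) * (\<integral>\<^sup>+v. (\<integral>\<^sup>+u. ennreal (1 / (v - u + \<delta>)) * indicator {0..v} u \<partial>lborel) * indicator {0..1} v \<partial>lborel)"
    by (intro mult_left_mono nn_integral_triangle_shifted_inverse \<delta>) simp
  also have "(\<integral>\<^sup>+v. (\<integral>\<^sup>+u. ennreal (1 / (v - u + \<delta>)) * indicator {0..v} u \<partial>lborel) * indicator {0..1} v \<partial>lborel)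
      = (\<integral>\<^sup>+v. (\<integral>\<^sup>+u. indicator triangle (v, u) * ennreal (1 / (v - u + \<delta>)) \<partial>lborel) \<partial>lborel)"
    using AE_lborel_singleton[of 1]
  proof (intro nn_integral_cong_AE, eventually_elim)
    fix v :: real assume v: "v \<noteq> 1"
    show "(\<integral>\<^sup>+u. ennreal (1 / (v - u + \<delta>)) * indicator {0..v} u \<partial>lborel) * indicator {0..1} v
      = (\<integral>\<^sup>+u. indicator triangle (v, u) * ennreal (1 / (v - u + \<delta>)) \<partial>lborel)"
    proof (cases "v \<in> {0..1}")
      case True
      hence "indicator triangle (v, u) = (indicator {0..v} u :: ennreal)" for u
        using v by (auto simp: triangle_def indicator_def)
      thus ?thesis using True by (simp add: mult.commute)
    next
      case False
      hence "indicator triangle (v, u) = (0 :: ennreal)" for u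
        by (auto simp: triangle_def indicator_def)
      thus ?thesis using False by simp
    qed
  qed
  also have "\<dots> = (\<integral>\<^sup>+p. indicator triangle p * ennreal (1 / (fst p - snd p + \<delta>)) \<partial>lborel)"
    by (subst nn_integral_lborel_pair) auto
  also have "ennreal (1 / (2 * pi)) * \<dots> = (\<integral>\<^sup>+p. ennreal (1 / (2 * pi)) * (indicator triangle p * ennreal (1 / (fst p - snd p + \<delta>))) \<partial>lborel)"
    by (rule nn_integral_cmult[symmetric]) measurable
  also have "\<dots> \<le> (\<integral>\<^sup>+p. ennreal (F p) \<partial>lborel)"
    using AE_off_diagonal
  proof (intro nn_integral_mono_AE, eventually_elim)
    fix p :: "real \<times> real" assume ne: "fst p \<noteq> snd p"
    show "ennreal (1 / (2 * pi)) * (indicator triangle p * ennreal (1 / (fst p - snd p + \<delta>))) \<le> ennreal (F p)"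
    proof (cases "p \<in> triangle")
      case True
      define r where "r = fst p - snd p"
      have r: "r > 0" unfolding r_def using True ne by (auto simp: triangle_def)
      define x where "x = l * r / 2"
      have x: "x > 0" unfolding x_def using l r by simp
      have "exp (- x) \<le> 1 / (1 + x)" using exp_ge_add_one_self[of x] x by (simp add: exp_minus inverse_eq_divide frac_le)
      hence "x / (1 + x) \<le> 1 - exp (- x)" using x by (simp add: field_simps)
      hence "x / (1 + x) / r \<le> (1 - exp (- x)) / r" using r by (intro divide_right_mono) auto
      moreover have "x / (1 + x) / r = 1 / (r + \<delta>)"
      proof -
        have "x * (r + \<delta>) = (1 + x) * r" unfolding x_def \<delta>_def using l by (simp add: field_simps)
        thus ?thesis using x r \<delta> by (simp add: frac_eq_eq)
      qed
      ultimately have "1 / (r + \<delta>) \<le> (1 - exp (- x)) / r" by simp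
      hence "1 / (2 * pi) * (1 / (r + \<delta>)) \<le> 1 / (2 * pi) * ((1 - exp (- x)) / r)" by (intro mult_left_mono) auto
      moreover have "F p = 1 / (2 * pi) * ((1 - exp (- x)) / r)"
        using True unfolding F_def x_def r_def by simp
      ultimately have "ennreal (1 / (2 * pi) * (1 / (r + \<delta>))) \<le> ennreal (F p)" by (simp only: ennreal_leI)
      thus ?thesis using True r \<delta> by (simp add: ennreal_mult[symmetric] r_def)
    qed simp
  qed
  also have "\<dots> = ennreal ?I"
    unfolding F_def[symmetric] using intF F0 by (intro nn_integral_eq_integral) auto
  finally have *: "ennreal ((ln l - ln 2 - 1) / (2 * pi)) \<le> ennreal ?I" .
  \<comment> \<open>\<open>ennreal\<close> sends negative numbers to 0; the comparison can be read
    back in the reals because the larger side is nonnegative.\<close>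
  have "0 \<le> ?I" unfolding F_def[symmetric] using F0 by (intro integral_nonneg_AE) auto
  thus ?thesis using * by (simp only: ennreal_le_iff)
qed

section \<open>Mean self-intersections under the drift\<close>

context cbm_kernel
begin

text \<open>Girsanov density on [0, 1] of Brownian motion with drift \<mu>; the increment from time
  0 appears because the starting point is free.\<close>

definition tilt :: "real^2 \<Rightarrow> 'a \<Rightarrow> real" where
  "tilt \<mu> \<omega> = exp (\<mu> \<bullet> (X 1 \<omega> - X 0 \<omega>) - (norm \<mu>)\<^sup>2 / 2)"

text \<open>Density near 0 of the increment between the two times of p under the drift \<mu>,
  averaged over the mollifier. The substitution x = \<epsilon> z puts \<epsilon> into the argument
  of \<open>gauss2\<close>, where it can tend to 0.\<close>

definition tilted_density :: "real^2 \<Rightarrow> real \<Rightarrow> real \<times> real \<Rightarrow> real" where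
  "tilted_density \<mu> \<epsilon> p = (\<integral>z. \<phi> z * gauss2 (fst p - snd p) (\<epsilon> *\<^sub>R z - (fst p - snd p) *\<^sub>R \<mu>) \<partial>lborel)"

lemma phi_measurable [measurable]: "\<phi> \<in> borel_measurable borel"
  by (rule kernelD(6)[OF phi])

lemma phi_integrable: "integrable lborel \<phi>" and phi_integral: "(\<integral>z. \<phi> z \<partial>lborel) = 1"
proof -
  have "(\<integral>\<^sup>+z. ennreal (\<phi> z) \<partial>lborel) = ennreal 1" using kernelD(5)[OF phi] by simp
  hence "integrable lborel \<phi> \<and> (\<integral>z. \<phi> z \<partial>lborel) = 1"
    using kernelD(2)[OF phi] by (subst (asm) nn_integral_eq_integrable) auto
  thus "integrable lborel \<phi>" "(\<integral>z. \<phi> z \<partial>lborel) = 1" by auto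
qed

lemma tilt_measurable [measurable]: "tilt \<mu> \<in> borel_measurable M"
  unfolding tilt_def by measurable

lemma tilt_integrable: "integrable M (tilt \<mu>)" and tilt_integral: "expectation (tilt \<mu>) = 1"
proof -
  have "(\<integral>\<^sup>+\<omega>. ennreal (tilt \<mu> \<omega>) \<partial>M) = ennreal 1"
    unfolding tilt_def using nn_integral_exp_increment[of 0 1 \<mu>] by simp
  hence "integrable M (tilt \<mu>) \<and> expectation (tilt \<mu>) = 1"
    by (subst (asm) nn_integral_eq_integrable) (auto simp: tilt_def)
  thus "integrable M (tilt \<mu>)" "expectation (tilt \<mu>) = 1" by auto
qed

lemma tilt_square: "(tilt \<mu> \<omega>)\<^sup>2 = exp ((norm \<mu>)\<^sup>2) * tilt (2 *\<^sub>R \<mu>) \<omega>"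
  unfolding tilt_def by (simp add: power2_eq_square exp_add[symmetric])

text \<open>Jensen's inequality for the tilted law. Its relative entropy is \<open>(norm \<mu>)\<^sup>2 / 2\<close>; the cruder bound by the
  logarithm of the second moment of the density makes the argument pointwise.\<close>

lemma mgf_ge_tilt:
  assumes e: "\<epsilon> > 0"
  shows "exp (l * expectation (\<lambda>\<omega>. tilt \<mu> \<omega> * xi \<epsilon> \<omega>) - (norm \<mu>)\<^sup>2) \<le> mgf \<epsilon> l"
proof -
  define k where "k = (norm \<mu>)\<^sup>2"
  define c where "c = l * expectation (\<lambda>\<omega>. tilt \<mu> \<omega> * xi \<epsilon> \<omega>) - k"
  have int1: "integrable M (\<lambda>\<omega>. tilt \<mu> \<omega> * xi \<epsilon> \<omega>)"
  proof (rule Bochner_Integration.integrable_bound)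
    show "integrable M (\<lambda>\<omega>. tilt \<mu> \<omega> * (2 * (SI_bound / \<epsilon>\<^sup>2)))" using tilt_integrable by simp
    show "AE \<omega> in M. norm (tilt \<mu> \<omega> * xi \<epsilon> \<omega>) \<le> norm (tilt \<mu> \<omega> * (2 * (SI_bound / \<epsilon>\<^sup>2)))"
      unfolding real_norm_def abs_mult using xi_bound[OF e] SI_bound_nonneg by (intro AE_I2 mult_left_mono) auto
  qed (use e in measurable)
  \<comment> \<open>Two tangents: of exp at c + ln D, and of ln at exp k, which is the second moment
    of D. The value of c makes the bracket have mean one.\<close>
  have pw: "exp c * (l * (tilt \<mu> \<omega> * xi \<epsilon> \<omega>) + (2 - c - k) * tilt \<mu> \<omega> - tilt (2 *\<^sub>R \<mu>) \<omega>) \<le> exp (l * xi \<epsilon> \<omega>)" for \<omega>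
  proof -
    define D where "D = tilt \<mu> \<omega>"
    define a where "a = l * xi \<epsilon> \<omega>"
    have D: "D > 0" unfolding D_def tilt_def by simp
    have "ln (D * exp (- k)) \<le> D * exp (- k) - 1" using D by (intro ln_le_minus_one) auto
    hence lnD: "ln D - k \<le> D * exp (- k) - 1" using D by (simp add: ln_mult)
    have "1 + a - c - k + 1 - D * exp (- k) \<le> 1 + (a - c - ln D)" using lnD by simp
    also have "\<dots> \<le> exp (a - c - ln D)" by (rule exp_ge_add_one_self)
    finally have "D * exp c * (1 + a - c - k + 1 - D * exp (- k)) \<le> D * exp c * exp (a - c - ln D)"
      using D by (intro mult_left_mono) auto
    also have "\<dots> = exp a" using D by (simp add: exp_diff)
    finally have "exp c * (D * a + (2 - c - k) * D - D\<^sup>2 * exp (- k)) \<le> exp a"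
      by (simp add: algebra_simps power2_eq_square)
    moreover have "D\<^sup>2 * exp (- k) = tilt (2 *\<^sub>R \<mu>) \<omega>"
      unfolding D_def tilt_square k_def by (simp add: exp_minus)
    ultimately show ?thesis unfolding D_def a_def by (simp add: mult_ac)
  qed
  have "expectation (\<lambda>\<omega>. exp c * (l * (tilt \<mu> \<omega> * xi \<epsilon> \<omega>) + (2 - c - k) * tilt \<mu> \<omega> - tilt (2 *\<^sub>R \<mu>) \<omega>)) \<le> mgf \<epsilon> l"
    unfolding mgf_def using pw int1 tilt_integrable exp_xi_integrable[OF e]
    by (intro integral_mono) auto
  moreover have "expectation (\<lambda>\<omega>. exp c * (l * (tilt \<mu> \<omega> * xi \<epsilon> \<omega>) + (2 - c - k) * tilt \<mu> \<omega> - tilt (2 *\<^sub>R \<mu>) \<omega>))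
      = exp c * (l * expectation (\<lambda>\<omega>. tilt \<mu> \<omega> * xi \<epsilon> \<omega>) + (2 - c - k) - 1)"
    using int1 tilt_integrable by (simp add: tilt_integral)
  moreover have "l * expectation (\<lambda>\<omega>. tilt \<mu> \<omega> * xi \<epsilon> \<omega>) + (2 - c - k) - 1 = 1" unfolding c_def by simp
  ultimately show ?thesis unfolding c_def k_def by simp
qed

lemma tilted_density_integrable:
  assumes "snd p \<le> fst p"
  shows "integrable lborel (\<lambda>z. \<phi> z * gauss2 (fst p - snd p) (\<epsilon> *\<^sub>R z - (fst p - snd p) *\<^sub>R \<mu>))"
proof (cases "snd p = fst p")
  case True
  \<comment> \<open>On the diagonal \<open>gauss2 0\<close> vanishes by division by zero.\<close>
  thus ?thesis by (simp add: gauss2_def)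
next
  case False
  hence r: "fst p - snd p > 0" using assms by simp
  show ?thesis
  proof (rule Bochner_Integration.integrable_bound)
    show "integrable lborel (\<lambda>z. \<phi> z * (1 / (2 * pi * (fst p - snd p))))" using phi_integrable by simp
    show "AE z in lborel. norm (\<phi> z * gauss2 (fst p - snd p) (\<epsilon> *\<^sub>R z - (fst p - snd p) *\<^sub>R \<mu>)) \<le> norm (\<phi> z * (1 / (2 * pi * (fst p - snd p))))"
      unfolding real_norm_def abs_mult using r gauss2_le[OF r] gauss2_nonneg[OF r]
      by (intro AE_I2 mult_left_mono) auto
  qed measurable
qed

lemma tilted_density_nonneg: "snd p \<le> fst p \<Longrightarrow> 0 \<le> tilted_density \<mu> \<epsilon> p"
  unfolding tilted_density_def using kernelD(2)[OF phi]
  by (intro integral_nonneg_AE AE_I2 mult_nonneg_nonneg) (auto simp: gauss2_def)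

lemma tilted_density_measurable [measurable]: "tilted_density \<mu> \<epsilon> \<in> borel_measurable borel"
  unfolding tilted_density_def by (intro lborel.borel_measurable_lebesgue_integral) measurable

lemma tilt_SI_integrable:
  assumes e: "\<epsilon> > 0"
  shows "integrable M (\<lambda>\<omega>. tilt \<mu> \<omega> * SI \<epsilon> \<omega>)"
proof (rule Bochner_Integration.integrable_bound)
  show "integrable M (\<lambda>\<omega>. tilt \<mu> \<omega> * (SI_bound / \<epsilon>\<^sup>2))" using tilt_integrable by simp
  show "AE \<omega> in M. norm (tilt \<mu> \<omega> * SI \<epsilon> \<omega>) \<le> norm (tilt \<mu> \<omega> * (SI_bound / \<epsilon>\<^sup>2))"
    unfolding real_norm_def abs_mult using SI_bounds[OF e] SI_bound_nonneg by (intro AE_I2 mult_left_mono) auto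
qed (use e in measurable)

lemma tilted_density_integral:
  assumes e: "\<epsilon> > 0"
  shows "integrable lborel (\<lambda>p. indicator triangle p * tilted_density \<mu> \<epsilon> p)"
    and "(\<integral>p. indicator triangle p * tilted_density \<mu> \<epsilon> p \<partial>lborel) = expectation (\<lambda>\<omega>. tilt \<mu> \<omega> * SI \<epsilon> \<omega>)"
proof -
  have int: "integrable M (\<lambda>\<omega>. SI \<epsilon> \<omega> * tilt \<mu> \<omega>)"
    using tilt_SI_integrable[OF e] by (simp add: mult.commute)
  have nn: "0 \<le> SI \<epsilon> \<omega> * tilt \<mu> \<omega>" if "\<omega> \<in> space M" for \<omega>
    using SI_bounds[OF e that] by (simp add: tilt_def)
  have "(\<integral>\<^sup>+p. ennreal (indicator triangle p * tilted_density \<mu> \<epsilon> p) \<partial>lborel) =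
    (\<integral>\<^sup>+p. indicator triangle p * (\<integral>\<^sup>+x. ennreal (moll \<phi> \<epsilon> x * gauss2 (fst p - snd p) (x - (fst p - snd p) *\<^sub>R \<mu>)) \<partial>lborel) \<partial>lborel)"
  proof (rule nn_integral_cong)
    fix p :: "real \<times> real"
    show "ennreal (indicator triangle p * tilted_density \<mu> \<epsilon> p) =
      indicator triangle p * (\<integral>\<^sup>+x. ennreal (moll \<phi> \<epsilon> x * gauss2 (fst p - snd p) (x - (fst p - snd p) *\<^sub>R \<mu>)) \<partial>lborel)"
    proof (cases "p \<in> triangle")
      case True
      hence p: "snd p \<le> fst p" by (auto simp: triangle_def)
      have "(\<integral>\<^sup>+x. ennreal (moll \<phi> \<epsilon> x * gauss2 (fst p - snd p) (x - (fst p - snd p) *\<^sub>R \<mu>)) \<partial>lborel)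
        = (\<integral>\<^sup>+z. ennreal (\<phi> z * gauss2 (fst p - snd p) (\<epsilon> *\<^sub>R z - (fst p - snd p) *\<^sub>R \<mu>)) \<partial>lborel)"
        using e kernelD(6)[OF kernel_moll[OF phi e]]
        by (subst nn_integral_scale[OF _ e]) (auto simp: moll_def ennreal_mult'[symmetric])
      also have "\<dots> = ennreal (tilted_density \<mu> \<epsilon> p)"
        unfolding tilted_density_def using p kernelD(2)[OF phi]
        by (intro nn_integral_eq_integral tilted_density_integrable AE_I2 mult_nonneg_nonneg) (auto simp: gauss2_def)
      finally show ?thesis using True by simp
    qed simp
  qed
  also have "\<dots> = (\<integral>\<^sup>+\<omega>. ennreal (SI \<epsilon> \<omega> * tilt \<mu> \<omega>) \<partial>M)"
    unfolding SI_def tilt_def by (rule nn_integral_tilted_self_int[OF kernel_moll[OF phi e], symmetric])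
  also have "\<dots> = ennreal (expectation (\<lambda>\<omega>. SI \<epsilon> \<omega> * tilt \<mu> \<omega>))"
    using int nn by (intro nn_integral_eq_integral) auto
  finally have "integrable lborel (\<lambda>p. indicator triangle p * tilted_density \<mu> \<epsilon> p) \<and>
      (\<integral>p. indicator triangle p * tilted_density \<mu> \<epsilon> p \<partial>lborel) = expectation (\<lambda>\<omega>. SI \<epsilon> \<omega> * tilt \<mu> \<omega>)"
    using nn tilted_density_nonneg
    by (subst (asm) nn_integral_eq_integrable) (auto simp: indicator_def triangle_def intro!: integral_nonneg_AE)
  thus "integrable lborel (\<lambda>p. indicator triangle p * tilted_density \<mu> \<epsilon> p)"
    "(\<integral>p. indicator triangle p * tilted_density \<mu> \<epsilon> p \<partial>lborel) = expectation (\<lambda>\<omega>. tilt \<mu> \<omega> * SI \<epsilon> \<omega>)"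
    by (auto simp: mult.commute)
qed

text \<open>Both means diverge logarithmically as \<epsilon> tends to 0. Written as one integral
  over the triangle, their difference has an integrand in which the 1 / r singularities cancel
  before the limit is taken.\<close>

lemma expectation_tilt_xi:
  assumes e: "\<epsilon> > 0"
  shows "expectation (\<lambda>\<omega>. tilt \<mu> \<omega> * xi \<epsilon> \<omega>) =
    (\<integral>p. indicator triangle p * (tilted_density 0 \<epsilon> p - tilted_density \<mu> \<epsilon> p) \<partial>lborel)"
proof -
  note int = tilt_SI_integrable[OF e, of \<mu>]
  have "expectation (\<lambda>\<omega>. tilt \<mu> \<omega> * xi \<epsilon> \<omega>) = expectation (\<lambda>\<omega>. expectation (SI \<epsilon>) * tilt \<mu> \<omega> - tilt \<mu> \<omega> * SI \<epsilon> \<omega>)"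
    unfolding xi_def by (simp add: right_diff_distrib mult.commute)
  also have "\<dots> = expectation (SI \<epsilon>) - expectation (\<lambda>\<omega>. tilt \<mu> \<omega> * SI \<epsilon> \<omega>)"
    using int tilt_integrable by (simp add: tilt_integral)
  also have "expectation (SI \<epsilon>) = expectation (\<lambda>\<omega>. tilt 0 \<omega> * SI \<epsilon> \<omega>)" by (simp add: tilt_def)
  finally show ?thesis
    unfolding tilted_density_integral(2)[OF e, symmetric] right_diff_distrib
    using tilted_density_integral(1)[OF e] by simp
qed

lemma tilted_density_limit:
  assumes e: "e \<longlonglongrightarrow> 0" and r: "snd p < fst p"
  shows "(\<lambda>n. tilted_density \<mu> (e n) p) \<longlonglongrightarrow> gauss2 (fst p - snd p) (- ((fst p - snd p) *\<^sub>R \<mu>))"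
proof -
  let ?r = "fst p - snd p"
  have r0: "?r > 0" using r by simp
  have "(\<lambda>n. tilted_density \<mu> (e n) p) \<longlonglongrightarrow> (\<integral>z. \<phi> z * gauss2 ?r (- (?r *\<^sub>R \<mu>)) \<partial>lborel)"
    unfolding tilted_density_def
  proof (rule integral_dominated_convergence[where w = "\<lambda>z. \<phi> z * (1 / (2 * pi * ?r))"])
    show "integrable lborel (\<lambda>z. \<phi> z * (1 / (2 * pi * ?r)))" using phi_integrable by simp
    show "AE z in lborel. (\<lambda>n. \<phi> z * gauss2 ?r (e n *\<^sub>R z - ?r *\<^sub>R \<mu>)) \<longlonglongrightarrow> \<phi> z * gauss2 ?r (- (?r *\<^sub>R \<mu>))"
    proof (rule AE_I2)
      fix z :: "real^2"
      have "(\<lambda>n. e n *\<^sub>R z - ?r *\<^sub>R \<mu>) \<longlonglongrightarrow> 0 *\<^sub>R z - ?r *\<^sub>R \<mu>" by (intro tendsto_intros e)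
      hence "(\<lambda>n. gauss2 ?r (e n *\<^sub>R z - ?r *\<^sub>R \<mu>)) \<longlonglongrightarrow> gauss2 ?r (- (?r *\<^sub>R \<mu>))"
        using continuous_on_gauss2[of UNIV ?r]
        by (intro isCont_tendsto_compose[of _ "gauss2 ?r"]) (auto simp: continuous_on_eq_continuous_at)
      thus "(\<lambda>n. \<phi> z * gauss2 ?r (e n *\<^sub>R z - ?r *\<^sub>R \<mu>)) \<longlonglongrightarrow> \<phi> z * gauss2 ?r (- (?r *\<^sub>R \<mu>))"
        by (intro tendsto_intros)
    qed
    show "AE z in lborel. norm (\<phi> z * gauss2 ?r (e n *\<^sub>R z - ?r *\<^sub>R \<mu>)) \<le> \<phi> z * (1 / (2 * pi * ?r))" for n
      unfolding real_norm_def abs_mult abs_of_nonneg[OF kernelD(2)[OF phi]]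
      using r0 gauss2_le[OF r0] gauss2_nonneg[OF r0] kernelD(2)[OF phi]
      by (intro AE_I2 mult_left_mono) auto
  qed measurable
  thus ?thesis by (simp add: phi_integral)
qed

lemma tilted_density_diff_bound:
  assumes "snd p \<le> fst p"
  shows "\<bar>tilted_density 0 \<epsilon> p - tilted_density \<mu> \<epsilon> p\<bar> \<le> norm \<mu> * (1 / sqrt (fst p - snd p))"
proof (cases "snd p = fst p")
  case True
  thus ?thesis by (simp add: tilted_density_def gauss2_def)
next
  case False
  let ?r = "fst p - snd p"
  have r: "?r > 0" using False assms by simp
  have "tilted_density 0 \<epsilon> p - tilted_density \<mu> \<epsilon> p =
    (\<integral>z. \<phi> z * gauss2 ?r (\<epsilon> *\<^sub>R z - ?r *\<^sub>R 0) - \<phi> z * gauss2 ?r (\<epsilon> *\<^sub>R z - ?r *\<^sub>R \<mu>) \<partial>lborel)"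
    unfolding tilted_density_def
    by (rule Bochner_Integration.integral_diff[symmetric]) (intro tilted_density_integrable assms)+
  also have "\<bar>\<dots>\<bar> \<le> (\<integral>z. \<phi> z * (norm \<mu> / sqrt ?r) \<partial>lborel)"
    unfolding real_norm_def[symmetric]
  proof (rule Bochner_Integration.integral_norm_bound_integral)
    show "integrable lborel (\<lambda>z. \<phi> z * gauss2 ?r (\<epsilon> *\<^sub>R z - ?r *\<^sub>R 0) - \<phi> z * gauss2 ?r (\<epsilon> *\<^sub>R z - ?r *\<^sub>R \<mu>))"
      by (intro Bochner_Integration.integrable_diff tilted_density_integrable assms)
    show "integrable lborel (\<lambda>z. \<phi> z * (norm \<mu> / sqrt ?r))" using phi_integrable by simp
    fix z
    have "norm (\<phi> z * (gauss2 ?r (\<epsilon> *\<^sub>R z) - gauss2 ?r (\<epsilon> *\<^sub>R z - ?r *\<^sub>R \<mu>))) \<le> \<phi> z * (norm \<mu> / sqrt ?r)"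
      unfolding real_norm_def abs_mult using kernelD(2)[OF phi] gauss2_shift_bound[OF r]
      by (simp add: mult_left_mono del: times_divide_eq_right)
    thus "norm (\<phi> z * gauss2 ?r (\<epsilon> *\<^sub>R z - ?r *\<^sub>R 0) - \<phi> z * gauss2 ?r (\<epsilon> *\<^sub>R z - ?r *\<^sub>R \<mu>)) \<le> \<phi> z * (norm \<mu> / sqrt ?r)"
      by (simp add: right_diff_distrib)
  qed
  also have "\<dots> = norm \<mu> * (1 / sqrt ?r)" by (simp add: phi_integral)
  finally show ?thesis .
qed

lemma expectation_tilt_xi_limit:
  assumes e: "\<And>n. e n > 0" "e \<longlonglongrightarrow> 0"
  shows "(\<lambda>n. expectation (\<lambda>\<omega>. tilt \<mu> \<omega> * xi (e n) \<omega>)) \<longlonglongrightarrow>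
    (\<integral>p. indicator triangle p * ((1 - exp (- (norm \<mu>)\<^sup>2 * (fst p - snd p) / 2)) / (2 * pi * (fst p - snd p))) \<partial>lborel)"
  unfolding expectation_tilt_xi[OF e(1)]
proof (rule integral_dominated_convergence[where w = "\<lambda>p. norm \<mu> * (indicator triangle p * (1 / sqrt (fst p - snd p)))"])
  show "integrable lborel (\<lambda>p. norm \<mu> * (indicator triangle p * (1 / sqrt (fst p - snd p))))"
    using integrable_triangle_inverse_sqrt by (rule integrable_mult_right)
  show "AE p in lborel. (\<lambda>n. indicator triangle p * (tilted_density 0 (e n) p - tilted_density \<mu> (e n) p))
     \<longlonglongrightarrow> indicator triangle p * ((1 - exp (- (norm \<mu>)\<^sup>2 * (fst p - snd p) / 2)) / (2 * pi * (fst p - snd p)))"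
    using AE_off_diagonal
  proof eventually_elim
    case (elim p)
    show ?case
    proof (cases "p \<in> triangle")
      case True
      hence r: "snd p < fst p" using elim by (auto simp: triangle_def)
      let ?r = "fst p - snd p"
      have "(\<lambda>n. tilted_density 0 (e n) p - tilted_density \<mu> (e n) p) \<longlonglongrightarrow> gauss2 ?r (- (?r *\<^sub>R 0)) - gauss2 ?r (- (?r *\<^sub>R \<mu>))"
        by (intro tendsto_diff tilted_density_limit e r)
      also have "gauss2 ?r (- (?r *\<^sub>R 0)) - gauss2 ?r (- (?r *\<^sub>R \<mu>)) = (1 - exp (- (norm \<mu>)\<^sup>2 * ?r / 2)) / (2 * pi * ?r)"
        using gauss2_drift[of ?r] r by (simp add: gauss2_def diff_divide_distrib)
      finally show ?thesis using True by simp
    qed simp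
  qed
  show "AE p in lborel. norm (indicator triangle p * (tilted_density 0 (e n) p - tilted_density \<mu> (e n) p))
      \<le> norm \<mu> * (indicator triangle p * (1 / sqrt (fst p - snd p)))" for n
    using tilted_density_diff_bound by (intro AE_I2) (auto simp: indicator_def triangle_def)
qed measurable

end

section \<open>Passage to the limit\<close>

text \<open>A form of Vitali's theorem: Fatou gives Z the same second moment bound, and truncation
  at level R changes each mean by at most C / R, uniformly in n.\<close>

lemma (in prob_space) expectation_limit_second_moment:
  fixes Y :: "nat \<Rightarrow> 'a \<Rightarrow> real"
  assumes [measurable]: "\<And>n. Y n \<in> borel_measurable M" "Z \<in> borel_measurable M"
    and nonneg: "\<And>n \<omega>. 0 \<le> Y n \<omega>"
    and int2: "\<And>n. integrable M (\<lambda>\<omega>. (Y n \<omega>)\<^sup>2)" and C: "\<And>n. expectation (\<lambda>\<omega>. (Y n \<omega>)\<^sup>2) \<le> C"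
    and lim: "AE \<omega> in M. (\<lambda>n. Y n \<omega>) \<longlonglongrightarrow> Z \<omega>"
  shows "integrable M Z" "(\<lambda>n. expectation (Y n)) \<longlonglongrightarrow> expectation Z"
proof -
  have C0: "0 \<le> C" using C[of 0] by (rule order_trans[rotated]) (auto intro!: integral_nonneg_AE)
  have Z0: "AE \<omega> in M. 0 \<le> Z \<omega>"
    using lim by eventually_elim (rule LIMSEQ_le_const, auto intro: nonneg)
  have "(\<integral>\<^sup>+\<omega>. ennreal ((Z \<omega>)\<^sup>2) \<partial>M) = (\<integral>\<^sup>+\<omega>. liminf (\<lambda>n. ennreal ((Y n \<omega>)\<^sup>2)) \<partial>M)"
  proof (rule nn_integral_cong_AE)
    show "AE \<omega> in M. ennreal ((Z \<omega>)\<^sup>2) = liminf (\<lambda>n. ennreal ((Y n \<omega>)\<^sup>2))"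
      using lim
    proof eventually_elim
      case (elim \<omega>)
      have "(\<lambda>n. ennreal ((Y n \<omega>)\<^sup>2)) \<longlonglongrightarrow> ennreal ((Z \<omega>)\<^sup>2)"
        by (intro tendsto_ennrealI tendsto_power elim)
      thus ?case using lim_imp_Liminf[OF sequentially_bot] by metis
    qed
  qed
  also have "\<dots> \<le> liminf (\<lambda>n. \<integral>\<^sup>+\<omega>. ennreal ((Y n \<omega>)\<^sup>2) \<partial>M)"
    by (rule nn_integral_liminf) measurable
  also have "\<dots> \<le> ennreal C"
  proof (rule Liminf_le)
    show "\<forall>\<^sub>F n in sequentially. (\<integral>\<^sup>+\<omega>. ennreal ((Y n \<omega>)\<^sup>2) \<partial>M) \<le> ennreal C"
      using C int2 by (intro always_eventually allI) (subst nn_integral_eq_integral, auto intro: ennreal_leI)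
  qed simp
  finally have nnZ: "(\<integral>\<^sup>+\<omega>. ennreal ((Z \<omega>)\<^sup>2) \<partial>M) \<le> ennreal C" .
  have intZ2: "integrable M (\<lambda>\<omega>. (Z \<omega>)\<^sup>2)"
    by (rule integrableI_nonneg) (use nnZ in \<open>auto intro: le_less_trans\<close>)
  have EZ2: "expectation (\<lambda>\<omega>. (Z \<omega>)\<^sup>2) \<le> C"
    using nnZ C0 by (subst (asm) nn_integral_eq_integral[OF intZ2]) (auto simp: ennreal_le_iff)
  show intZ: "integrable M Z" by (rule square_integrable_imp_integrable[OF _ intZ2]) simp
  have intY: "integrable M (Y n)" for n by (rule square_integrable_imp_integrable[OF _ int2]) simp
  have trunc: "\<bar>expectation W - expectation (\<lambda>\<omega>. min (W \<omega>) R)\<bar> \<le> C / R"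
    if R: "R > 0" and W: "integrable M W" "integrable M (\<lambda>\<omega>. (W \<omega>)\<^sup>2)" "expectation (\<lambda>\<omega>. (W \<omega>)\<^sup>2) \<le> C" for R W
  proof -
    have [measurable]: "W \<in> borel_measurable M" using W by auto
    have intm: "integrable M (\<lambda>\<omega>. min (W \<omega>) R)"
      by (rule Bochner_Integration.integrable_bound[of M "\<lambda>\<omega>. \<bar>W \<omega>\<bar> + R"])
         (use W R in \<open>auto intro!: AE_I2 simp: min_def\<close>)
    have pw: "0 \<le> W \<omega> - min (W \<omega>) R \<and> W \<omega> - min (W \<omega>) R \<le> (W \<omega>)\<^sup>2 / R" for \<omega>
    proof (cases "W \<omega> \<le> R")
      case False
      hence "W \<omega> * R \<le> W \<omega> * W \<omega>" using R by (intro mult_left_mono) auto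
      hence "W \<omega> \<le> (W \<omega>)\<^sup>2 / R" using R by (simp add: le_divide_eq power2_eq_square)
      thus ?thesis using False R by simp
    qed (use R in auto)
    have "expectation W - expectation (\<lambda>\<omega>. min (W \<omega>) R) = expectation (\<lambda>\<omega>. W \<omega> - min (W \<omega>) R)"
      using W intm by simp
    moreover have "0 \<le> expectation (\<lambda>\<omega>. W \<omega> - min (W \<omega>) R)" using pw by (intro integral_nonneg_AE AE_I2) auto
    moreover have "expectation (\<lambda>\<omega>. W \<omega> - min (W \<omega>) R) \<le> expectation (\<lambda>\<omega>. (W \<omega>)\<^sup>2 / R)"
      using pw W intm by (intro integral_mono) auto
    moreover have "expectation (\<lambda>\<omega>. (W \<omega>)\<^sup>2 / R) \<le> C / R" using W R by (simp add: divide_right_mono)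
    ultimately show ?thesis by simp
  qed
  show "(\<lambda>n. expectation (Y n)) \<longlonglongrightarrow> expectation Z"
  proof (rule LIMSEQ_I)
    fix r :: real assume r: "r > 0"
    \<comment> \<open>Makes C / R smaller than r / 3; the added 1 keeps R positive when C =
      0.\<close>
    define R where "R = 3 * C / r + 1"
    have R: "R > 0" unfolding R_def using C0 r by (simp add: add_nonneg_pos)
    have "C < r / 3 * R" unfolding R_def using r C0 by (simp add: field_simps)
    hence CR: "C / R < r / 3" using R by (simp add: divide_less_eq)
    have "(\<lambda>n. expectation (\<lambda>\<omega>. min (Y n \<omega>) R)) \<longlonglongrightarrow> expectation (\<lambda>\<omega>. min (Z \<omega>) R)"
    proof (rule integral_dominated_convergence[where w = "\<lambda>_. R"])
      show "AE \<omega> in M. (\<lambda>n. min (Y n \<omega>) R) \<longlonglongrightarrow> min (Z \<omega>) R"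
        using lim by eventually_elim (intro tendsto_min tendsto_const)
      show "AE \<omega> in M. norm (min (Y n \<omega>) R) \<le> R" for n using nonneg R by (intro AE_I2) (auto simp: min_def)
    qed auto
    from LIMSEQ_D[OF this, of "r / 3"] r obtain N where
      N: "\<And>n. n \<ge> N \<Longrightarrow> \<bar>expectation (\<lambda>\<omega>. min (Y n \<omega>) R) - expectation (\<lambda>\<omega>. min (Z \<omega>) R)\<bar> < r / 3" by auto
    show "\<exists>N. \<forall>n\<ge>N. norm (expectation (Y n) - expectation Z) < r"
    proof (intro exI allI impI)
      fix n assume "n \<ge> N"
      from N[OF this] trunc[OF R intY int2 C, of n] trunc[OF R intZ intZ2 EZ2] CR
      show "norm (expectation (Y n) - expectation Z) < r" unfolding real_norm_def by linarith
    qed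
  qed
qed

text \<open>\<xi> stands for - \<beta>. Convergence along all small \<epsilon> covers the rescaled
  sequences 1 / (n + 1) / sqrt s that arise from the blocks.\<close>

locale cbm_limit = cbm_kernel M X \<phi> B for M :: "'a measure" and X \<phi> B +
  fixes \<xi> :: "'a \<Rightarrow> real"
  assumes \<xi>_meas [measurable]: "\<xi> \<in> borel_measurable M"
    and \<xi>_lim: "AE \<omega> in M. ((\<lambda>\<epsilon>. xi \<epsilon> \<omega>) \<longlongrightarrow> \<xi> \<omega>) (at_right 0)"
begin

definition Mgf :: "real \<Rightarrow> real" where
  "Mgf l = expectation (\<lambda>\<omega>. exp (l * \<xi> \<omega>))"

text \<open>The square of exp (l xi) is the exponential at 2 l, so the uniform bound
  \<open>mgf_le\<close> at 2 l provides the second moments.\<close>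

lemma Mgf_limit:
  assumes e: "\<And>n. e n > 0" "e \<longlonglongrightarrow> 0" and l: "l \<ge> 0"
  shows "integrable M (\<lambda>\<omega>. exp (l * \<xi> \<omega>))" "(\<lambda>n. mgf (e n) l) \<longlonglongrightarrow> Mgf l"
proof -
  have fe: "filterlim e (at_right 0) sequentially"
  proof -
    have "e n \<noteq> 0" for n using e(1)[of n] by simp
    thus ?thesis using e by (auto simp: filterlim_at)
  qed
  have sq: "(exp (l * xi \<epsilon> \<omega>))\<^sup>2 = exp ((2 * l) * xi \<epsilon> \<omega>)" for \<epsilon> \<omega>
    by (simp add: power2_eq_square exp_add[symmetric])
  have meas: "(\<lambda>\<omega>. exp (l * xi (e n) \<omega>)) \<in> borel_measurable M" for n using e by measurable
  have meas': "(\<lambda>\<omega>. exp (l * \<xi> \<omega>)) \<in> borel_measurable M" by measurable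
  have int2: "integrable M (\<lambda>\<omega>. (exp (l * xi (e n) \<omega>))\<^sup>2)" for n
    unfolding sq by (rule exp_xi_integrable[OF e(1)])
  have bound: "expectation (\<lambda>\<omega>. (exp (l * xi (e n) \<omega>))\<^sup>2) \<le> exp (mgf_rate * (2 * l)\<^sup>2)" for n
    unfolding sq using mgf_le[OF e(1), of "2 * l" n] l by (simp add: mgf_def)
  have lim: "AE \<omega> in M. (\<lambda>n. exp (l * xi (e n) \<omega>)) \<longlonglongrightarrow> exp (l * \<xi> \<omega>)"
    using \<xi>_lim
  proof eventually_elim
    case (elim \<omega>)
    from filterlim_compose[OF elim fe] show ?case by (intro tendsto_exp tendsto_mult tendsto_const)
  qed
  note vitali = expectation_limit_second_moment[OF meas meas' exp_ge_zero int2 bound lim]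
  show "integrable M (\<lambda>\<omega>. exp (l * \<xi> \<omega>))" by (rule vitali(1))
  show "(\<lambda>n. mgf (e n) l) \<longlonglongrightarrow> Mgf l" unfolding mgf_def Mgf_def by (rule vitali(2))
qed

lemma eps_seq: "1 / real (Suc n) > 0" "(\<lambda>n. 1 / real (Suc n)) \<longlonglongrightarrow> 0"
  using LIMSEQ_inverse_real_of_nat by (simp_all add: inverse_eq_divide)

lemma exp_\<xi>_integrable: "l \<ge> 0 \<Longrightarrow> integrable M (\<lambda>\<omega>. exp (l * \<xi> \<omega>))"
  by (rule Mgf_limit(1)[OF eps_seq])

lemma Mgf_le:
  assumes "l \<ge> 0"
  shows "Mgf l \<le> exp (mgf_rate * l\<^sup>2)"
  by (rule LIMSEQ_le_const2[OF Mgf_limit(2)[OF eps_seq assms]]) (use mgf_le[OF eps_seq(1) assms] in auto)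

lemma Mgf_ge:
  assumes l: "l > 0"
  shows "exp (l * ((ln l - ln 2 - 1) / (2 * pi)) - l) \<le> Mgf l"
proof -
  \<comment> \<open>A drift with |\<mu>|^2 = l costs l in the exponent and gains l ln l / (2 pi) up
    to a linear term, which is the right leading order; its direction is arbitrary.\<close>
  define \<mu> where "\<mu> = sqrt l *\<^sub>R (axis 1 1 :: real^2)"
  have \<mu>: "(norm \<mu>)\<^sup>2 = l" unfolding \<mu>_def using l by (simp add: norm_axis_1)
  define I where "I = (\<integral>p. indicator triangle p * ((1 - exp (- l * (fst p - snd p) / 2)) / (2 * pi * (fst p - snd p))) \<partial>lborel)"
  have "exp (l * I - l) \<le> Mgf l"
  proof (rule LIMSEQ_le[OF _ Mgf_limit(2)[OF eps_seq less_imp_le[OF l]]])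
    show "(\<lambda>n. exp (l * expectation (\<lambda>\<omega>. tilt \<mu> \<omega> * xi (1 / real (Suc n)) \<omega>) - l)) \<longlonglongrightarrow> exp (l * I - l)"
      using expectation_tilt_xi_limit[OF eps_seq, of \<mu>] unfolding I_def \<mu>
      by (intro tendsto_intros)
    show "\<exists>N. \<forall>n\<ge>N. exp (l * expectation (\<lambda>\<omega>. tilt \<mu> \<omega> * xi (1 / real (Suc n)) \<omega>) - l) \<le> mgf (1 / real (Suc n)) l"
      using mgf_ge_tilt[OF eps_seq(1), of l \<mu>] unfolding \<mu> by blast
  qed
  moreover have "l * ((ln l - ln 2 - 1) / (2 * pi)) \<le> l * I"
    unfolding I_def using l by (intro mult_left_mono integral_triangle_drift_ge) auto
  ultimately show ?thesis by (smt (verit) exp_le_cancel_iff)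
qed

lemma Mgf_pos: "l > 0 \<Longrightarrow> Mgf l > 0"
  using Mgf_ge[of l] by (smt (verit) exp_gt_zero)

lemma Mgf_submultiplicative:
  assumes a: "a > 0" and b: "b > 0"
  shows "Mgf (a + b) \<le> Mgf a * Mgf b * exp (((a + b) * ln (a + b) - a * ln a - b * ln b) / (2 * pi))"
proof -
  let ?E = "((a + b) * ln (a + b) - a * ln a - b * ln b) / (2 * pi)"
  \<comment> \<open>Then (a + b) s = a and (a + b) (1 - s) = b, and the entropy of s becomes the
    defect of additivity of x ln x.\<close>
  define s where "s = a / (a + b)"
  have s: "0 < s" "s < 1" and s': "1 - s = b / (a + b)" unfolding s_def using a b by (auto simp: field_simps)
  have as: "(a + b) * s = a" "(a + b) * (1 - s) = b" unfolding s' unfolding s_def using a b by auto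
  have "(a + b) * ((- (s * ln s) - (1 - s) * ln (1 - s)) / (2 * pi)) =
      (- (((a + b) * s) * ln s) - ((a + b) * (1 - s)) * ln (1 - s)) / (2 * pi)"
    by (simp add: algebra_simps)
  also have "\<dots> = ?E"
    unfolding as unfolding s' unfolding s_def using a b by (simp add: ln_div algebra_simps)
  finally have H: "(a + b) * ((- (s * ln s) - (1 - s) * ln (1 - s)) / (2 * pi)) = ?E" .
  have ev: "(\<lambda>n. 1 / real (Suc n) / sqrt c) \<longlonglongrightarrow> 0" for c
    using tendsto_divide_zero[OF eps_seq(2)] .
  have ep: "1 / real (Suc n) / sqrt c > 0" if "c > 0" for c n using that by simp
  show ?thesis
  proof (rule LIMSEQ_le[OF Mgf_limit(2)[OF eps_seq, of "a + b"]])
    show "(\<lambda>n. mgf (1 / real (Suc n) / sqrt s) a * mgf (1 / real (Suc n) / sqrt (1 - s)) b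
        * exp (?E))
      \<longlonglongrightarrow> Mgf a * Mgf b * exp (?E)"
      using s a b by (intro tendsto_mult tendsto_const Mgf_limit(2) ev ep) auto
    show "\<exists>N. \<forall>n\<ge>N. mgf (1 / real (Suc n)) (a + b) \<le> mgf (1 / real (Suc n) / sqrt s) a * mgf (1 / real (Suc n) / sqrt (1 - s)) b
        * exp (?E)"
      using mgf_submultiplicative[OF s eps_seq(1), of "a + b"] a b unfolding as H by auto
  qed (use a b in auto)
qed

text \<open>Subtracting l ln l / (2 pi) absorbs exactly the defect in
  \<open>Mgf_submultiplicative\<close>, so Fekete's lemma applies; \<open>Mgf_ge\<close> gives the
  linear lower bound, and \<open>Mgf_le\<close> together with - t ln t \<le> 1 the local upper
  bound.\<close>

lemma Mgf_asymptotics: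
  "\<exists>\<kappa>. ((\<lambda>l. (ln (Mgf l) - l * ln l / (2 * pi)) / l) \<longlongrightarrow> \<kappa>) at_top"
proof (rule fekete_real)
  fix s t :: real assume st: "s > 0" "t > 0"
  have "ln (Mgf (s + t)) \<le> ln (Mgf s * Mgf t * exp (((s + t) * ln (s + t) - s * ln s - t * ln t) / (2 * pi)))"
    using Mgf_submultiplicative[OF st] Mgf_pos[of s] Mgf_pos[of t] Mgf_pos[of "s + t"] st by (intro ln_mono) auto
  also have "\<dots> = ln (Mgf s) + ln (Mgf t) + ((s + t) * ln (s + t) - s * ln s - t * ln t) / (2 * pi)"
    using Mgf_pos[of s] Mgf_pos[of t] st by (simp add: ln_mult)
  finally show "ln (Mgf (s + t)) - (s + t) * ln (s + t) / (2 * pi) \<le> ln (Mgf s) - s * ln s / (2 * pi) + (ln (Mgf t) - t * ln t / (2 * pi))"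
    by (simp add: diff_divide_distrib)
next
  fix T :: real
  show "\<exists>C. \<forall>t. 0 < t \<and> t \<le> T \<longrightarrow> ln (Mgf t) - t * ln t / (2 * pi) \<le> C"
  proof (intro exI allI impI)
    fix t assume t: "0 < t \<and> t \<le> T"
    have "mgf_rate \<ge> 0" unfolding mgf_rate_def by simp
    hence Kt: "mgf_rate * t\<^sup>2 \<le> mgf_rate * T\<^sup>2" using t by (intro mult_left_mono power_mono) auto
    have "ln (Mgf t) \<le> mgf_rate * t\<^sup>2" using Mgf_le[of t] Mgf_pos[of t] t by (metis less_imp_le ln_exp ln_mono)
    moreover have "- (t * ln t) \<le> 1"
    proof -
      have "ln (1 / t) \<le> 1 / t - 1" using t by (intro ln_le_minus_one) auto
      hence "t * - ln t \<le> t * (1 / t - 1)" using t by (intro mult_left_mono) (auto simp: ln_div)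
      thus ?thesis using t by (simp add: algebra_simps)
    qed
    hence "- (t * ln t) / (2 * pi) \<le> 1 / (2 * pi)" by (intro divide_right_mono) auto
    ultimately show "ln (Mgf t) - t * ln t / (2 * pi) \<le> mgf_rate * T\<^sup>2 + 1 / (2 * pi)" using Kt by simp
  qed
next
  fix t :: real assume t: "t \<ge> 1"
  have "t * ((ln t - ln 2 - 1) / (2 * pi)) - t \<le> ln (Mgf t)"
    using Mgf_ge[of t] Mgf_pos[of t] t by (simp add: ln_ge_iff)
  moreover have "t * ((ln t - ln 2 - 1) / (2 * pi)) - t = t * ln t / (2 * pi) - ((ln 2 + 1) / (2 * pi) + 1) * t"
    by (simp add: field_simps)
  ultimately show "ln (Mgf t) - t * ln t / (2 * pi) \<ge> - ((ln 2 + 1) / (2 * pi) + 1) * t"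
    unfolding mult_minus_left by linarith
qed

text \<open>Multiplying \<xi> by 2 pi turns the leading term into t ln t, the form that the
  Tauberian theorem takes, and the level ln t into ln (t powr (2 * pi)), the source of the power of
  t.\<close>

lemma upper_tail_asymptotics:
  "\<exists>L>0. ((\<lambda>t. t powr (- 2 * pi) * ln (prob {\<omega> \<in> space M. \<xi> \<omega> \<ge> ln t})) \<longlongrightarrow> - L) at_top"
proof -
  obtain \<kappa> where \<kappa>: "((\<lambda>l. (ln (Mgf l) - l * ln l / (2 * pi)) / l) \<longlongrightarrow> \<kappa>) at_top"
    using Mgf_asymptotics by blast
  \<comment> \<open>The substitution l = 2 pi t inside ln l leaves the extra constant ln (2
    pi).\<close>
  have "((\<lambda>t. 2 * pi * ((ln (Mgf (2 * pi * t)) - (2 * pi * t) * ln (2 * pi * t) / (2 * pi)) / (2 * pi * t)) + ln (2 * pi))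
      \<longlongrightarrow> 2 * pi * \<kappa> + ln (2 * pi)) at_top"
    by (intro tendsto_intros filterlim_compose[OF \<kappa>] filterlim_tendsto_pos_mult_at_top[OF tendsto_const _ filterlim_ident]) auto
  moreover have "\<forall>\<^sub>F t in at_top. 2 * pi * ((ln (Mgf (2 * pi * t)) - (2 * pi * t) * ln (2 * pi * t) / (2 * pi)) / (2 * pi * t)) + ln (2 * pi)
     = (ln (expectation (\<lambda>\<omega>. exp (t * (2 * pi * \<xi> \<omega>)))) - t * ln t) / t"
    using eventually_gt_at_top[of 0]
  proof eventually_elim
    case (elim t)
    have "expectation (\<lambda>\<omega>. exp (t * (2 * pi * \<xi> \<omega>))) = Mgf (2 * pi * t)"
      unfolding Mgf_def by (simp add: mult_ac)
    thus ?case using elim by (simp add: ln_mult field_simps)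
  qed
  ultimately have lim: "((\<lambda>t. (ln (expectation (\<lambda>\<omega>. exp (t * (2 * pi * \<xi> \<omega>)))) - t * ln t) / t) \<longlongrightarrow> 2 * pi * \<kappa> + ln (2 * pi)) at_top"
    by (rule Lim_transform_eventually)
  define L where "L = exp (- 1 - (2 * pi * \<kappa> + ln (2 * pi)))"
  have "((\<lambda>x. ln (prob {\<omega> \<in> space M. 2 * pi * \<xi> \<omega> \<ge> ln x}) / x) \<longlongrightarrow> - L) at_top"
    unfolding L_def
  proof (rule tauberian_exponential[OF _ _ lim])
    show "integrable M (\<lambda>\<omega>. exp (t * (2 * pi * \<xi> \<omega>)))" if "t > 0" for t
      using exp_\<xi>_integrable[of "t * (2 * pi)"] that by (simp add: mult.assoc)
  qed measurable
  moreover have "filterlim (\<lambda>t::real. t powr (2 * pi)) at_top at_top" by real_asymp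
  ultimately have "((\<lambda>t. ln (prob {\<omega> \<in> space M. 2 * pi * \<xi> \<omega> \<ge> ln (t powr (2 * pi))}) / (t powr (2 * pi))) \<longlongrightarrow> - L) at_top"
    by (rule filterlim_compose)
  moreover have "\<forall>\<^sub>F t in at_top. ln (prob {\<omega> \<in> space M. 2 * pi * \<xi> \<omega> \<ge> ln (t powr (2 * pi))}) / (t powr (2 * pi))
      = t powr (- 2 * pi) * ln (prob {\<omega> \<in> space M. \<xi> \<omega> \<ge> ln t})"
    using eventually_gt_at_top[of 0]
  proof eventually_elim
    case (elim t)
    have "{\<omega> \<in> space M. 2 * pi * \<xi> \<omega> \<ge> ln (t powr (2 * pi))} = {\<omega> \<in> space M. \<xi> \<omega> \<ge> ln t}"
      using elim by (simp add: ln_powr)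
    moreover have "t powr (- 2 * pi) = inverse (t powr (2 * pi))" by (simp add: powr_minus)
    ultimately show ?case by (simp add: divide_inverse mult.commute)
  qed
  ultimately have "((\<lambda>t. t powr (- 2 * pi) * ln (prob {\<omega> \<in> space M. \<xi> \<omega> \<ge> ln t})) \<longlongrightarrow> - L) at_top"
    by (rule Lim_transform_eventually)
  moreover have "L > 0" unfolding L_def by simp
  ultimately show ?thesis by blast
qed

end

section \<open>Transfer to the given motion and mollifier\<close>

lemma planar_BM_imp_cbm:
  assumes "planar_BM M X"
  shows "cbm M (\<lambda>t. X (max 0 t))"
proof -
  interpret prob_space M using assms by (simp add: planar_BM_def)
  show ?thesis
  proof
    show "X (max 0 t) \<in> borel_measurable M" for t using assms by (simp add: planar_BM_def)
    \<comment> \<open>\<open>max 0 t\<close> holds the path at its starting point for negative times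
      and so extends it continuously.\<close>
    show "continuous_on UNIV (\<lambda>t. X (max 0 t) \<omega>)" if "\<omega> \<in> space M" for \<omega>
    proof (rule continuous_on_compose2[where g = "\<lambda>t. X t \<omega>" and t = "{0..}"])
      show "continuous_on {0..} (\<lambda>t. X t \<omega>)" using assms that by (simp add: planar_BM_def)
    qed (auto intro!: continuous_intros)
    show "distributed M lborel (\<lambda>\<omega>. X (max 0 t) \<omega> - X (max 0 s) \<omega>) (\<lambda>x. ennreal (gauss2 (t - s) x))"
      if "0 \<le> s" "s < t" for s t
      using assms that by (simp add: planar_BM_def)
    fix n :: nat and tt :: "nat \<Rightarrow> real" assume tt: "0 \<le> tt 0" "\<And>i. i < n \<Longrightarrow> tt i \<le> tt (Suc i)"
    have pos: "0 \<le> tt i" if "i \<le> n" for i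
      using that
    proof (induction i)
      case (Suc i) thus ?case using tt(2)[of i] by simp
    qed (use tt in simp)
    have "indep_vars (\<lambda>_. borel) (\<lambda>i \<omega>. X (tt (Suc i)) \<omega> - X (tt i) \<omega>) {..<n}"
      using assms tt by (simp add: planar_BM_def)
    moreover have "(\<lambda>\<omega>. X (tt (Suc i)) \<omega> - X (tt i) \<omega>) = (\<lambda>\<omega>. X (max 0 (tt (Suc i))) \<omega> - X (max 0 (tt i)) \<omega>)" if "i \<in> {..<n}" for i
      using pos[of i] pos[of "Suc i"] that by (simp add: max_def)
    ultimately show "indep_vars (\<lambda>_. borel) (\<lambda>i \<omega>. X (max 0 (tt (Suc i))) \<omega> - X (max 0 (tt i)) \<omega>) {..<n}"
      by (subst indep_vars_cong[symmetric]) auto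
  qed
qed

lemma schwartz2_kernel:
  assumes S: "schwartz2 \<phi>" and nonneg: "\<And>x. \<phi> x \<ge> 0" and int: "integral\<^sup>L lborel \<phi> = 1"
  shows "\<exists>B. kernel B \<phi>"
proof -
  \<comment> \<open>The Schwartz seminorm without weight and without derivatives bounds
    \<phi>.\<close>
  have "\<exists>C. \<forall>x. norm x ^ 0 * \<bar>iter_pd [] \<phi> x\<bar> \<le> C" using S unfolding schwartz2_def by blast
  then obtain B where B: "\<And>x. \<bar>\<phi> x\<bar> \<le> B" by auto
  have "continuous_on UNIV (iter_pd [] \<phi>)" using S unfolding schwartz2_def smooth2_def by blast
  \<comment> \<open>The Bochner integral of a non-integrable function is 0, so the value 1 forces
    integrability.\<close>
  moreover have "integrable lborel \<phi>" using int not_integrable_integral_eq[of lborel \<phi>] by force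
  hence "(\<integral>\<^sup>+z. ennreal (\<phi> z) \<partial>lborel) = ennreal 1"
    using nonneg int by (subst nn_integral_eq_integral) auto
  ultimately show ?thesis unfolding kernel_def using B nonneg by (auto intro!: exI[of _ B] simp: abs_le_iff)
qed

theorem theorem1p3:
  fixes M :: "'a measure" and X :: "real \<Rightarrow> 'a \<Rightarrow> real^2"
    and \<phi> :: "real^2 \<Rightarrow> real" and \<beta> :: "'a \<Rightarrow> real"
  assumes BM: "planar_BM M X"
    and phi_schwartz: "schwartz2 \<phi>"
    and phi_nonneg: "\<And>x. \<phi> x \<ge> 0"
    and phi_int: "integral\<^sup>L lborel \<phi> = 1"
    and beta_meas: "\<beta> \<in> borel_measurable M"
    and beta_lim: "AE \<omega> in M. ((\<lambda>\<epsilon>. SI_approx \<phi> X 1 \<epsilon> \<omega>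
                       - (\<integral>\<omega>'. SI_approx \<phi> X 1 \<epsilon> \<omega>' \<partial>M)) \<longlongrightarrow> \<beta> \<omega>) (at_right 0)"
  shows "\<exists>L::real. 0 < L \<and>
    ((\<lambda>t. t powr (- 2 * pi) * ln (measure M {\<omega> \<in> space M. - \<beta> \<omega> \<ge> ln t})) \<longlongrightarrow> - L) at_top"
proof -
  obtain B where k: "kernel B \<phi>" using schwartz2_kernel[OF phi_schwartz phi_nonneg phi_int] by blast
  interpret cbm_kernel M "\<lambda>t. X (max 0 t)" \<phi> B
    using planar_BM_imp_cbm[OF BM] k by (simp add: cbm_kernel_def cbm_kernel_axioms_def)
  have SI: "SI_approx \<phi> X 1 \<epsilon> \<omega> = SI \<epsilon> \<omega>" if "\<epsilon> > 0" "\<omega> \<in> space M" for \<epsilon> \<omega>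
    unfolding SI_def
    by (rule SI_approx_eq_self_int[OF kernelD(1,4)[OF kernel_moll[OF k that(1)]] X_cont[OF that(2)]]) simp
  have lim: "AE \<omega> in M. ((\<lambda>\<epsilon>. xi \<epsilon> \<omega>) \<longlongrightarrow> - \<beta> \<omega>) (at_right 0)"
    using beta_lim AE_space
  proof eventually_elim
    case (elim \<omega>)
    \<comment> \<open>\<open>SI_approx\<close> and \<open>SI\<close> agree on the whole space for
      each \<epsilon> > 0, so their means agree too; positive \<epsilon> are all that a limit from
      the right sees.\<close>
    have "\<forall>\<^sub>F \<epsilon> in at_right 0. - (SI_approx \<phi> X 1 \<epsilon> \<omega> - (\<integral>\<omega>'. SI_approx \<phi> X 1 \<epsilon> \<omega>' \<partial>M)) = xi \<epsilon> \<omega>"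
      using eventually_at_right_less[of "0::real"]
    proof eventually_elim
      case (elim \<epsilon>)
      have "(\<integral>\<omega>'. SI_approx \<phi> X 1 \<epsilon> \<omega>' \<partial>M) = expectation (SI \<epsilon>)"
        using SI[OF elim] by (intro Bochner_Integration.integral_cong) auto
      thus ?case using SI[OF elim \<open>\<omega> \<in> space M\<close>] by (simp add: xi_def)
    qed
    from Lim_transform_eventually[OF tendsto_minus[OF elim(1)] this] show ?case .
  qed
  interpret cbm_limit M "\<lambda>t. X (max 0 t)" \<phi> B "\<lambda>\<omega>. - \<beta> \<omega>"
    by unfold_locales (use beta_meas lim in auto)
  show ?thesis using upper_tail_asymptotics by simp
qed

end
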